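(* Let $X_1,\dots,X_n$ be a piecewise locally stationary process with $E[X_j]=0$ and $\|X_j\|_2<\infty$ for all $j$, with local autocovariances $\gamma(t,h)$ and local spectral density $f(t,\lambda)$ as in the context. Let $\lambda=\lambda_n$ be a sequence of frequencies and let $$I_n(\lambda)=\frac1{2\pi n}\Big|\sum_{j=1}^nX_j\exp(ij\lambda)\Big|^2 .$$ Assume that for some $p\ge1$, $\gamma(t,h)$ is $\mathcal C^p$ in $t$ on $(d_k,d_{k+1}]$ for every $h$ and $k=0,\dots,r$; that $\delta_X(k,4)=O(\rho^k)$ for some $\rho\in[0,1)$; that $\|G_k(t,\mathcal F_0)-G_k(s,\mathcal F_0)\|_4\le C|t-s|$ for all $t,s\in[d_k,d_{k+1}]$, $k=0,\dots,r$, for some $C<\infty$; and that $\inf_{t\in[0,1]}f(t,\lambda)>0$. (i) If $0<\lambda_*\le\lambda\le\lambda^*<\pi$ for some constants $\lambda_*,\lambda^*$, then $$I_n(\lambda)\Big/\int_0^1f(t,\lambda)\,dt\Rightarrow\operatorname{Exp}(1)\quad\text{as }n\to\infty,$$ where $\operatorname{Exp}(1)$ is the exponential distribution with mean $1$. (ii) If $\lambda=0$ or $\lambda=\pi$, then $I_n(\lambda)/\int_0^1f(t,\lambda)\,dt$ converges in distribution to a $\chi^2(1)$ random variable.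
   Context: Notation: $t_k=k/n$; $\|Y\|_p=(E|Y|^p)^{1/p}$; $i=\sqrt{-1}$; $\Rightarrow$ denotes weak convergence. Piecewise locally stationary model: there are an integer $r\ge0$ and nonrandom points $0=d_0<d_1<\dots<d_r<d_{r+1}=1$ such that $$X_k=\sum_{j=0}^rG_j(t_k,\mathcal F_k)\mathbf 1\{d_j<t_k\le d_{j+1}\},\qquad k=1,\dots,n,$$ where $\mathcal F_k=(\dots,\varepsilon_{k-1},\varepsilon_k)$, $(\varepsilon_k)_{k\in\mathbb Z}$ are i.i.d. random variables and $G_j$ are measurable real functions of $(t,\mathcal F)$, $t\in(d_j,d_{j+1}]$, understood to be defined also at $t=d_j$ when closed intervals are used. Dependence measures: $\delta_X(k,p)=\max_{0\le l\le r}\sup_{t\in(d_l,d_{l+1}]}\|G_l(t,\mathcal F_0)-G_l(t,\mathcal F_{0,-k})\|_p$, where $\mathcal F_{0,-k}$ is $\mathcal F_0$ with $\varepsilon_{-k}$ replaced by $\varepsilon'_{-k}$, and $(\varepsilon'_j)$ is an independent i.i.d. copy of $(\varepsilon_j)$. Local spectral density: $\zeta(t)=k$ if $d_k<t\le d_{k+1}$ and $\zeta(0)=0$; $\gamma(t,k)=\operatorname{Cov}[G_{\zeta(t)}(t,\mathcal F_0),G_{\zeta(t)}(t,\mathcal F_k)]$; $f(t,\lambda)=\frac1{2\pi}\sum_{k=-\infty}^\infty\gamma(t,k)\cos(k\lambda)$.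
   Formalization: The condition inf over t in [0,1] of f(t,λ) > 0 is taken uniformly along the sequence: f(t,λ_n) ≥ c > 0 for all n and t; with positivity only for each n separately, part (i) fails, e.g. for a noninvertible MA(2) with λ_n tending fast to a zero of f. *)

theory Defs
  imports "HOL-Probability.Probability"
begin

text \<open>
  \<open>||Y||_p = (E|Y|^p)^(1/p)\<close>, extended-real valued so that \<open>lp_norm M p Y < \<top>\<close> really says
  that the \<open>p\<close>-th moment is finite.
\<close>

definition lp_norm :: "'a measure \<Rightarrow> real \<Rightarrow> ('a \<Rightarrow> real) \<Rightarrow> ennreal" where
  "lp_norm M p Y =
     (let m = (\<integral>\<^sup>+ \<omega>. ennreal (\<bar>Y \<omega>\<bar> powr p) \<partial>M)
      in if m = \<top> then \<top> else ennreal (enn2real m powr (1 / p)))"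

definition covariance :: "'a measure \<Rightarrow> ('a \<Rightarrow> real) \<Rightarrow> ('a \<Rightarrow> real) \<Rightarrow> real" where
  "covariance M Y Z =
     (\<integral>\<omega>. (Y \<omega> - (\<integral>\<omega>'. Y \<omega>' \<partial>M)) * (Z \<omega> - (\<integral>\<omega>'. Z \<omega>' \<partial>M)) \<partial>M)"

text \<open>
  All variables of the two families are jointly independent and share one distribution; thus
  \<open>\<epsilon>'\<close> is an independent copy of the i.i.d. family \<open>\<epsilon>\<close>.
\<close>

definition iid_with_copy ::
    "'a measure \<Rightarrow> (int \<Rightarrow> 'a \<Rightarrow> real) \<Rightarrow> (int \<Rightarrow> 'a \<Rightarrow> real) \<Rightarrow> bool" where
  "iid_with_copy M \<epsilon> \<epsilon>' \<longleftrightarrow>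
     prob_space.indep_vars M (\<lambda>_. borel) (case_sum \<epsilon> \<epsilon>') UNIV \<and>
     (\<forall>k. distr M borel (\<epsilon> k) = distr M borel (\<epsilon> 0)) \<and>
     (\<forall>k. distr M borel (\<epsilon>' k) = distr M borel (\<epsilon> 0))"

text \<open>
  The history \<open>F_k = (\<dots>, \<epsilon>_{k-1}, \<epsilon>_k)\<close> is stored backwards: coordinate \<open>i\<close> is \<open>\<epsilon>_{k-i}\<close>.
  In \<open>F_{0,-k}\<close> the entry \<open>\<epsilon>_{-k}\<close>, i.e. coordinate \<open>k\<close>, is replaced by \<open>\<epsilon>'_{-k}\<close>.
\<close>

definition history :: "(int \<Rightarrow> 'a \<Rightarrow> real) \<Rightarrow> int \<Rightarrow> 'a \<Rightarrow> nat \<Rightarrow> real" where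
  "history \<epsilon> k \<omega> = (\<lambda>i. \<epsilon> (k - int i) \<omega>)"

definition coupled_history ::
    "(int \<Rightarrow> 'a \<Rightarrow> real) \<Rightarrow> (int \<Rightarrow> 'a \<Rightarrow> real) \<Rightarrow> nat \<Rightarrow> 'a \<Rightarrow> nat \<Rightarrow> real" where
  "coupled_history \<epsilon> \<epsilon>' k \<omega> = (history \<epsilon> 0 \<omega>)(k := \<epsilon>' (- int k) \<omega>)"

definition break_points :: "nat \<Rightarrow> (nat \<Rightarrow> real) \<Rightarrow> bool" where
  "break_points r d \<longleftrightarrow> d 0 = 0 \<and> d (Suc r) = 1 \<and> (\<forall>j\<le>r. d j < d (Suc j))"

text \<open>Joint measurability in \<open>(t, F)\<close>, with \<open>t\<close> in the closed interval.\<close>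

definition measurable_filters ::
    "nat \<Rightarrow> (nat \<Rightarrow> real) \<Rightarrow> (nat \<Rightarrow> real \<Rightarrow> (nat \<Rightarrow> real) \<Rightarrow> real) \<Rightarrow> bool" where
  "measurable_filters r d G \<longleftrightarrow>
     (\<forall>j\<le>r. (\<lambda>(t, x). G j t x) \<in>
        borel_measurable (restrict_space borel {d j..d (Suc j)} \<Otimes>\<^sub>M Pi\<^sub>M UNIV (\<lambda>_. borel)))"

text \<open>\<open>pls_process r d G \<epsilon> n k\<close> is the \<open>k\<close>-th observation of the sample of size \<open>n\<close>.\<close>

definition pls_process ::
    "nat \<Rightarrow> (nat \<Rightarrow> real) \<Rightarrow> (nat \<Rightarrow> real \<Rightarrow> (nat \<Rightarrow> real) \<Rightarrow> real) \<Rightarrow> (int \<Rightarrow> 'a \<Rightarrow> real)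
      \<Rightarrow> nat \<Rightarrow> nat \<Rightarrow> 'a \<Rightarrow> real" where
  "pls_process r d G \<epsilon> n k \<omega> =
     (\<Sum>j\<le>r. G j (real k / real n) (history \<epsilon> (int k) \<omega>)
              * indicator {d j<..d (Suc j)} (real k / real n))"

definition dependence_measure ::
    "'a measure \<Rightarrow> nat \<Rightarrow> (nat \<Rightarrow> real) \<Rightarrow> (nat \<Rightarrow> real \<Rightarrow> (nat \<Rightarrow> real) \<Rightarrow> real)
      \<Rightarrow> (int \<Rightarrow> 'a \<Rightarrow> real) \<Rightarrow> (int \<Rightarrow> 'a \<Rightarrow> real) \<Rightarrow> nat \<Rightarrow> real \<Rightarrow> ennreal" where
  "dependence_measure M r d G \<epsilon> \<epsilon>' k p =
     (MAX l\<in>{..r}. SUP t\<in>{d l<..d (Suc l)}.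
        lp_norm M p (\<lambda>\<omega>. G l t (history \<epsilon> 0 \<omega>) - G l t (coupled_history \<epsilon> \<epsilon>' k \<omega>)))"

definition regime :: "nat \<Rightarrow> (nat \<Rightarrow> real) \<Rightarrow> real \<Rightarrow> nat" where
  "regime r d t = (if t = 0 then 0 else (THE k. k \<le> r \<and> d k < t \<and> t \<le> d (Suc k)))"

definition local_acov ::
    "'a measure \<Rightarrow> nat \<Rightarrow> (nat \<Rightarrow> real) \<Rightarrow> (nat \<Rightarrow> real \<Rightarrow> (nat \<Rightarrow> real) \<Rightarrow> real)
      \<Rightarrow> (int \<Rightarrow> 'a \<Rightarrow> real) \<Rightarrow> real \<Rightarrow> int \<Rightarrow> real" where
  "local_acov M r d G \<epsilon> t k =
     covariance M (\<lambda>\<omega>. G (regime r d t) t (history \<epsilon> 0 \<omega>))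
                  (\<lambda>\<omega>. G (regime r d t) t (history \<epsilon> k \<omega>))"

definition local_spec ::
    "'a measure \<Rightarrow> nat \<Rightarrow> (nat \<Rightarrow> real) \<Rightarrow> (nat \<Rightarrow> real \<Rightarrow> (nat \<Rightarrow> real) \<Rightarrow> real)
      \<Rightarrow> (int \<Rightarrow> 'a \<Rightarrow> real) \<Rightarrow> real \<Rightarrow> real \<Rightarrow> real" where
  "local_spec M r d G \<epsilon> t l =
     1 / (2 * pi) * (\<Sum>\<^sub>\<infinity>k\<in>UNIV. local_acov M r d G \<epsilon> t k * cos (of_int k * l))"

text \<open>
  \<open>g\<close> is \<open>p\<close> times continuously differentiable on \<open>S\<close>, with one-sided derivatives at those end
  points of an interval \<open>S\<close> that belong to it; \<open>D m\<close> is the \<open>m\<close>-th derivative.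
\<close>

definition Cp_on :: "nat \<Rightarrow> real set \<Rightarrow> (real \<Rightarrow> real) \<Rightarrow> bool" where
  "Cp_on p S g \<longleftrightarrow>
     (\<exists>D :: nat \<Rightarrow> real \<Rightarrow> real.
        (\<forall>t\<in>S. D 0 t = g t) \<and>
        (\<forall>m<p. \<forall>t\<in>S. (D m has_real_derivative D (Suc m) t) (at t within S)) \<and>
        continuous_on S (D p))"

definition periodogram :: "(nat \<Rightarrow> 'a \<Rightarrow> real) \<Rightarrow> nat \<Rightarrow> real \<Rightarrow> 'a \<Rightarrow> real" where
  "periodogram X n l \<omega> =
     1 / (2 * pi * real n) *
       (cmod (\<Sum>j=1..n. complex_of_real (X j \<omega>) * exp (\<i> * of_nat j * complex_of_real l)))\<^sup>2"

text \<open>\<open>exponential_dist l\<close> has rate \<open>l\<close>, hence mean \<open>1 / l\<close>.\<close>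

definition exponential_dist :: "real \<Rightarrow> real measure" where
  "exponential_dist l = density lborel (\<lambda>x. ennreal (exponential_density l x))"

text \<open>The chi-squared law with one degree of freedom: the law of the square of a standard normal.\<close>

definition chi_square_1 :: "real measure" where
  "chi_square_1 = distr (density lborel (\<lambda>x. ennreal (std_normal_density x))) borel (\<lambda>z. z\<^sup>2)"

end

theory Submission
  imports Defs
begin

text \<open>
  Up to normalisation the periodogram is \<open>C\<^sup>2 + S\<^sup>2\<close>, where \<open>C\<close> and \<open>S\<close> are the cosine and the sine
  transform of the sample. The theorem follows from a central limit theorem for the linear
  combinations \<open>a C + b S\<close>, which are weighted sums of the observations with weights of order
  \<open>n\<^bsup>-1/2\<^esup>\<close>.

  \<^bold>\<open>Dependence.\<close> The history up to a time \<open>a\<close> can be replaced by the independent copy of the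
  innovations. This leaves the law of a later block of observations unchanged, makes the block
  independent of everything up to time \<open>a\<close>, and moves an observation at time \<open>k\<close> by
  \<open>O(\<rho>\<^bsup>k - a\<^esup>)\<close> in \<open>L\<^sup>4\<close> (\<open>filter_coupling\<close>): the coordinates are exchanged one at a time, each exchange
  costs one dependence coefficient, and the limit of infinitely many exchanges is justified in \<open>L\<^sup>1\<close>
  (\<open>L1_draw_conv\<close>). Hence covariances decay geometrically and characteristic functions of sums over
  separated index sets nearly factorise (\<open>covariance_decouple\<close>, \<open>iexp_decouple\<close>). The same coupling
  yields finite fourth moments (\<open>filter_L4\<close>).

  \<^bold>\<open>Normality.\<close> These two facts are all that Bernstein's blocking method needs (\<open>blocking_bound\<close>,
  \<open>blocking_clt\<close>): short gaps separate long blocks, the characteristic function of the sum is almost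
  the product over the blocks, and each block is expanded to second order. Blocks of length
  \<open>n\<^bsup>1/5\<^esup>\<close> are so short that the crude \<open>L\<^sup>4\<close> triangle inequality controls the remainder.

  \<^bold>\<open>Variance.\<close> The variance is sorted by the lag \<open>h\<close>. A product of two weights at distance \<open>h\<close> is
  \<open>\<kappa> cos (h \<lambda>)\<close> plus a term of frequency \<open>2 \<lambda>\<close>. The constant part turns the covariances into a Riemann
  sum of \<open>\<gamma>(t, h)\<close>. The oscillating part has bounded partial sums while the covariances vary slowly
  along the sample, so it averages out (\<open>lagged_average_tendsto\<close>). Summing over \<open>h\<close> gives
  \<open>2 \<pi> \<kappa>\<close> times the integrated spectral density (\<open>variance_tendsto\<close>, \<open>integral_local_spec\<close>). For
  interior frequencies \<open>\<kappa> = (a\<^sup>2 + b\<^sup>2) / 2\<close>; for \<open>\<lambda> = 0\<close> and \<open>\<lambda> = \<pi>\<close> the sine transform vanishes and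
  \<open>\<kappa> = a\<^sup>2\<close>.

  \<^bold>\<open>Limit laws.\<close> In the second case Levy's theorem and the map \<open>z \<mapsto> z\<^sup>2\<close> give the chi-squared law. In the
  first case integrating the joint characteristic function against Gaussian weights produces
  \<open>E exp (- k (C\<^sup>2 + S\<^sup>2)) \<longlonglongrightarrow> 1 / (1 + k)\<close> for every natural \<open>k\<close>. These are the moments of
  \<open>exp (- (C\<^sup>2 + S\<^sup>2))\<close>, which therefore converges to the uniform law, and \<open>- ln\<close> of a uniform
  variable is exponential (\<open>weak_conv_m_exponential\<close>).
\<close>

section \<open>Fourth moments\<close>

text \<open>
  The ball of radius \<open>B\<close> in \<open>L\<^sup>4\<close>. Bounding the extended integral makes the existence of the fourth
  moment part of the statement.
\<close>

definition L4_le :: "'a measure \<Rightarrow> ('a \<Rightarrow> real) \<Rightarrow> real \<Rightarrow> bool" where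
  "L4_le M Y B \<longleftrightarrow>
     Y \<in> borel_measurable M \<and> 0 \<le> B \<and> (\<integral>\<^sup>+ \<omega>. ennreal (Y \<omega> ^ 4) \<partial>M) \<le> ennreal (B ^ 4)"

lemma L4_le_measurable: "L4_le M Y B \<Longrightarrow> Y \<in> borel_measurable M"
  and L4_le_nonneg: "L4_le M Y B \<Longrightarrow> 0 \<le> B"
  by (auto simp: L4_le_def)

lemma L4_le_mono: "L4_le M Y B \<Longrightarrow> B \<le> C \<Longrightarrow> L4_le M Y C"
  unfolding L4_le_def by (meson order_trans ennreal_leI power_mono)

lemma L4_le_integrable_pow4:
  assumes "L4_le M Y B" shows "integrable M (\<lambda>\<omega>. Y \<omega> ^ 4)"
  using assms by (intro integrableI_nonneg) (auto simp: L4_le_def top_unique less_top[symmetric])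

lemma L4_le_integral_pow4:
  assumes "L4_le M Y B" shows "(\<integral>\<omega>. Y \<omega> ^ 4 \<partial>M) \<le> B ^ 4"
proof -
  have "ennreal (\<integral>\<omega>. Y \<omega> ^ 4 \<partial>M) = (\<integral>\<^sup>+ \<omega>. ennreal (Y \<omega> ^ 4) \<partial>M)"
    by (subst nn_integral_eq_integral) (auto intro: L4_le_integrable_pow4[OF assms])
  also have "\<dots> \<le> ennreal (B ^ 4)" using assms by (simp add: L4_le_def)
  finally show ?thesis by simp
qed

lemma L4_le_iff_integral:
  "L4_le M Y B \<longleftrightarrow> Y \<in> borel_measurable M \<and> 0 \<le> B \<and> integrable M (\<lambda>\<omega>. Y \<omega> ^ 4)
     \<and> (\<integral>\<omega>. Y \<omega> ^ 4 \<partial>M) \<le> B ^ 4"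
proof
  assume "L4_le M Y B"
  then show "Y \<in> borel_measurable M \<and> 0 \<le> B \<and> integrable M (\<lambda>\<omega>. Y \<omega> ^ 4)
     \<and> (\<integral>\<omega>. Y \<omega> ^ 4 \<partial>M) \<le> B ^ 4"
    using L4_le_integrable_pow4[of M Y B] L4_le_integral_pow4[of M Y B] by (auto simp: L4_le_def)
next
  assume *: "Y \<in> borel_measurable M \<and> 0 \<le> B \<and> integrable M (\<lambda>\<omega>. Y \<omega> ^ 4)
     \<and> (\<integral>\<omega>. Y \<omega> ^ 4 \<partial>M) \<le> B ^ 4"
  then show "L4_le M Y B"
    unfolding L4_le_def by (subst nn_integral_eq_integral) auto
qed

lemma L4_le_zero_AE:
  assumes "L4_le M Y 0" shows "AE \<omega> in M. Y \<omega> = 0"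
proof -
  have [measurable]: "Y \<in> borel_measurable M" using assms by (rule L4_le_measurable)
  have "(\<integral>\<^sup>+ \<omega>. ennreal (Y \<omega> ^ 4) \<partial>M) = 0" using assms by (simp add: L4_le_def)
  then have "AE \<omega> in M. ennreal (Y \<omega> ^ 4) = 0" by (subst (asm) nn_integral_0_iff_AE) auto
  then show ?thesis
    by eventually_elim (auto simp: ennreal_eq_0_iff power_le_zero_eq)
qed

lemma L4_le_AE_cong:
  assumes "L4_le M Y B" "AE \<omega> in M. Y \<omega> = Z \<omega>" "Z \<in> borel_measurable M"
  shows "L4_le M Z B"
proof -
  have "(\<integral>\<^sup>+ \<omega>. ennreal (Y \<omega> ^ 4) \<partial>M) = (\<integral>\<^sup>+ \<omega>. ennreal (Z \<omega> ^ 4) \<partial>M)"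
    using assms(2) by (intro nn_integral_cong_AE) auto
  then show ?thesis using assms by (simp add: L4_le_def)
qed

lemma L4_le_scale:
  assumes "L4_le M Y B" shows "L4_le M (\<lambda>\<omega>. c * Y \<omega>) (\<bar>c\<bar> * B)"
proof -
  have "integrable M (\<lambda>\<omega>. c ^ 4 * Y \<omega> ^ 4)" "c ^ 4 * (\<integral>\<omega>. Y \<omega> ^ 4 \<partial>M) \<le> c ^ 4 * B ^ 4"
    using assms by (simp_all add: L4_le_iff_integral mult_left_mono)
  moreover have "(\<lambda>\<omega>. c * Y \<omega>) \<in> borel_measurable M"
    using L4_le_measurable[OF assms] by measurable
  ultimately show ?thesis
    using L4_le_nonneg[OF assms] unfolding L4_le_iff_integral power_mult_distrib by simp
qed

lemma (in prob_space) L4_le_const: "L4_le M (\<lambda>_. c) \<bar>c\<bar>"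
  unfolding L4_le_iff_integral by (simp add: prob_space)

text \<open>
  Minkowski's inequality in \<open>L\<^sup>4\<close>: after normalising both summands to fourth moment one, it is
  convexity of \<open>x \<mapsto> x\<^sup>4\<close> at the weights \<open>A / (A + B)\<close> and \<open>B / (A + B)\<close>.
\<close>

lemma L4_le_add:
  assumes Y: "L4_le M Y A" and Z: "L4_le M Z B"
  shows "L4_le M (\<lambda>\<omega>. Y \<omega> + Z \<omega>) (A + B)"
proof -
  have [measurable]: "Y \<in> borel_measurable M" "Z \<in> borel_measurable M"
    using Y Z by (auto dest: L4_le_measurable)
  consider "A = 0" | "B = 0" | "A > 0" "B > 0"
    using L4_le_nonneg[OF Y] L4_le_nonneg[OF Z] by linarith
  then show ?thesis
  proof cases
    case 1
    have "AE \<omega> in M. Z \<omega> = Y \<omega> + Z \<omega>" using L4_le_zero_AE[of M Y] Y 1 by auto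
    from L4_le_AE_cong[OF Z this] show ?thesis using 1 by simp
  next
    case 2
    have "AE \<omega> in M. Y \<omega> = Y \<omega> + Z \<omega>" using L4_le_zero_AE[of M Z] Z 2 by auto
    from L4_le_AE_cong[OF Y this] show ?thesis using 2 by simp
  next
    case 3
    let ?S = "A + B"
    have S: "?S > 0" using 3 by simp
    have weight: "1 - B / ?S = A / ?S" using S by (simp add: field_simps)
    have pw: "(y + z) ^ 4 \<le> ?S ^ 3 * (y ^ 4 / A ^ 3 + z ^ 4 / B ^ 3)" for y z :: real
    proof -
      have "((A / ?S) *\<^sub>R (y / A) + (B / ?S) *\<^sub>R (z / B)) ^ 4
          \<le> (A / ?S) * (y / A) ^ 4 + (B / ?S) * (z / B) ^ 4"
        using 3 convex_onD[OF convex_power_even[of 4], of "B / ?S" "y / A" "z / B"] weight by auto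
      also have "((A / ?S) *\<^sub>R (y / A) + (B / ?S) *\<^sub>R (z / B)) = (y + z) / ?S"
        using 3 by (simp add: add_divide_distrib)
      finally have "((y + z) / ?S) ^ 4 \<le> (A / ?S) * (y / A) ^ 4 + (B / ?S) * (z / B) ^ 4" .
      then have "?S ^ 4 * ((y + z) / ?S) ^ 4 \<le> ?S ^ 4 * ((A / ?S) * (y / A) ^ 4 + (B / ?S) * (z / B) ^ 4)"
        using S by (intro mult_left_mono) auto
      also have "?S ^ 4 * ((y + z) / ?S) ^ 4 = (y + z) ^ 4" using S by (simp add: power_divide)
      also have "?S ^ 4 * ((A / ?S) * (y / A) ^ 4 + (B / ?S) * (z / B) ^ 4)
          = ?S ^ 3 * (y ^ 4 / A ^ 3 + z ^ 4 / B ^ 3)"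
        proof -
        have "?S ^ 4 * ((A / ?S) * (y / A) ^ 4) = ?S ^ 3 * (y ^ 4 / A ^ 3)"
          "?S ^ 4 * ((B / ?S) * (z / B) ^ 4) = ?S ^ 3 * (z ^ 4 / B ^ 3)"
          using 3 S unfolding power_divide by (simp_all add: divide_simps power4_eq_xxxx power3_eq_cube)
        then show ?thesis by (simp only: distrib_left)
      qed
      finally show ?thesis .
    qed
    let ?R = "\<lambda>\<omega>. ?S ^ 3 * (Y \<omega> ^ 4 / A ^ 3 + Z \<omega> ^ 4 / B ^ 3)"
    have R: "integrable M ?R"
      using L4_le_integrable_pow4[OF Y] L4_le_integrable_pow4[OF Z] by auto
    have I: "integrable M (\<lambda>\<omega>. (Y \<omega> + Z \<omega>) ^ 4)"
      by (rule Bochner_Integration.integrable_bound[OF R])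
        (use pw in \<open>auto intro!: AE_I2 order_trans[OF _ abs_ge_self]\<close>)
    have "(\<integral>\<omega>. (Y \<omega> + Z \<omega>) ^ 4 \<partial>M) \<le> (\<integral>\<omega>. ?R \<omega> \<partial>M)"
      by (intro integral_mono I R pw)
    also have "\<dots> = ?S ^ 3 * ((\<integral>\<omega>. Y \<omega> ^ 4 \<partial>M) / A ^ 3 + (\<integral>\<omega>. Z \<omega> ^ 4 \<partial>M) / B ^ 3)"
      using L4_le_integrable_pow4[OF Y] L4_le_integrable_pow4[OF Z] by simp
    also have "\<dots> \<le> ?S ^ 3 * (A ^ 4 / A ^ 3 + B ^ 4 / B ^ 3)"
      using 3 L4_le_integral_pow4[OF Y] L4_le_integral_pow4[OF Z]
      by (intro mult_left_mono add_mono divide_right_mono) auto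
    also have "\<dots> = ?S ^ 4"
      using 3 by (simp add: power4_eq_xxxx power3_eq_cube)
    finally show ?thesis using 3 I by (simp add: L4_le_iff_integral)
  qed
qed

lemma L4_le_zero: "L4_le M (\<lambda>_. 0) 0"
  by (simp add: L4_le_def)

lemma L4_le_sum:
  assumes "\<And>i. i \<in> I \<Longrightarrow> L4_le M (Y i) (B i)"
  shows "L4_le M (\<lambda>\<omega>. \<Sum>i\<in>I. Y i \<omega>) (\<Sum>i\<in>I. B i)"
  using assms
  by (induction I rule: infinite_finite_induct) (auto simp: L4_le_zero intro: L4_le_add)

text \<open>
  On a probability space the fourth-moment bounds multiply: with both factors normalised,
  \<open>\<bar>a b\<bar> \<le> (2 + a\<^sup>4 + b\<^sup>4) / 4\<close>, whose expectation is at most one.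
\<close>

lemma (in prob_space) L4_le_mult:
  assumes Y: "L4_le M Y A" and Z: "L4_le M Z B"
  shows "integrable M (\<lambda>\<omega>. Y \<omega> * Z \<omega>)" and "expectation (\<lambda>\<omega>. \<bar>Y \<omega> * Z \<omega>\<bar>) \<le> A * B"
proof -
  have [measurable]: "Y \<in> borel_measurable M" "Z \<in> borel_measurable M"
    using Y Z by (auto dest: L4_le_measurable)
  have "integrable M (\<lambda>\<omega>. Y \<omega> * Z \<omega>) \<and> expectation (\<lambda>\<omega>. \<bar>Y \<omega> * Z \<omega>\<bar>) \<le> A * B"
  proof (cases "A = 0 \<or> B = 0")
    case True
    then have "AE \<omega> in M. Y \<omega> * Z \<omega> = 0"
      using L4_le_zero_AE[of M Y] L4_le_zero_AE[of M Z] Y Z by auto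
    then have "integrable M (\<lambda>\<omega>. Y \<omega> * Z \<omega>) = integrable M (\<lambda>\<omega>. 0 :: real)"
      "expectation (\<lambda>\<omega>. \<bar>Y \<omega> * Z \<omega>\<bar>) = expectation (\<lambda>\<omega>. 0)"
      by (intro integrable_cong_AE integral_cong_AE; simp)+
    then show ?thesis using True by auto
  next
    case False
    then have AB: "A > 0" "B > 0" using L4_le_nonneg[OF Y] L4_le_nonneg[OF Z] by auto
    have pw: "\<bar>y * z\<bar> \<le> A * B * ((2 + y ^ 4 / A ^ 4 + z ^ 4 / B ^ 4) / 4)" for y z :: real
    proof -
      define a b where "a = \<bar>y\<bar> / A" and "b = \<bar>z\<bar> / B"
      have "0 \<le> (a - b)\<^sup>2" "0 \<le> (a\<^sup>2 - 1)\<^sup>2" "0 \<le> (b\<^sup>2 - 1)\<^sup>2" by auto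
      then have "a * b \<le> (2 + a ^ 4 + b ^ 4) / 4"
        by (simp add: power2_eq_square power4_eq_xxxx algebra_simps)
      moreover have "\<bar>y * z\<bar> = A * B * (a * b)" using AB by (simp add: a_def b_def abs_mult)
      ultimately have "\<bar>y * z\<bar> \<le> A * B * ((2 + a ^ 4 + b ^ 4) / 4)"
        using AB by (simp only: mult_left_mono mult_nonneg_nonneg less_imp_le)
      then show ?thesis by (simp add: a_def b_def power_divide)
    qed
    let ?R = "\<lambda>\<omega>. A * B * ((2 + Y \<omega> ^ 4 / A ^ 4 + Z \<omega> ^ 4 / B ^ 4) / 4)"
    have R: "integrable M ?R"
      using L4_le_integrable_pow4[OF Y] L4_le_integrable_pow4[OF Z] by auto
    have I: "integrable M (\<lambda>\<omega>. Y \<omega> * Z \<omega>)"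
      by (rule Bochner_Integration.integrable_bound[OF R])
        (use pw in \<open>auto intro!: AE_I2 order_trans[OF _ abs_ge_self]\<close>)
    have "expectation (\<lambda>\<omega>. \<bar>Y \<omega> * Z \<omega>\<bar>) \<le> expectation ?R"
      by (intro integral_mono integrable_abs I R pw)
    also have "\<dots> = A * B * ((2 + expectation (\<lambda>\<omega>. Y \<omega> ^ 4) / A ^ 4 + expectation (\<lambda>\<omega>. Z \<omega> ^ 4) / B ^ 4) / 4)"
      using L4_le_integrable_pow4[OF Y] L4_le_integrable_pow4[OF Z] by (simp add: prob_space)
    also have "\<dots> \<le> A * B * ((2 + A ^ 4 / A ^ 4 + B ^ 4 / B ^ 4) / 4)"
      using AB L4_le_integral_pow4[OF Y] L4_le_integral_pow4[OF Z]
      by (intro mult_left_mono divide_right_mono add_mono) auto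
    also have "\<dots> = A * B" using AB by simp
    finally show ?thesis using I by simp
  qed
  then show "integrable M (\<lambda>\<omega>. Y \<omega> * Z \<omega>)" "expectation (\<lambda>\<omega>. \<bar>Y \<omega> * Z \<omega>\<bar>) \<le> A * B"
    by auto
qed

lemma (in prob_space) L4_le_expectation_mult:
  assumes "L4_le M Y A" "L4_le M Z B"
  shows "\<bar>expectation (\<lambda>\<omega>. Y \<omega> * Z \<omega>)\<bar> \<le> A * B"
  using integral_abs_bound[of M "\<lambda>\<omega>. Y \<omega> * Z \<omega>"] L4_le_mult(2)[OF assms] by linarith

lemma (in prob_space) L4_le_integrable: "L4_le M Y B \<Longrightarrow> integrable M Y"
  using L4_le_mult(1)[OF _ L4_le_const[of 1]] by simp

lemma (in prob_space) L4_le_expectation_abs: "L4_le M Y B \<Longrightarrow> expectation (\<lambda>\<omega>. \<bar>Y \<omega>\<bar>) \<le> B"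
  using L4_le_mult(2)[OF _ L4_le_const[of 1], of Y B] by simp

lemma (in prob_space) L4_le_square:
  assumes "L4_le M Y B"
  shows "integrable M (\<lambda>\<omega>. (Y \<omega>)\<^sup>2)" and "expectation (\<lambda>\<omega>. (Y \<omega>)\<^sup>2) \<le> B\<^sup>2"
  using L4_le_mult[OF assms assms] by (auto simp: power2_eq_square)

lemma (in prob_space) L4_le_cube:
  assumes "L4_le M Y B"
  shows "integrable M (\<lambda>\<omega>. \<bar>Y \<omega>\<bar> ^ 3)" and "expectation (\<lambda>\<omega>. \<bar>Y \<omega>\<bar> ^ 3) \<le> 2 * B ^ 3"
proof -
  have [measurable]: "Y \<in> borel_measurable M" using assms by (rule L4_le_measurable)
  have I4: "integrable M (\<lambda>\<omega>. Y \<omega> ^ 4)" by (rule L4_le_integrable_pow4[OF assms])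
  have pw1: "\<bar>y\<bar> ^ 3 \<le> 1 + y ^ 4" for y :: real
  proof (cases "\<bar>y\<bar> \<le> 1")
    case True then show ?thesis using power_le_one[of "\<bar>y\<bar>" 3] zero_le_even_power[of 4 y]
      by (simp add: add_increasing2)
  next
    case False then show ?thesis using power_increasing[of 3 4 "\<bar>y\<bar>"] by (simp add: power_even_abs)
  qed
  show I: "integrable M (\<lambda>\<omega>. \<bar>Y \<omega>\<bar> ^ 3)"
    by (rule Bochner_Integration.integrable_bound[of M "\<lambda>\<omega>. 1 + Y \<omega> ^ 4"])
      (use pw1 I4 in \<open>auto intro!: AE_I2 order_trans[OF _ abs_ge_self]\<close>)
  show "expectation (\<lambda>\<omega>. \<bar>Y \<omega>\<bar> ^ 3) \<le> 2 * B ^ 3"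
  proof (cases "B = 0")
    case True
    then have "AE \<omega> in M. Y \<omega> = 0" using L4_le_zero_AE[of M Y] assms by auto
    then have "expectation (\<lambda>\<omega>. \<bar>Y \<omega>\<bar> ^ 3) = expectation (\<lambda>\<omega>. 0)"
      by (intro integral_cong_AE) auto
    then show ?thesis using True by simp
  next
    case False
    then have B: "B > 0" using L4_le_nonneg[OF assms] by auto
    have pw: "\<bar>y\<bar> ^ 3 \<le> B ^ 3 * (1 + y ^ 4 / B ^ 4)" for y
      using mult_left_mono[OF pw1[of "y / B"], of "B ^ 3"] B by (simp add: power_divide)
    have "expectation (\<lambda>\<omega>. \<bar>Y \<omega>\<bar> ^ 3) \<le> expectation (\<lambda>\<omega>. B ^ 3 * (1 + Y \<omega> ^ 4 / B ^ 4))"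
      by (intro integral_mono I pw) (use I4 in auto)
    also have "\<dots> = B ^ 3 * (1 + expectation (\<lambda>\<omega>. Y \<omega> ^ 4) / B ^ 4)"
      using I4 by (simp add: prob_space)
    also have "\<dots> \<le> B ^ 3 * (1 + B ^ 4 / B ^ 4)"
      using B L4_le_integral_pow4[OF assms] by (intro mult_left_mono add_mono divide_right_mono) auto
    finally show ?thesis using B by simp
  qed
qed

text \<open>Fatou's lemma: along an almost surely convergent subsequence the bound passes to the limit.\<close>

lemma L4_le_L1_limit:
  assumes Y: "\<And>N. L4_le M (Y N) B" and Z: "Z \<in> borel_measurable M"
    and I: "\<And>N. integrable M (\<lambda>\<omega>. Y N \<omega> - Z \<omega>)"
    and lim: "(\<lambda>N. \<integral>\<omega>. \<bar>Y N \<omega> - Z \<omega>\<bar> \<partial>M) \<longlonglongrightarrow> 0"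
  shows "L4_le M Z B"
proof -
  have [measurable]: "Y N \<in> borel_measurable M" for N using Y by (rule L4_le_measurable)
  note Z[measurable]
  from tendsto_L1_AE_subseq[of M "\<lambda>N \<omega>. Y N \<omega> - Z \<omega>"] I lim
  obtain s where "AE \<omega> in M. (\<lambda>N. Y (s N) \<omega> - Z \<omega>) \<longlonglongrightarrow> 0" by auto
  then have AE: "AE \<omega> in M. ennreal (Z \<omega> ^ 4) = liminf (\<lambda>N. ennreal (Y (s N) \<omega> ^ 4))"
  proof eventually_elim
    case (elim \<omega>)
    then have "(\<lambda>N. Y (s N) \<omega>) \<longlonglongrightarrow> Z \<omega>" by (rule LIM_zero_cancel)
    then have "(\<lambda>N. ennreal (Y (s N) \<omega> ^ 4)) \<longlonglongrightarrow> ennreal (Z \<omega> ^ 4)"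
      by (intro tendsto_ennrealI tendsto_power)
    then show ?case by (rule lim_imp_Liminf[OF sequentially_bot, symmetric])
  qed
  have "(\<integral>\<^sup>+ \<omega>. ennreal (Z \<omega> ^ 4) \<partial>M) = (\<integral>\<^sup>+ \<omega>. liminf (\<lambda>N. ennreal (Y (s N) \<omega> ^ 4)) \<partial>M)"
    by (intro nn_integral_cong_AE AE)
  also have "\<dots> \<le> liminf (\<lambda>N. \<integral>\<^sup>+ \<omega>. ennreal (Y (s N) \<omega> ^ 4) \<partial>M)"
    by (intro nn_integral_liminf) auto
  also have "\<dots> \<le> ennreal (B ^ 4)"
    using Y by (intro Liminf_le) (auto simp: L4_le_def)
  finally show ?thesis using Y[of 0] by (simp add: L4_le_def)
qed

text \<open>
  The slack between \<open>B\<close> and \<open>C\<close> absorbs constants of either sign: \<open>ennreal\<close> cuts a negative \<open>B\<close> off at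
  zero.
\<close>

lemma lp_norm_4_le_imp_L4_le:
  assumes Y: "Y \<in> borel_measurable M" and "lp_norm M 4 Y \<le> ennreal B" and "B \<le> C" "0 \<le> C"
  shows "L4_le M Y C"
proof -
  let ?m = "\<integral>\<^sup>+ \<omega>. ennreal (Y \<omega> ^ 4) \<partial>M"
  have eq: "(\<integral>\<^sup>+ \<omega>. ennreal (\<bar>Y \<omega>\<bar> powr 4) \<partial>M) = ?m"
    by (intro nn_integral_cong) (simp add: powr_numeral power_even_abs)
  have fin: "?m \<noteq> \<top>" using assms(2) by (auto simp: lp_norm_def eq Let_def top_unique split: if_splits)
  have "ennreal (enn2real ?m powr (1 / 4)) \<le> ennreal C"
    using assms(2) fin ennreal_leI[OF \<open>B \<le> C\<close>] by (auto simp: lp_norm_def eq Let_def)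
  then have "enn2real ?m powr (1 / 4) \<le> C" using \<open>0 \<le> C\<close> by simp
  then have "(enn2real ?m powr (1 / 4)) ^ 4 \<le> C ^ 4" by (intro power_mono) auto
  also have "(enn2real ?m powr (1 / 4)) ^ 4 = enn2real ?m"
    by (cases "enn2real ?m = 0") (auto simp: powr_power)
  finally have "ennreal (enn2real ?m) \<le> ennreal (C ^ 4)" by (rule ennreal_leI)
  then have "?m \<le> ennreal (C ^ 4)" using fin by (simp only: ennreal_enn2real less_top)
  then show ?thesis using Y \<open>0 \<le> C\<close> by (simp add: L4_le_def)
qed

section \<open>The innovations and their replacement by an independent copy\<close>

locale iid_pair = prob_space M for M :: "'a measure" +
  fixes \<epsilon> \<epsilon>' :: "int \<Rightarrow> 'a \<Rightarrow> real"
  assumes iid: "iid_with_copy M \<epsilon> \<epsilon>'"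
begin

text \<open>
  Innovations and copies form one i.i.d. family indexed by \<open>int + int\<close>. Histories, coupled histories
  and all the resampled sequences below are selections from this family, described by the index map
  \<open>\<sigma>\<close> alone.
\<close>

definition noise :: "int + int \<Rightarrow> 'a \<Rightarrow> real" where
  "noise = case_sum \<epsilon> \<epsilon>'"

definition draw :: "('i \<Rightarrow> int + int) \<Rightarrow> 'a \<Rightarrow> 'i \<Rightarrow> real" where
  "draw \<sigma> \<omega> = (\<lambda>i. noise (\<sigma> i) \<omega>)"

abbreviation (input) law :: "real measure" where
  "law \<equiv> distr M borel (\<epsilon> 0)"

lemma indep_noise: "indep_vars (\<lambda>_. borel) noise UNIV"
  using iid by (simp add: iid_with_copy_def noise_def)

lemma measurable_noise[measurable]: "noise s \<in> borel_measurable M"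
  using indep_noise by (simp add: indep_vars_def2)

lemma distr_noise: "distr M borel (noise s) = law"
  using iid by (cases s) (simp_all add: iid_with_copy_def noise_def)

lemma measurable_draw[measurable]:
  "draw \<sigma> \<in> M \<rightarrow>\<^sub>M Pi\<^sub>M UNIV (\<lambda>_. borel)"
  unfolding draw_def[abs_def] by (rule measurable_PiM_single') auto

lemma prob_space_law: "prob_space law"
  using measurable_noise[of "Inl 0"] by (intro prob_space_distr) (simp add: noise_def)

lemma distr_draw:
  fixes \<sigma> :: "'i \<Rightarrow> int + int"
  assumes "inj \<sigma>"
  shows "distr M (Pi\<^sub>M UNIV (\<lambda>_. borel)) (draw \<sigma>) = Pi\<^sub>M UNIV (\<lambda>_. law)"
proof -
  have restrict_UNIV: "(\<lambda>\<omega>. \<lambda>s\<in>UNIV. noise s \<omega>) = (\<lambda>\<omega> s. noise s \<omega>)" by (simp add: fun_eq_iff)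
  have all: "distr M (Pi\<^sub>M UNIV (\<lambda>_. borel)) (\<lambda>\<omega> s. noise s \<omega>) = Pi\<^sub>M UNIV (\<lambda>_. law)"
    using indep_vars_iff_distr_eq_PiM[of UNIV noise "\<lambda>_. borel"] indep_noise
    by (simp add: distr_noise restrict_UNIV)
  have [measurable]: "(\<lambda>\<omega> s. noise s \<omega>) \<in> M \<rightarrow>\<^sub>M Pi\<^sub>M UNIV (\<lambda>_. borel)"
    by (rule measurable_PiM_single') auto
  have re: "(\<lambda>z i. z (\<sigma> i)) \<in> Pi\<^sub>M UNIV (\<lambda>_. borel) \<rightarrow>\<^sub>M Pi\<^sub>M UNIV (\<lambda>_. borel :: real measure)"
    by (rule measurable_PiM_single') auto
  have "distr M (Pi\<^sub>M UNIV (\<lambda>_. borel)) (draw \<sigma>)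
      = distr (distr M (Pi\<^sub>M UNIV (\<lambda>_. borel)) (\<lambda>\<omega> s. noise s \<omega>)) (Pi\<^sub>M UNIV (\<lambda>_. borel)) (\<lambda>z i. z (\<sigma> i))"
    by (subst distr_distr) (auto simp: re comp_def draw_def[abs_def])
  also have "\<dots> = distr (Pi\<^sub>M UNIV (\<lambda>_. law)) (Pi\<^sub>M UNIV (\<lambda>_. law)) (\<lambda>z i. z (\<sigma> i))"
    unfolding all by (intro distr_cong refl sets_PiM_cong) auto
  also have "\<dots> = Pi\<^sub>M UNIV (\<lambda>_. law)"
    using distr_PiM_reindex[of UNIV "\<lambda>_. law" \<sigma> UNIV] assms prob_space_law by (simp add: restrict_def)
  finally show ?thesis .
qed

text \<open>
  Since the innovations are exchangeable with their copies, the law of a functional does not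
  depend on which distinct innovations it is fed with; this one principle gives stationarity and
  the invariance of every coupling used below.
\<close>

lemma expectation_draw_eq:
  fixes \<phi> :: "_ \<Rightarrow> 'b::{banach, second_countable_topology}"
  assumes "inj \<sigma>" "inj \<tau>" "\<phi> \<in> borel_measurable (Pi\<^sub>M UNIV (\<lambda>_. borel))"
  shows "expectation (\<lambda>\<omega>. \<phi> (draw \<sigma> \<omega>)) = expectation (\<lambda>\<omega>. \<phi> (draw \<tau> \<omega>))"
proof -
  have "expectation (\<lambda>\<omega>. \<phi> (draw \<sigma> \<omega>)) = integral\<^sup>L (Pi\<^sub>M UNIV (\<lambda>_. law)) \<phi>" if "inj \<sigma>" for \<sigma>
    using that assms(3) by (subst distr_draw[OF that, symmetric]) (simp add: integral_distr)
  from this[OF assms(1)] this[OF assms(2)] show ?thesis by simp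
qed

lemma integrable_draw_iff:
  fixes \<phi> :: "_ \<Rightarrow> 'b::{banach, second_countable_topology}"
  assumes "inj \<sigma>" "\<phi> \<in> borel_measurable (Pi\<^sub>M UNIV (\<lambda>_. borel))"
  shows "integrable M (\<lambda>\<omega>. \<phi> (draw \<sigma> \<omega>)) \<longleftrightarrow> integrable (Pi\<^sub>M UNIV (\<lambda>_. law)) \<phi>"
  using assms by (subst distr_draw[OF assms(1), symmetric]) (simp add: integrable_distr_eq)

lemma L4_le_draw:
  assumes "inj \<sigma>" "inj \<tau>" "\<phi> \<in> borel_measurable (Pi\<^sub>M UNIV (\<lambda>_. borel))"
    and "L4_le M (\<lambda>\<omega>. \<phi> (draw \<sigma> \<omega>)) B"
  shows "L4_le M (\<lambda>\<omega>. \<phi> (draw \<tau> \<omega>)) B"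
proof -
  note [measurable] = assms(3)
  have "(\<integral>\<^sup>+ \<omega>. ennreal (\<phi> (draw \<sigma> \<omega>) ^ 4) \<partial>M) = (\<integral>\<^sup>+ z. ennreal (\<phi> z ^ 4) \<partial>Pi\<^sub>M UNIV (\<lambda>_. law))"
    if "inj \<sigma>" for \<sigma>
    by (subst distr_draw[OF that, symmetric]) (subst nn_integral_distr; measurable)
  then show ?thesis using assms by (simp add: L4_le_def)
qed

lemma indep_draw:
  fixes \<Phi> :: "('i \<Rightarrow> real) \<Rightarrow> 'b::topological_space" and \<Psi> :: "('j \<Rightarrow> real) \<Rightarrow> 'b"
  assumes disj: "range \<sigma> \<inter> range \<tau> = {}"
    and \<Phi>: "\<Phi> \<in> borel_measurable (Pi\<^sub>M UNIV (\<lambda>_. borel))"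
    and \<Psi>: "\<Psi> \<in> borel_measurable (Pi\<^sub>M UNIV (\<lambda>_. borel))"
  shows "indep_var borel (\<lambda>\<omega>. \<Phi> (draw \<sigma> \<omega>)) borel (\<lambda>\<omega>. \<Psi> (draw \<tau> \<omega>))"
proof -
  have re1: "(\<lambda>z i. z (\<sigma> i)) \<in> Pi\<^sub>M (range \<sigma>) (\<lambda>_. borel) \<rightarrow>\<^sub>M Pi\<^sub>M UNIV (\<lambda>_. borel :: real measure)"
    by (rule measurable_PiM_single') auto
  have re2: "(\<lambda>z i. z (\<tau> i)) \<in> Pi\<^sub>M (range \<tau>) (\<lambda>_. borel) \<rightarrow>\<^sub>M Pi\<^sub>M UNIV (\<lambda>_. borel :: real measure)"
    by (rule measurable_PiM_single') auto
  from indep_var_compose[OF indep_var_restrict[OF indep_noise disj]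
      measurable_compose[OF re1 \<Phi>] measurable_compose[OF re2 \<Psi>]]
  show ?thesis by (simp add: comp_def draw_def[abs_def])
qed

text \<open>
  Index maps that converge coordinatewise are eventually indistinguishable to a cylinder set. This
  extends to all measurable sets because the resampled sequences all have the same law, which makes
  the tail of a disjoint union uniformly small.
\<close>

lemma measure_draw_conv:
  fixes \<sigma> :: "nat \<Rightarrow> 'i \<Rightarrow> int + int"
  assumes inj: "\<And>N. inj (\<sigma> N)" "inj \<tau>"
    and ev: "\<And>i. \<forall>\<^sub>F N in sequentially. \<sigma> N i = \<tau> i"
    and A: "A \<in> sets (Pi\<^sub>M UNIV (\<lambda>_. borel))"
  shows "(\<lambda>N. expectation (\<lambda>\<omega>. \<bar>indicator A (draw (\<sigma> N) \<omega>) - indicator A (draw \<tau> \<omega>)\<bar> :: real)) \<longlonglongrightarrow> 0"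
proof -
  let ?S = "Pi\<^sub>M (UNIV :: 'i set) (\<lambda>_. borel :: real measure)"
  let ?Q = "\<lambda>A. (\<lambda>N. expectation (\<lambda>\<omega>. \<bar>indicator A (draw (\<sigma> N) \<omega>) - indicator A (draw \<tau> \<omega>)\<bar> :: real)) \<longlonglongrightarrow> 0"
  have sets_eq: "sets ?S = sigma_sets (\<Pi>\<^sub>E i\<in>UNIV. space borel) (prod_algebra UNIV (\<lambda>_. borel))"
    by (rule sets_PiM)
  from A have A': "A \<in> sigma_sets (\<Pi>\<^sub>E i\<in>UNIV. space borel) (prod_algebra UNIV (\<lambda>_. borel :: real measure))"
    by (simp add: sets_eq)
  show ?thesis
    using Int_stable_prod_algebra prod_algebra_sets_into_space A'
  proof (induction rule: sigma_sets_induct_disjoint)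
    case (basic A)
    then obtain J E where A: "A = prod_emb UNIV (\<lambda>_. borel :: real measure) J (Pi\<^sub>E J E)" and J: "finite J"
      by (elim prod_algebraE) auto
    have memA: "z \<in> A \<longleftrightarrow> (\<forall>j\<in>J. z j \<in> E j)" for z
      unfolding A prod_emb_def
      by (simp add: PiE_def Pi_def space_PiM restrict_def extensional_def Ball_def)
    have "\<forall>\<^sub>F N in sequentially. \<forall>j\<in>J. \<sigma> N j = \<tau> j"
      using J ev by (simp add: eventually_ball_finite_distrib)
    then have "\<forall>\<^sub>F N in sequentially.
        expectation (\<lambda>\<omega>. \<bar>indicator A (draw (\<sigma> N) \<omega>) - indicator A (draw \<tau> \<omega>)\<bar> :: real) = 0"
    proof eventually_elim
      case (elim N)
      then have "draw (\<sigma> N) \<omega> \<in> A \<longleftrightarrow> draw \<tau> \<omega> \<in> A" for \<omega>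
        unfolding memA draw_def by (metis (no_types))
      then have "(\<lambda>\<omega>. \<bar>indicator A (draw (\<sigma> N) \<omega>) - indicator A (draw \<tau> \<omega>)\<bar> :: real) = (\<lambda>_. 0)"
        by (auto simp: fun_eq_iff indicator_def)
      then show ?case by simp
    qed
    then show ?case by (rule tendsto_eventually)
  next
    case empty
    then show ?case by simp
  next
    case (compl A)
    have "\<bar>indicator ((\<Pi>\<^sub>E i\<in>UNIV. space borel) - A) x - indicator ((\<Pi>\<^sub>E i\<in>UNIV. space borel) - A) y\<bar>
        = (\<bar>indicator A x - indicator A y\<bar> :: real)" for x y :: "'i \<Rightarrow> real"
      by (auto simp: indicator_def)
    then show ?case using compl by simp
  next
    case (union A)
    have Am: "A i \<in> sets ?S" for i using union(2) by (auto simp: sets_eq)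
    note [measurable] = Am
    let ?P = "Pi\<^sub>M (UNIV :: 'i set) (\<lambda>_. law)"
    interpret P: prob_space ?P by (intro prob_space_PiM prob_space_law)
    have setsP: "sets ?P = sets ?S" by (intro sets_PiM_cong) auto
    have AP[measurable]: "A i \<in> sets ?P" for i using Am by (simp add: setsP)
    define T where "T m = (\<Union>i. A (i + m))" for m
    have Tm[measurable]: "T m \<in> sets ?S" for m unfolding T_def by measurable
    have PT: "(\<lambda>m. P.prob (T m)) \<longlonglongrightarrow> 0"
    proof -
      have "T (Suc m) \<subseteq> T m" for m
      proof
        fix z assume "z \<in> T (Suc m)"
        then obtain i where "z \<in> A (i + Suc m)" unfolding T_def by blast
        then have "z \<in> A (Suc i + m)" by simp
        then show "z \<in> T m" unfolding T_def by blast
      qed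
      then have dec: "decseq T" by (simp add: decseq_Suc_iff)
      have "(\<Inter>m. T m) = {}"
      proof -
        have False if "\<forall>m. z \<in> T m" for z
        proof -
          from that obtain i where i: "z \<in> A i" unfolding T_def by blast
          from that[rule_format, of "Suc i"] obtain j where "z \<in> A (j + Suc i)" unfolding T_def by blast
          moreover have "A i \<inter> A (j + Suc i) = {}"
            using \<open>disjoint_family A\<close> by (simp add: disjoint_family_on_def)
          ultimately show False using i by blast
        qed
        then show ?thesis by auto
      qed
      moreover have "(\<lambda>m. P.prob (T m)) \<longlonglongrightarrow> P.prob (\<Inter>m. T m)"
        by (intro P.finite_Lim_measure_decseq dec) (auto simp: setsP image_subset_iff)
      ultimately show ?thesis by simp
    qed
    have ET: "expectation (\<lambda>\<omega>. indicator (T m) (draw \<sigma> \<omega>)) = P.prob (T m)" if "inj \<sigma>" for m \<sigma>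
    proof -
      have "expectation (\<lambda>\<omega>. indicator (T m) (draw \<sigma> \<omega>) :: real) = (\<integral>z. indicator (T m) z \<partial>distr M ?S (draw \<sigma>))"
        by (subst integral_distr) auto
      then show ?thesis using distr_draw[OF that] by (simp add: setsP)
    qed
    have split: "(indicator (\<Union>i. A i) z :: real) = (\<Sum>i<m. indicator (A i) z) + indicator (T m) z" for m z
    proof -
      have U: "(\<Union>i. A i) = (\<Union>i<m. A i) \<union> T m"
      proof (intro equalityI subsetI)
        fix z assume "z \<in> (\<Union>i. A i)"
        then obtain i where i: "z \<in> A i" by blast
        show "z \<in> (\<Union>i<m. A i) \<union> T m"
        proof (cases "i < m")
          case False
          then have "z \<in> A ((i - m) + m)" using i by simp
          then show ?thesis unfolding T_def by blast
        qed (use i in blast)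
      qed (auto simp: T_def)
      have disj: "(\<Union>i<m. A i) \<inter> T m = {}"
      proof -
        have False if "i < m" "z \<in> A i" "z \<in> A (j + m)" for i j z
        proof -
          have "i \<noteq> j + m" using that by auto
          then have "A i \<inter> A (j + m) = {}"
            using \<open>disjoint_family A\<close> by (auto simp: disjoint_family_on_def)
          then show False using that by auto
        qed
        then show ?thesis unfolding T_def by blast
      qed
      have "indicator (\<Union>i<m. A i) z = (\<Sum>i<m. indicator (A i) z :: real)"
        by (rule indicator_UN_disjoint)
          (use \<open>disjoint_family A\<close> in \<open>auto simp: disjoint_family_on_def\<close>)
      moreover have "indicator ((\<Union>i<m. A i) \<union> T m) z = (indicator (\<Union>i<m. A i) z + indicator (T m) z :: real)"
        using disj by (cases "z \<in> T m"; cases "z \<in> (\<Union>i<m. A i)") (auto simp: indicator_def)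
      ultimately show ?thesis unfolding U by simp
    qed
    have ind_int: "integrable M (\<lambda>\<omega>. \<bar>indicator B (draw \<sigma> \<omega>) - indicator B (draw \<tau> \<omega>)\<bar> :: real)"
      if "B \<in> sets ?S" for B and \<sigma> \<tau> :: "'i \<Rightarrow> int + int"
      using that by (intro integrable_const_bound[where B = 1]) (auto simp: indicator_def)
    have ind_int1: "integrable M (\<lambda>\<omega>. indicator B (draw \<sigma> \<omega>) :: real)"
      if "B \<in> sets ?S" for B and \<sigma> :: "'i \<Rightarrow> int + int"
      using that by (intro integrable_const_bound[where B = 1]) (auto simp: indicator_def)
    let ?E = "\<lambda>N B. expectation (\<lambda>\<omega>. \<bar>indicator B (draw (\<sigma> N) \<omega>) - indicator B (draw \<tau> \<omega>)\<bar> :: real)"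
    have bound: "?E N (\<Union>i. A i) \<le> (\<Sum>i<m. ?E N (A i)) + 2 * P.prob (T m)" for N m
    proof -
      have "?E N (\<Union>i. A i) \<le> expectation (\<lambda>\<omega>. (\<Sum>i<m. \<bar>indicator (A i) (draw (\<sigma> N) \<omega>) - indicator (A i) (draw \<tau> \<omega>)\<bar>)
           + (indicator (T m) (draw (\<sigma> N) \<omega>) + indicator (T m) (draw \<tau> \<omega>)))"
      proof (intro integral_mono Bochner_Integration.integrable_add Bochner_Integration.integrable_sum ind_int ind_int1)
        fix \<omega>
        have "\<bar>(\<Sum>i<m. indicator (A i) (draw (\<sigma> N) \<omega>)) - (\<Sum>i<m. indicator (A i) (draw \<tau> \<omega>))\<bar>
           \<le> (\<Sum>i<m. \<bar>indicator (A i) (draw (\<sigma> N) \<omega>) - indicator (A i) (draw \<tau> \<omega>)\<bar> :: real)"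
          unfolding sum_subtractf[symmetric] by (rule sum_abs)
        moreover have "\<bar>indicator (T m) (draw (\<sigma> N) \<omega>) - indicator (T m) (draw \<tau> \<omega>)\<bar>
           \<le> (indicator (T m) (draw (\<sigma> N) \<omega>) + indicator (T m) (draw \<tau> \<omega>) :: real)"
          by (auto simp: indicator_def)
        ultimately show "\<bar>indicator (\<Union>i. A i) (draw (\<sigma> N) \<omega>) - indicator (\<Union>i. A i) (draw \<tau> \<omega>)\<bar>
          \<le> (\<Sum>i<m. \<bar>indicator (A i) (draw (\<sigma> N) \<omega>) - indicator (A i) (draw \<tau> \<omega>)\<bar>)
           + (indicator (T m) (draw (\<sigma> N) \<omega>) + indicator (T m) (draw \<tau> \<omega>) :: real)"
          unfolding split[of _ m] by linarith
      qed (auto intro: Am Tm)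
      also have "\<dots> = (\<Sum>i<m. ?E N (A i)) + 2 * P.prob (T m)"
        by (simp add: ind_int ind_int1 ET inj integral_sum)
      finally show ?thesis .
    qed
    show ?case
    proof (rule LIMSEQ_I)
      fix e :: real assume "0 < e"
      from order_tendstoD(2)[OF PT, of "e / 4"] \<open>0 < e\<close>
      obtain m where m: "P.prob (T m) < e / 4" by (auto simp: eventually_sequentially)
      have "(\<lambda>N. \<Sum>i<m. ?E N (A i)) \<longlonglongrightarrow> (\<Sum>i<m. 0)"
        by (intro tendsto_sum union(3))
      then have "\<forall>\<^sub>F N in sequentially. (\<Sum>i<m. ?E N (A i)) < e / 2"
        using \<open>0 < e\<close> by (intro order_tendstoD(2)) auto
      then have "\<forall>\<^sub>F N in sequentially. norm (?E N (\<Union>i. A i) - 0) < e"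
      proof eventually_elim
        case (elim N)
        have "0 \<le> ?E N (\<Union>i. A i)" by simp
        with bound[of N m] elim m show ?case by auto
      qed
      then show "\<exists>no. \<forall>n\<ge>no. norm (?E n (\<Union>i. A i) - 0) < e" by (simp add: eventually_sequentially)
    qed
  qed
qed

text \<open>
  Approximating \<open>\<psi>\<close> in \<open>L\<^sup>1\<close> by simple functions costs the same for all the resampled sequences, since
  they share one law.
\<close>

lemma L1_draw_conv:
  fixes \<sigma> :: "nat \<Rightarrow> 'i \<Rightarrow> int + int" and \<psi> :: "('i \<Rightarrow> real) \<Rightarrow> real"
  assumes inj: "\<And>N. inj (\<sigma> N)" "inj \<tau>"
    and ev: "\<And>i. \<forall>\<^sub>F N in sequentially. \<sigma> N i = \<tau> i"
    and \<psi>: "integrable (Pi\<^sub>M UNIV (\<lambda>_. law)) \<psi>"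
  shows "(\<lambda>N. expectation (\<lambda>\<omega>. \<bar>\<psi> (draw (\<sigma> N) \<omega>) - \<psi> (draw \<tau> \<omega>)\<bar>)) \<longlonglongrightarrow> 0"
proof -
  let ?S = "Pi\<^sub>M (UNIV :: 'i set) (\<lambda>_. borel :: real measure)"
  let ?P = "Pi\<^sub>M (UNIV :: 'i set) (\<lambda>_. law)"
  have setsP: "sets ?P = sets ?S" by (intro sets_PiM_cong) auto
  have PI: "integrable M (\<lambda>\<omega>. \<phi> (draw \<sigma> \<omega>))" if "integrable ?P \<phi>" "inj \<sigma>" for \<phi> :: "_ \<Rightarrow> real" and \<sigma>
    using that integrable_draw_iff[of \<sigma> \<phi>] borel_measurable_integrable[of ?P \<phi>]
    by (simp add: measurable_cong_sets[OF setsP refl])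
  have PE: "expectation (\<lambda>\<omega>. \<phi> (draw \<sigma> \<omega>)) = integral\<^sup>L ?P \<phi>" if "integrable ?P \<phi>" "inj \<sigma>" for \<phi> :: "_ \<Rightarrow> real" and \<sigma>
    using that borel_measurable_integrable[of ?P \<phi>]
    by (subst distr_draw[OF that(2), symmetric]) (simp add: integral_distr measurable_cong_sets[OF setsP refl])
  show ?thesis using \<psi>
  proof (induction rule: integrable_induct)
    case (base A c)
    have "(\<lambda>N. \<bar>c\<bar> * expectation (\<lambda>\<omega>. \<bar>indicator A (draw (\<sigma> N) \<omega>) - indicator A (draw \<tau> \<omega>)\<bar> :: real)) \<longlonglongrightarrow> \<bar>c\<bar> * 0"
      using base(1) by (intro tendsto_mult_left measure_draw_conv inj ev) (simp add: setsP)
    moreover have "\<bar>indicator A x *\<^sub>R c - indicator A y *\<^sub>R c\<bar> = \<bar>c\<bar> * \<bar>indicator A x - indicator A y\<bar>" for x y :: "'i \<Rightarrow> real"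
      by (auto simp: indicator_def)
    ultimately show ?case by simp
  next
    case (add f g)
    have lim0: "(\<lambda>N. expectation (\<lambda>\<omega>. \<bar>f (draw (\<sigma> N) \<omega>) - f (draw \<tau> \<omega>)\<bar>) + expectation (\<lambda>\<omega>. \<bar>g (draw (\<sigma> N) \<omega>) - g (draw \<tau> \<omega>)\<bar>)) \<longlonglongrightarrow> 0"
      using tendsto_add[OF add(3,4)] by simp
    show ?case
    proof (rule Lim_null_comparison[OF _ lim0])
      show "\<forall>\<^sub>F N in sequentially. norm (expectation (\<lambda>\<omega>. \<bar>f (draw (\<sigma> N) \<omega>) + g (draw (\<sigma> N) \<omega>) - (f (draw \<tau> \<omega>) + g (draw \<tau> \<omega>))\<bar>))
        \<le> expectation (\<lambda>\<omega>. \<bar>f (draw (\<sigma> N) \<omega>) - f (draw \<tau> \<omega>)\<bar>) + expectation (\<lambda>\<omega>. \<bar>g (draw (\<sigma> N) \<omega>) - g (draw \<tau> \<omega>)\<bar>)"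
      proof (intro always_eventually allI)
        fix N
        note I = PI[OF add(1) inj(1)[of N]] PI[OF add(1) inj(2)] PI[OF add(2) inj(1)[of N]] PI[OF add(2) inj(2)]
        have "expectation (\<lambda>\<omega>. \<bar>f (draw (\<sigma> N) \<omega>) + g (draw (\<sigma> N) \<omega>) - (f (draw \<tau> \<omega>) + g (draw \<tau> \<omega>))\<bar>)
          \<le> expectation (\<lambda>\<omega>. \<bar>f (draw (\<sigma> N) \<omega>) - f (draw \<tau> \<omega>)\<bar> + \<bar>g (draw (\<sigma> N) \<omega>) - g (draw \<tau> \<omega>)\<bar>)"
          by (intro integral_mono) (use I in auto)
        then show "norm (expectation (\<lambda>\<omega>. \<bar>f (draw (\<sigma> N) \<omega>) + g (draw (\<sigma> N) \<omega>) - (f (draw \<tau> \<omega>) + g (draw \<tau> \<omega>))\<bar>))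
        \<le> expectation (\<lambda>\<omega>. \<bar>f (draw (\<sigma> N) \<omega>) - f (draw \<tau> \<omega>)\<bar>) + expectation (\<lambda>\<omega>. \<bar>g (draw (\<sigma> N) \<omega>) - g (draw \<tau> \<omega>)\<bar>)"
          using I by simp
      qed
    qed
  next
    case (lim f s)
    have dI: "integrable ?P (\<lambda>z. \<bar>f z - s i z\<bar>)" for i using lim(1,4) by auto
    have L: "(\<lambda>i. integral\<^sup>L ?P (\<lambda>z. \<bar>f z - s i z\<bar>)) \<longlonglongrightarrow> integral\<^sup>L ?P (\<lambda>_. 0)"
    proof (rule integral_dominated_convergence[where w = "\<lambda>z. 3 * \<bar>f z\<bar>"])
      show "AE z in ?P. (\<lambda>i. \<bar>f z - s i z\<bar>) \<longlonglongrightarrow> 0"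
      proof (rule AE_I2)
        fix z assume "z \<in> space ?P"
        from tendsto_diff[OF tendsto_const lim(2)[OF this], of "f z"]
        show "(\<lambda>i. \<bar>f z - s i z\<bar>) \<longlonglongrightarrow> 0" by (simp add: tendsto_rabs_zero)
      qed
      show "AE z in ?P. norm \<bar>f z - s i z\<bar> \<le> 3 * \<bar>f z\<bar>" for i
      proof (rule AE_I2)
        fix z assume "z \<in> space ?P"
        from lim(3)[OF this, of i] show "norm \<bar>f z - s i z\<bar> \<le> 3 * \<bar>f z\<bar>" by simp
      qed
    qed (use lim(1,4) dI in auto)
    show ?case
    proof (rule LIMSEQ_I)
      fix e :: real assume "0 < e"
      from order_tendstoD(2)[OF L, of "e / 4"] \<open>0 < e\<close>
      obtain i where i: "integral\<^sup>L ?P (\<lambda>z. \<bar>f z - s i z\<bar>) < e / 4" by (auto simp: eventually_sequentially)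
      have "\<forall>\<^sub>F N in sequentially. expectation (\<lambda>\<omega>. \<bar>s i (draw (\<sigma> N) \<omega>) - s i (draw \<tau> \<omega>)\<bar>) < e / 2"
        using \<open>0 < e\<close> by (intro order_tendstoD(2)[OF lim(5)]) auto
      then have "\<forall>\<^sub>F N in sequentially. norm (expectation (\<lambda>\<omega>. \<bar>f (draw (\<sigma> N) \<omega>) - f (draw \<tau> \<omega>)\<bar>) - 0) < e"
      proof eventually_elim
        case (elim N)
        note I = PI[OF dI inj(1)[of N], of i] PI[OF dI inj(2), of i] PI[OF lim(4) inj(1)[of N]] PI[OF lim(4) inj(2)]
          PI[OF lim(1) inj(1)[of N], of i] PI[OF lim(1) inj(2), of i]
        have "expectation (\<lambda>\<omega>. \<bar>f (draw (\<sigma> N) \<omega>) - f (draw \<tau> \<omega>)\<bar>)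
          \<le> expectation (\<lambda>\<omega>. (\<bar>f (draw (\<sigma> N) \<omega>) - s i (draw (\<sigma> N) \<omega>)\<bar> + \<bar>f (draw \<tau> \<omega>) - s i (draw \<tau> \<omega>)\<bar>)
             + \<bar>s i (draw (\<sigma> N) \<omega>) - s i (draw \<tau> \<omega>)\<bar>)"
          by (intro integral_mono) (use I in auto)
        also have "\<dots> = 2 * integral\<^sup>L ?P (\<lambda>z. \<bar>f z - s i z\<bar>) + expectation (\<lambda>\<omega>. \<bar>s i (draw (\<sigma> N) \<omega>) - s i (draw \<tau> \<omega>)\<bar>)"
          using I PE[OF dI inj(1)[of N], of i] PE[OF dI inj(2), of i] by simp
        finally show ?case using i elim by simp
      qed
      then show "\<exists>no. \<forall>n\<ge>no. norm (expectation (\<lambda>\<omega>. \<bar>f (draw (\<sigma> n) \<omega>) - f (draw \<tau> \<omega>)\<bar>) - 0) < e"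
        by (simp add: eventually_sequentially)
    qed
  qed
qed

end

section \<open>Decoupling of causal filters\<close>

lemma geometric_segment_le:
  fixes \<rho> :: real assumes "0 \<le> \<rho>" "\<rho> < 1"
  shows "(\<Sum>i<N. \<rho> ^ (L + i)) \<le> \<rho> ^ L / (1 - \<rho>)"
proof -
  have "(\<Sum>i<N. \<rho> ^ (L + i)) = \<rho> ^ L * (\<Sum>i<N. \<rho> ^ i)"
    by (simp add: power_add sum_distrib_left)
  also have "\<dots> = \<rho> ^ L * ((1 - \<rho> ^ N) / (1 - \<rho>))"
    using assms by (simp add: geometric_sum minus_divide_left[symmetric] divide_simps) (simp add: algebra_simps)
  also have "\<dots> \<le> \<rho> ^ L * (1 / (1 - \<rho>))"
    using assms by (intro mult_left_mono divide_right_mono) auto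
  finally show ?thesis by simp
qed

lemma iexp_diff_le: "cmod (iexp x - iexp y) \<le> \<bar>x - y\<bar>" for x y :: real
proof -
  have "iexp x - iexp y = iexp y * (iexp (x - y) - 1)"
    by (simp add: right_diff_distrib exp_add[symmetric] algebra_simps)
  then have "cmod (iexp x - iexp y) = cmod (iexp (x - y) - 1)" by (simp add: norm_mult)
  also have "\<dots> \<le> \<bar>x - y\<bar>" using iexp_approx1[of "x - y" 0] by simp
  finally show ?thesis .
qed

lemma (in prob_space) integrable_iexp_rv:
  "Y \<in> borel_measurable M \<Longrightarrow> integrable M (\<lambda>\<omega>. iexp (Y \<omega>))" for Y :: "'a \<Rightarrow> real"
  by (rule integrable_const_bound[of _ 1]) auto

context iid_pair
begin

text \<open>
  \<open>mixed a\<close> keeps the innovations after time \<open>a\<close> and takes the copies up to time \<open>a\<close>, so that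
  functionals of \<open>draw (mixed a)\<close> are independent of everything observed up to time \<open>a\<close>.
\<close>

definition mixed :: "int \<Rightarrow> int \<Rightarrow> int + int" where
  "mixed a j = (if j \<le> a then Inr j else Inl j)"

lemma inj_mixed: "inj (mixed a)"
  by (auto simp: inj_def mixed_def split: if_splits)

lemma inj_past: "inj (\<lambda>i. s (k - int i))" if "inj s"
  by (rule injI) (use that in \<open>simp add: inj_eq\<close>)

lemma history_eq_draw: "history \<epsilon> k = draw (\<lambda>i. Inl (k - int i))"
  by (simp add: history_def draw_def noise_def fun_eq_iff)

lemma measurable_history[measurable]: "history \<epsilon> k \<in> M \<rightarrow>\<^sub>M Pi\<^sub>M UNIV (\<lambda>_. borel)"
  unfolding history_eq_draw by measurable

lemma measurable_shift: "(\<lambda>z i. z (k - int i)) \<in> Pi\<^sub>M UNIV (\<lambda>_. borel) \<rightarrow>\<^sub>M Pi\<^sub>M UNIV (\<lambda>_. borel :: real measure)"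
  by (rule measurable_PiM_single') auto

text \<open>
  Exchanging one more coordinate costs what it costs in the stationary coupling at time zero: the
  two pairs of sequences are images of equally distributed families indexed by
  \<open>nat option\<close>, the extra index carrying the new innovation.
\<close>

lemma coupling_step:
  assumes g[measurable]: "g \<in> borel_measurable (Pi\<^sub>M UNIV (\<lambda>_. borel))"
    and c: "L4_le M (\<lambda>\<omega>. g (history \<epsilon> 0 \<omega>) - g (coupled_history \<epsilon> \<epsilon>' N \<omega>)) B"
    and s: "inj s" "Inr (k - int N) \<notin> range (\<lambda>i. s i)"
  shows "L4_le M (\<lambda>\<omega>. g (draw s \<omega>) - g (draw (s(N := Inr (k - int N))) \<omega>)) B"
proof -
  let ?\<phi> = "\<lambda>z :: nat option \<Rightarrow> real. g (\<lambda>i. z (Some i)) - g (\<lambda>i. if i = N then z None else z (Some i))"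
  have m1: "(\<lambda>z i. z (Some i)) \<in> Pi\<^sub>M UNIV (\<lambda>_. borel) \<rightarrow>\<^sub>M Pi\<^sub>M UNIV (\<lambda>_. borel :: real measure)"
    by (rule measurable_PiM_single') auto
  have m2: "(\<lambda>z i. if i = N then z None else z (Some i)) \<in> Pi\<^sub>M UNIV (\<lambda>_. borel) \<rightarrow>\<^sub>M Pi\<^sub>M UNIV (\<lambda>_. borel :: real measure)"
    by (rule measurable_PiM_single') auto
  have \<phi>: "?\<phi> \<in> borel_measurable (Pi\<^sub>M UNIV (\<lambda>_. borel))"
    by (intro borel_measurable_diff measurable_compose[OF m1 g] measurable_compose[OF m2 g])
  let ?\<sigma> = "case_option (Inr (- int N)) (\<lambda>i. Inl (0 - int i))"
  let ?\<tau> = "case_option (Inr (k - int N)) s"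
  have i1: "inj ?\<sigma>" by (auto simp: inj_def split: option.splits)
  have i2: "inj ?\<tau>" using s by (auto simp: inj_def split: option.splits) (metis rangeI)+
  have e1: "(\<lambda>\<omega>. ?\<phi> (draw ?\<sigma> \<omega>)) = (\<lambda>\<omega>. g (history \<epsilon> 0 \<omega>) - g (coupled_history \<epsilon> \<epsilon>' N \<omega>))"
    by (intro ext arg_cong2[where f = "(-)"] arg_cong[where f = g])
      (auto simp: draw_def noise_def history_def coupled_history_def fun_upd_def)
  have e2: "(\<lambda>\<omega>. ?\<phi> (draw ?\<tau> \<omega>)) = (\<lambda>\<omega>. g (draw s \<omega>) - g (draw (s(N := Inr (k - int N))) \<omega>))"
    by (intro ext arg_cong2[where f = "(-)"] arg_cong[where f = g])
      (auto simp: draw_def noise_def fun_upd_def)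
  show ?thesis
    using L4_le_draw[OF i1 i2 \<phi>, of B] c unfolding e1 e2 by simp
qed

text \<open>
  Replacing the whole past costs the geometric tail of the one-coordinate couplings: the coordinates
  \<open>L\<close>, \<open>L + 1\<close>, ... are replaced one after the other. The passage from finitely many replaced
  coordinates to all of them is \<open>L1_draw_conv\<close>, and Fatou's lemma keeps the bound.
\<close>

lemma filter_coupling:
  assumes g[measurable]: "g \<in> borel_measurable (Pi\<^sub>M UNIV (\<lambda>_. borel))"
    and int: "integrable M (\<lambda>\<omega>. g (history \<epsilon> 0 \<omega>))"
    and c: "\<And>N. L4_le M (\<lambda>\<omega>. g (history \<epsilon> 0 \<omega>) - g (coupled_history \<epsilon> \<epsilon>' N \<omega>)) (K * \<rho> ^ N)"
    and \<rho>: "0 \<le> \<rho>" "\<rho> < 1"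
  shows "L4_le M (\<lambda>\<omega>. g (history \<epsilon> k \<omega>) - g (draw (\<lambda>i. mixed (k - int L) (k - int i)) \<omega>)) (K * \<rho> ^ L / (1 - \<rho>))"
proof -
  define s where "s N i = (if L \<le> i \<and> i < L + N then Inr (k - int i) else Inl (k - int i))" for N i :: nat
  have inj_s: "inj (s N)" for N by (auto simp: inj_def s_def split: if_splits)
  have K: "0 \<le> K" using L4_le_nonneg[OF c[of 0]] by simp
  have step: "L4_le M (\<lambda>\<omega>. g (draw (s 0) \<omega>) - g (draw (s N) \<omega>)) (\<Sum>i<N. K * \<rho> ^ (L + i))" for N
  proof (induction N)
    case 0
    show ?case by (simp add: L4_le_zero)
  next
    case (Suc N)
    have upd: "(s N)(L + N := Inr (k - int (L + N))) = s (Suc N)"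
      by (auto simp: s_def fun_eq_iff less_Suc_eq)
    have "L4_le M (\<lambda>\<omega>. g (draw (s N) \<omega>) - g (draw ((s N)(L + N := Inr (k - int (L + N)))) \<omega>)) (K * \<rho> ^ (L + N))"
      by (intro coupling_step[OF g c inj_s]) (auto simp: s_def split: if_splits)
    from L4_le_add[OF Suc this[unfolded upd]] show ?case by simp
  qed
  have s0: "draw (s 0) = history \<epsilon> k" by (auto simp: s_def history_eq_draw intro!: arg_cong[where f = draw])
  have B: "(\<Sum>i<N. K * \<rho> ^ (L + i)) \<le> K * \<rho> ^ L / (1 - \<rho>)" for N
    using mult_left_mono[OF geometric_segment_le[OF \<rho>, where L = L and N = N] K]
    by (simp add: sum_distrib_left)
  let ?\<tau> = "\<lambda>i. mixed (k - int L) (k - int i)"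
  have \<tau>: "inj ?\<tau>" by (intro inj_past inj_mixed)
  have int': "integrable (Pi\<^sub>M UNIV (\<lambda>_. law)) g"
    using int integrable_draw_iff[OF inj_past[of Inl 0] g] by (simp add: history_eq_draw)
  have I: "integrable M (\<lambda>\<omega>. g (draw \<sigma> \<omega>))" if "inj \<sigma>" for \<sigma>
    using int' integrable_draw_iff[OF that g] by simp
  have L1: "(\<lambda>N. expectation (\<lambda>\<omega>. \<bar>g (draw (s N) \<omega>) - g (draw ?\<tau> \<omega>)\<bar>)) \<longlonglongrightarrow> 0"
  proof (rule L1_draw_conv[OF inj_s \<tau> _ int'])
    fix i
    show "\<forall>\<^sub>F N in sequentially. s N i = ?\<tau> i"
      using eventually_gt_at_top[of i] by eventually_elim (auto simp: s_def mixed_def)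
  qed
  show ?thesis
  proof (rule L4_le_L1_limit)
    show "L4_le M (\<lambda>\<omega>. g (history \<epsilon> k \<omega>) - g (draw (s N) \<omega>)) (K * \<rho> ^ L / (1 - \<rho>))" for N
      using L4_le_mono[OF step B, of N] by (simp add: s0)
    show "integrable M (\<lambda>\<omega>. (g (history \<epsilon> k \<omega>) - g (draw (s N) \<omega>)) - (g (history \<epsilon> k \<omega>) - g (draw ?\<tau> \<omega>)))" for N
      unfolding s0[symmetric] by (intro Bochner_Integration.integrable_diff I inj_s \<tau>)
    show "(\<lambda>N. \<integral>\<omega>. \<bar>(g (history \<epsilon> k \<omega>) - g (draw (s N) \<omega>)) - (g (history \<epsilon> k \<omega>) - g (draw ?\<tau> \<omega>))\<bar> \<partial>M) \<longlonglongrightarrow> 0"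
      using L1 by (simp add: abs_minus_commute)
  qed measurable
qed

text \<open>
  The dependence bound forces a finite fourth moment: the filter and its completely resampled
  copy are independent and their difference lies in \<open>L\<^sup>4\<close>, so by Fubini the filter minus a suitable
  constant lies in \<open>L\<^sup>4\<close>.
\<close>

lemma filter_L4:
  assumes g[measurable]: "g \<in> borel_measurable (Pi\<^sub>M UNIV (\<lambda>_. borel))"
    and int: "integrable M (\<lambda>\<omega>. g (history \<epsilon> 0 \<omega>))"
    and c: "\<And>N. L4_le M (\<lambda>\<omega>. g (history \<epsilon> 0 \<omega>) - g (coupled_history \<epsilon> \<epsilon>' N \<omega>)) (K * \<rho> ^ N)"
    and \<rho>: "0 \<le> \<rho>" "\<rho> < 1"
  shows "\<exists>B. L4_le M (\<lambda>\<omega>. g (history \<epsilon> 0 \<omega>)) B"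
proof -
  let ?\<tau> = "\<lambda>i. mixed 0 (0 - int i)"
  let ?U = "\<lambda>\<omega>. g (history \<epsilon> 0 \<omega>)" and ?V = "\<lambda>\<omega>. g (draw ?\<tau> \<omega>)"
  have D: "L4_le M (\<lambda>\<omega>. ?U \<omega> - ?V \<omega>) (K * \<rho> ^ 0 / (1 - \<rho>))"
    using filter_coupling[OF assms, of 0 0] by simp
  have "range ?\<tau> \<inter> range (\<lambda>i. Inl (0 - int i)) = {}" by (auto simp: mixed_def)
  from indep_draw[OF this g g]
  have ind: "indep_var borel ?V borel ?U" by (simp add: history_eq_draw)
  let ?\<mu> = "distr M borel ?U" and ?\<nu> = "distr M borel ?V"
  interpret \<mu>: prob_space ?\<mu> by (intro prob_space_distr) measurable
  interpret \<nu>: prob_space ?\<nu> by (intro prob_space_distr) measurable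
  from ind have VU: "distr M (borel \<Otimes>\<^sub>M borel) (\<lambda>\<omega>. (?V \<omega>, ?U \<omega>)) = ?\<nu> \<Otimes>\<^sub>M ?\<mu>"
    by (simp add: indep_var_distribution_eq)
  have "(\<integral>\<^sup>+ v. (\<integral>\<^sup>+ u. ennreal ((u - v) ^ 4) \<partial>?\<mu>) \<partial>?\<nu>) = (\<integral>\<^sup>+ (v, u). ennreal ((u - v) ^ 4) \<partial>(?\<nu> \<Otimes>\<^sub>M ?\<mu>))"
    by (subst \<mu>.nn_integral_fst[symmetric]) auto
  also have "\<dots> = (\<integral>\<^sup>+ \<omega>. ennreal ((?U \<omega> - ?V \<omega>) ^ 4) \<partial>M)"
    unfolding VU[symmetric] by (subst nn_integral_distr) auto
  also have "\<dots> < \<top>" using D by (simp add: L4_le_def top_unique less_top[symmetric]) (auto simp: top_unique)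
  finally have "AE v in ?\<nu>. (\<integral>\<^sup>+ u. ennreal ((u - v) ^ 4) \<partial>?\<mu>) \<noteq> \<infinity>"
    by (intro nn_integral_PInf_AE) auto
  from eventually_happens[OF this] \<nu>.ae_filter_bot
  obtain v where v: "(\<integral>\<^sup>+ u. ennreal ((u - v) ^ 4) \<partial>?\<mu>) \<noteq> \<infinity>" by (auto simp: trivial_limit_def)
  then have v': "(\<integral>\<^sup>+ \<omega>. ennreal ((?U \<omega> - v) ^ 4) \<partial>M) \<noteq> \<infinity>"
    by (simp add: nn_integral_distr)
  define m where "m = enn2real (\<integral>\<^sup>+ \<omega>. ennreal ((?U \<omega> - v) ^ 4) \<partial>M)"
  have m: "(\<integral>\<^sup>+ \<omega>. ennreal ((?U \<omega> - v) ^ 4) \<partial>M) = ennreal m" "0 \<le> m"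
    using v' by (auto simp: m_def less_top)
  have "m \<le> (1 + m) ^ 4" using m(2) self_le_power[of "1 + m" 4] by simp
  then have "L4_le M (\<lambda>\<omega>. ?U \<omega> - v) (1 + m)"
    unfolding L4_le_def using m by (auto intro!: ennreal_leI)
  from L4_le_add[OF this L4_le_const[of v]] show ?thesis by auto
qed

lemma indep_history_mixed:
  fixes \<Phi> \<Psi> :: "_ \<Rightarrow> real"
  assumes [measurable]: "\<Phi> \<in> borel_measurable (Pi\<^sub>M UNIV (\<lambda>_. borel))" "\<Psi> \<in> borel_measurable (Pi\<^sub>M UNIV (\<lambda>_. borel))"
  shows "indep_var borel (\<lambda>\<omega>. \<Phi> (history \<epsilon> a \<omega>)) borel (\<lambda>\<omega>. \<Psi> (draw (mixed a) \<omega>))"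
proof -
  have "range (\<lambda>i. Inl (a - int i)) \<inter> range (mixed a) = {}" by (auto simp: mixed_def split: if_splits)
  from indep_draw[OF this assms]
  show ?thesis by (simp add: history_eq_draw)
qed

text \<open>
  Decoupling a function of the past \<open>..., \<epsilon>\<^sub>a\<close> from a function \<open>\<Psi>\<close> of the whole path: replacing the
  path by \<open>draw (mixed a)\<close> makes the two exactly independent without changing the law of \<open>\<Psi>\<close>.
\<close>

lemma iexp_decouple:
  fixes \<Phi> \<Psi> :: "_ \<Rightarrow> real"
  assumes [measurable]: "\<Phi> \<in> borel_measurable (Pi\<^sub>M UNIV (\<lambda>_. borel))" "\<Psi> \<in> borel_measurable (Pi\<^sub>M UNIV (\<lambda>_. borel))"
    and I: "integrable M (\<lambda>\<omega>. \<Psi> (draw Inl \<omega>) - \<Psi> (draw (mixed a) \<omega>))"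
  shows "cmod (expectation (\<lambda>\<omega>. iexp (\<Phi> (history \<epsilon> a \<omega>) + \<Psi> (draw Inl \<omega>)))
           - expectation (\<lambda>\<omega>. iexp (\<Phi> (history \<epsilon> a \<omega>))) * expectation (\<lambda>\<omega>. iexp (\<Psi> (draw Inl \<omega>))))
      \<le> expectation (\<lambda>\<omega>. \<bar>\<Psi> (draw Inl \<omega>) - \<Psi> (draw (mixed a) \<omega>)\<bar>)"
proof -
  let ?U = "\<lambda>\<omega>. \<Phi> (history \<epsilon> a \<omega>)" and ?V = "\<lambda>\<omega>. \<Psi> (draw Inl \<omega>)" and ?W = "\<lambda>\<omega>. \<Psi> (draw (mixed a) \<omega>)"
  have "indep_var borel (\<lambda>\<omega>. iexp (?U \<omega>)) borel (\<lambda>\<omega>. iexp (?W \<omega>))"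
    using indep_var_compose[OF indep_history_mixed[OF assms(1,2), of a], of "\<lambda>x. iexp x" borel "\<lambda>x. iexp x" borel]
    by (simp add: comp_def)
  then have "expectation (\<lambda>\<omega>. iexp (?U \<omega>) * iexp (?W \<omega>)) = expectation (\<lambda>\<omega>. iexp (?U \<omega>)) * expectation (\<lambda>\<omega>. iexp (?W \<omega>))"
    by (rule indep_var_lebesgue_integral) (auto intro!: integrable_iexp_rv)
  then have "expectation (\<lambda>\<omega>. iexp (?U \<omega> + ?W \<omega>)) = expectation (\<lambda>\<omega>. iexp (?U \<omega>)) * expectation (\<lambda>\<omega>. iexp (?W \<omega>))"
    by (simp add: exp_add distrib_left)
  also have "expectation (\<lambda>\<omega>. iexp (?W \<omega>)) = expectation (\<lambda>\<omega>. iexp (?V \<omega>))"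
    by (rule expectation_draw_eq) (auto simp: inj_mixed)
  finally have "cmod (expectation (\<lambda>\<omega>. iexp (?U \<omega> + ?V \<omega>)) - expectation (\<lambda>\<omega>. iexp (?U \<omega>)) * expectation (\<lambda>\<omega>. iexp (?V \<omega>)))
      = cmod (expectation (\<lambda>\<omega>. iexp (?U \<omega> + ?V \<omega>) - iexp (?U \<omega> + ?W \<omega>)))"
    using integrable_iexp_rv[of "\<lambda>\<omega>. ?U \<omega> + ?V \<omega>"] integrable_iexp_rv[of "\<lambda>\<omega>. ?U \<omega> + ?W \<omega>"]
    by (subst Bochner_Integration.integral_diff) simp_all
  also have "\<dots> \<le> expectation (\<lambda>\<omega>. cmod (iexp (?U \<omega> + ?V \<omega>) - iexp (?U \<omega> + ?W \<omega>)))"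
    by (rule integral_norm_bound)
  also have "\<dots> \<le> expectation (\<lambda>\<omega>. \<bar>?V \<omega> - ?W \<omega>\<bar>)"
  proof (rule integral_mono)
    show "integrable M (\<lambda>\<omega>. cmod (iexp (?U \<omega> + ?V \<omega>) - iexp (?U \<omega> + ?W \<omega>)))"
      by (intro integrable_norm Bochner_Integration.integrable_diff integrable_iexp_rv) measurable
    show "cmod (iexp (?U \<omega> + ?V \<omega>) - iexp (?U \<omega> + ?W \<omega>)) \<le> \<bar>?V \<omega> - ?W \<omega>\<bar>" for \<omega>
      using iexp_diff_le[of "?U \<omega> + ?V \<omega>" "?U \<omega> + ?W \<omega>"] by simp
  qed (use I in auto)
  finally show ?thesis .
qed

lemma covariance_decouple:
  assumes [measurable]: "\<Phi> \<in> borel_measurable (Pi\<^sub>M UNIV (\<lambda>_. borel))" "\<Psi> \<in> borel_measurable (Pi\<^sub>M UNIV (\<lambda>_. borel))"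
    and U: "L4_le M (\<lambda>\<omega>. \<Phi> (history \<epsilon> a \<omega>)) A" and V: "L4_le M (\<lambda>\<omega>. \<Psi> (draw Inl \<omega>)) C"
    and mean: "expectation (\<lambda>\<omega>. \<Psi> (draw Inl \<omega>)) = 0"
    and D: "L4_le M (\<lambda>\<omega>. \<Psi> (draw Inl \<omega>) - \<Psi> (draw (mixed a) \<omega>)) B"
  shows "\<bar>expectation (\<lambda>\<omega>. \<Phi> (history \<epsilon> a \<omega>) * \<Psi> (draw Inl \<omega>))\<bar> \<le> A * B"
proof -
  have W: "L4_le M (\<lambda>\<omega>. \<Psi> (draw (mixed a) \<omega>)) C"
    by (rule L4_le_draw[OF _ inj_mixed _ V]) auto
  have "expectation (\<lambda>\<omega>. \<Phi> (history \<epsilon> a \<omega>) * \<Psi> (draw (mixed a) \<omega>))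
      = expectation (\<lambda>\<omega>. \<Phi> (history \<epsilon> a \<omega>)) * expectation (\<lambda>\<omega>. \<Psi> (draw (mixed a) \<omega>))"
    by (intro indep_var_lebesgue_integral indep_history_mixed assms(1,2) L4_le_integrable[OF U] L4_le_integrable[OF W])
  also have "expectation (\<lambda>\<omega>. \<Psi> (draw (mixed a) \<omega>)) = 0"
    using expectation_draw_eq[OF inj_mixed _ assms(2), of Inl a] mean by simp
  finally have "expectation (\<lambda>\<omega>. \<Phi> (history \<epsilon> a \<omega>) * \<Psi> (draw Inl \<omega>))
     = expectation (\<lambda>\<omega>. \<Phi> (history \<epsilon> a \<omega>) * (\<Psi> (draw Inl \<omega>) - \<Psi> (draw (mixed a) \<omega>)))"
    using L4_le_mult(1)[OF U V] L4_le_mult(1)[OF U W] by (simp add: right_diff_distrib)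
  with L4_le_expectation_mult[OF U D] show ?thesis by simp
qed

end

section \<open>A central limit theorem by blocking\<close>

lemma sum_geometric_inj_le:
  fixes \<rho> :: real
  assumes \<rho>: "0 \<le> \<rho>" "\<rho> < 1" and f: "finite K" "inj_on f K" "\<And>k. k \<in> K \<Longrightarrow> m \<le> f k"
  shows "(\<Sum>k\<in>K. \<rho> ^ f k) \<le> \<rho> ^ m / (1 - \<rho>)"
proof -
  have fin: "finite (f ` K)" using f by simp
  have "(\<Sum>k\<in>K. \<rho> ^ f k) = (\<Sum>i\<in>f ` K. \<rho> ^ i)" using f by (simp add: sum.reindex)
  also have "\<dots> \<le> (\<Sum>i\<in>{m..<m + Suc (Max (f ` K))}. \<rho> ^ i)"
  proof (rule sum_mono2)
    show "f ` K \<subseteq> {m..<m + Suc (Max (f ` K))}"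
      using f Max_ge[OF fin] by (auto simp: less_Suc_eq_le intro!: le_imp_less_Suc trans_le_add2)
  qed (use \<rho> in auto)
  also have "\<dots> = (\<Sum>i<Suc (Max (f ` K)). \<rho> ^ (m + i))"
    by (rule sum.reindex_bij_witness[of _ "\<lambda>i. m + i" "\<lambda>i. i - m"]) auto
  also have "\<dots> \<le> \<rho> ^ m / (1 - \<rho>)" by (rule geometric_segment_le[OF \<rho>])
  finally show ?thesis .
qed

abbreviation gap :: "nat \<Rightarrow> nat \<Rightarrow> nat" where
  "gap j k \<equiv> nat \<bar>int j - int k\<bar>"

lemma sum_geometric_gap_le:
  fixes \<rho> :: real
  assumes \<rho>: "0 \<le> \<rho>" "\<rho> < 1" and K: "finite K" "\<And>k. k \<in> K \<Longrightarrow> m \<le> gap j k"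
  shows "(\<Sum>k\<in>K. \<rho> ^ gap j k) \<le> 2 * \<rho> ^ m / (1 - \<rho>)"
proof -
  have "(\<Sum>k\<in>K. \<rho> ^ gap j k) = (\<Sum>k\<in>{k\<in>K. k \<le> j}. \<rho> ^ gap j k) + (\<Sum>k\<in>{k\<in>K. \<not> k \<le> j}. \<rho> ^ gap j k)"
    using K(1) by (subst sum.union_disjoint[symmetric]) (auto intro!: sum.cong)
  also have "\<dots> \<le> \<rho> ^ m / (1 - \<rho>) + \<rho> ^ m / (1 - \<rho>)"
    using K(1) by (intro add_mono sum_geometric_inj_le[OF \<rho>]) (auto simp: inj_on_def dest!: K(2))
  finally show ?thesis by simp
qed

lemma (in prob_space) expectation_abs_le_sqrt:
  fixes Y :: "'a \<Rightarrow> real"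
  assumes "integrable M Y" "integrable M (\<lambda>\<omega>. (Y \<omega>)\<^sup>2)"
  shows "expectation (\<lambda>\<omega>. \<bar>Y \<omega>\<bar>) \<le> sqrt (expectation (\<lambda>\<omega>. (Y \<omega>)\<^sup>2))"
proof (rule real_le_rsqrt)
  have "0 \<le> variance (\<lambda>\<omega>. \<bar>Y \<omega>\<bar>)" by (rule variance_positive)
  also have "\<dots> = expectation (\<lambda>\<omega>. (Y \<omega>)\<^sup>2) - (expectation (\<lambda>\<omega>. \<bar>Y \<omega>\<bar>))\<^sup>2"
    using assms by (subst variance_eq) auto
  finally show "(expectation (\<lambda>\<omega>. \<bar>Y \<omega>\<bar>))\<^sup>2 \<le> expectation (\<lambda>\<omega>. (Y \<omega>)\<^sup>2)" by simp
qed

text \<open>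
  Both \<open>exp (i Y)\<close> in the mean and \<open>exp (- v / 2)\<close> agree with \<open>1 - v / 2\<close> up to the next order of their
  expansions.
\<close>

lemma (in prob_space) iexp_gaussian_approx:
  assumes Y: "L4_le M Y \<eta>" and mean: "expectation Y = 0"
  shows "cmod (expectation (\<lambda>\<omega>. iexp (Y \<omega>)) - complex_of_real (exp (- expectation (\<lambda>\<omega>. (Y \<omega>)\<^sup>2) / 2))) \<le> \<eta> ^ 3 + \<eta> ^ 4"
proof -
  let ?v = "expectation (\<lambda>\<omega>. (Y \<omega>)\<^sup>2)"
  have [measurable]: "Y \<in> borel_measurable M" using Y by (rule L4_le_measurable)
  have v: "0 \<le> ?v" "?v \<le> \<eta>\<^sup>2" using L4_le_square[OF Y] by auto
  have "cmod (char (distr M borel Y) 1 - (1 - 1\<^sup>2 * ?v / 2)) \<le> (1\<^sup>2 / 6) * expectation (\<lambda>\<omega>. min (6 * (Y \<omega>)\<^sup>2) (\<bar>1\<bar> * \<bar>Y \<omega>\<bar> ^ 3))"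
    by (rule char_approx3') (use L4_le_integrable[OF Y] L4_le_square[OF Y] mean in auto)
  also have "\<dots> \<le> (1 / 6) * expectation (\<lambda>\<omega>. \<bar>Y \<omega>\<bar> ^ 3)"
    using L4_le_cube(1)[OF Y] L4_le_square(1)[OF Y]
    by (simp, intro integral_mono integrable_min) auto
  also have "\<dots> \<le> \<eta> ^ 3"
  proof -
    have "0 \<le> \<eta> ^ 3" using L4_le_nonneg[OF Y] by simp
    with L4_le_cube(2)[OF Y] show ?thesis by linarith
  qed
  finally have 1: "cmod (expectation (\<lambda>\<omega>. iexp (Y \<omega>)) - (1 - ?v / 2)) \<le> \<eta> ^ 3"
    by (simp add: char_def integral_distr)
  have "\<bar>exp (- (?v / 2)) - (1 - ?v / 2)\<bar> \<le> (?v / 2)\<^sup>2 / 2"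
  proof -
    have "1 - ?v / 2 \<le> exp (- (?v / 2))" using exp_ge_add_one_self[of "- (?v / 2)"] by simp
    moreover have "exp (- (?v / 2)) \<le> 1 - ?v / 2 + (?v / 2)\<^sup>2 / 2"
    proof -
      let ?x = "?v / 2"
      have x: "0 \<le> ?x" using v by simp
      obtain t where "\<bar>t\<bar> \<le> \<bar>- ?x\<bar>" and
        t: "exp (- ?x) = (\<Sum>m<3. (- ?x) ^ m / fact m) + exp t / fact 3 * (- ?x) ^ 3"
        using Maclaurin_exp_le[of "- ?x" 3] by blast
      have "exp t / fact 3 * (- ?x) ^ 3 \<le> 0"
        using x by (simp add: mult_le_0_iff power3_eq_cube)
      with t show ?thesis by (simp add: numeral_eq_Suc power2_eq_square)
    qed
    ultimately show ?thesis by (simp add: abs_le_iff)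
  qed
  also have "\<dots> \<le> \<eta> ^ 4"
  proof -
    have "?v\<^sup>2 \<le> (\<eta>\<^sup>2)\<^sup>2" using v by (intro power_mono) auto
    also have "(\<eta>\<^sup>2)\<^sup>2 = \<eta> ^ 4" by simp
    finally have "?v\<^sup>2 \<le> \<eta> ^ 4" .
    moreover have "0 \<le> \<eta> ^ 4" "(?v / 2)\<^sup>2 / 2 = ?v\<^sup>2 / 8" by (simp_all add: power_divide)
    ultimately show ?thesis by linarith
  qed
  finally have "cmod (complex_of_real (exp (- (?v / 2)) - (1 - ?v / 2))) \<le> \<eta> ^ 4"
    unfolding norm_of_real .
  then have 2: "cmod (complex_of_real (exp (- (?v / 2))) - (1 - ?v / 2)) \<le> \<eta> ^ 4" by simp
  from 1 2 norm_triangle_ineq4[of "expectation (\<lambda>\<omega>. iexp (Y \<omega>)) - (1 - ?v / 2)" "complex_of_real (exp (- (?v / 2))) - (1 - ?v / 2)"]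
  have "cmod (expectation (\<lambda>\<omega>. iexp (Y \<omega>)) - complex_of_real (exp (- (?v / 2)))) \<le> \<eta> ^ 3 + \<eta> ^ 4"
    by simp
  then show ?thesis by simp
qed

lemma abs_exp_minus_diff_le:
  fixes a b :: real assumes "0 \<le> a" "0 \<le> b"
  shows "\<bar>exp (- a) - exp (- b)\<bar> \<le> \<bar>a - b\<bar>"
proof -
  have "exp (- x) - exp (- y) \<le> y - x" if "0 \<le> x" "x \<le> y" for x y :: real
  proof -
    have "exp (- x) - exp (- y) = exp (- x) * (1 - exp (- (y - x)))"
      by (simp add: right_diff_distrib exp_add[symmetric])
    also have "\<dots> \<le> 1 * (1 - exp (- (y - x)))"
      using that by (intro mult_right_mono) auto
    also have "\<dots> \<le> y - x"
    proof -
      have "1 * (1 - e) \<le> y - x" if "1 + - (y - x) \<le> e" for e using that by simp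
      from this[OF exp_ge_add_one_self] show ?thesis .
    qed
    finally show ?thesis .
  qed
  from this[of a b] this[of b a] assms show ?thesis by (cases "a \<le> b") (auto simp: abs_if)
qed

context prob_space
begin

text \<open>
  Bernstein's blocks. The indices are cut into stretches of length \<open>l\<close>; the first \<open>m + 1\<close> positions
  of each stretch are discarded, so that consecutive blocks are more than \<open>m\<close> apart. The four terms
  of the bound are the discarded part, the decoupling of the blocks, the Gaussian approximation of
  each single block, and the change of the total variance.
\<close>

lemma blocking_bound:
  fixes \<xi> :: "nat \<Rightarrow> 'a \<Rightarrow> real" and n l m :: nat
  assumes A: "0 \<le> A" and \<rho>: "0 \<le> \<rho>" "\<rho> < 1" and n: "0 < n" and l: "0 < l"
    and L4: "\<And>k. k \<in> {1..n} \<Longrightarrow> L4_le M (\<xi> k) (A / sqrt n)"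
    and mean: "\<And>k. k \<in> {1..n} \<Longrightarrow> expectation (\<xi> k) = 0"
    and cov: "\<And>j k. j \<in> {1..n} \<Longrightarrow> k \<in> {1..n} \<Longrightarrow> \<bar>expectation (\<lambda>\<omega>. \<xi> j \<omega> * \<xi> k \<omega>)\<bar> \<le> A / n * \<rho> ^ gap j k"
    and dec: "\<And>a J K. J \<subseteq> {1..a} \<Longrightarrow> J \<subseteq> {1..n} \<Longrightarrow> K \<subseteq> {a + m<..n} \<Longrightarrow>
       cmod (expectation (\<lambda>\<omega>. iexp ((\<Sum>j\<in>J. \<xi> j \<omega>) + (\<Sum>k\<in>K. \<xi> k \<omega>)))
          - expectation (\<lambda>\<omega>. iexp (\<Sum>j\<in>J. \<xi> j \<omega>)) * expectation (\<lambda>\<omega>. iexp (\<Sum>k\<in>K. \<xi> k \<omega>)))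
        \<le> card K * (A / sqrt n * \<rho> ^ m)"
  defines "s \<equiv> real ((m + 1) * (n div l + 1)) / n"
  shows "cmod (expectation (\<lambda>\<omega>. iexp (\<Sum>k=1..n. \<xi> k \<omega>))
            - complex_of_real (exp (- expectation (\<lambda>\<omega>. (\<Sum>k=1..n. \<xi> k \<omega>)\<^sup>2) / 2)))
     \<le> sqrt (2 * A / (1 - \<rho>) * s) + A * (sqrt n * \<rho> ^ m)
       + real (n div l + 1) * ((l * (A / sqrt n)) ^ 3 + (l * (A / sqrt n)) ^ 4)
       + (2 * A / (1 - \<rho>) * s + A / (1 - \<rho>) * \<rho> ^ m)"
proof -
  define N where "N = n div l + 1"
  define small where "small = {k \<in> {1..n}. k mod l \<le> m}"
  define blk where "blk b = {k \<in> {1..n}. k div l = b \<and> m < k mod l}" for b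
  define B where "B b \<omega> = (\<Sum>k\<in>blk b. \<xi> k \<omega>)" for b \<omega>
  define R where "R \<omega> = (\<Sum>k\<in>small. \<xi> k \<omega>)" for \<omega>
  define S where "S \<omega> = (\<Sum>k=1..n. \<xi> k \<omega>)" for \<omega>
  define T where "T \<omega> = (\<Sum>b<N. B b \<omega>)" for \<omega>
  define c where "c j k = expectation (\<lambda>\<omega>. \<xi> j \<omega> * \<xi> k \<omega>)" for j k
  let ?g = "2 / (1 - \<rho>)"
  have meas[measurable]: "k \<in> {1..n} \<Longrightarrow> \<xi> k \<in> borel_measurable M" for k using L4 L4_le_measurable by blast
  have fin[simp]: "finite small" "finite (blk b)" for b by (auto simp: small_def blk_def)
  have sub: "small \<subseteq> {1..n}" "blk b \<subseteq> {1..n}" for b by (auto simp: small_def blk_def)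
  have in_n: "k \<in> small \<Longrightarrow> k \<in> {1..n}" "k \<in> blk b \<Longrightarrow> k \<in> {1..n}" for k b
    using sub by blast+
  have measB[measurable]: "B b \<in> borel_measurable M" for b
    unfolding B_def[abs_def] by (intro borel_measurable_sum meas in_n(2))
  have measR[measurable]: "R \<in> borel_measurable M"
    unfolding R_def[abs_def] by (intro borel_measurable_sum meas in_n(1))
  have measS[measurable]: "S \<in> borel_measurable M"
    unfolding S_def[abs_def] by (intro borel_measurable_sum meas) auto
  have measT[measurable]: "T \<in> borel_measurable M"
    unfolding T_def[abs_def] by (intro borel_measurable_sum measB)
  have in_blk: "k div l < N" if "k \<in> {1..n}" for k
    using that div_le_mono[of k n l] by (simp add: N_def)

  have card_small: "card small \<le> (m + 1) * N"
  proof -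
    have "small \<subseteq> (\<Union>b\<in>{..<N}. {b * l..<b * l + (m + 1)})"
    proof
      fix k assume k: "k \<in> small"
      have "k = k div l * l + k mod l" by simp
      moreover have "k mod l \<le> m" using k by (simp add: small_def)
      ultimately have "k div l * l \<le> k" "k < k div l * l + (m + 1)" by linarith+
      then have "k \<in> {k div l * l..<k div l * l + (m + 1)}" by simp
      then show "k \<in> (\<Union>b\<in>{..<N}. {b * l..<b * l + (m + 1)})"
        using in_blk[OF in_n(1)[OF k]] by (intro UN_I[of "k div l"]) simp_all
    qed
    then have "card small \<le> card (\<Union>b\<in>{..<N}. {b * l..<b * l + (m + 1)})" by (intro card_mono) auto
    also have "\<dots> \<le> (\<Sum>b<N. card {b * l..<b * l + (m + 1)})" by (intro card_UN_le) simp
    finally show ?thesis by (simp add: mult.commute)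
  qed
  have card_blk: "card (blk b) \<le> l" for b
  proof -
    have "blk b \<subseteq> {b * l..<b * l + l}"
    proof
      fix k assume "k \<in> blk b"
      then have "k div l = b" by (simp add: blk_def)
      then have "b * l + k mod l = k" "k mod l < l" using l div_mult_mod_eq[of k l] by simp_all
      then have "b * l \<le> k" "k < b * l + l" by linarith+
      then show "k \<in> {b * l..<b * l + l}" by simp
    qed
    from card_mono[OF _ this] show ?thesis by simp
  qed
  have disj_blk: "b \<noteq> b' \<Longrightarrow> blk b \<inter> blk b' = {}" for b b' by (auto simp: blk_def)
  have union: "{1..n} = small \<union> (\<Union>b<N. blk b)" "small \<inter> (\<Union>b<N. blk b) = {}"
    using in_blk by (auto simp: small_def blk_def not_le)
  have T_sum: "(\<Sum>b<k. B b \<omega>) = (\<Sum>i\<in>(\<Union>b<k. blk b). \<xi> i \<omega>)" for k \<omega>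
    unfolding B_def by (subst sum.UNION_disjoint) (auto simp: disj_blk)
  have S_eq: "S \<omega> = R \<omega> + T \<omega>" for \<omega>
    unfolding S_def R_def T_def T_sum union(1) using union(2) by (intro sum.union_disjoint) auto

  have int_prod: "integrable M (\<lambda>\<omega>. \<xi> j \<omega> * \<xi> k \<omega>)" if "j \<in> {1..n}" "k \<in> {1..n}" for j k
    by (intro L4_le_mult(1)[OF L4 L4] that)
  have sq_sum: "expectation (\<lambda>\<omega>. (\<Sum>k\<in>K. \<xi> k \<omega>)\<^sup>2) = (\<Sum>j\<in>K. \<Sum>k\<in>K. c j k)" if "K \<subseteq> {1..n}" for K
  proof -
    have "expectation (\<lambda>\<omega>. (\<Sum>k\<in>K. \<xi> k \<omega>)\<^sup>2) = expectation (\<lambda>\<omega>. \<Sum>j\<in>K. \<Sum>k\<in>K. \<xi> j \<omega> * \<xi> k \<omega>)"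
      by (simp add: power2_eq_square sum_product)
    also have "\<dots> = (\<Sum>j\<in>K. expectation (\<lambda>\<omega>. \<Sum>k\<in>K. \<xi> j \<omega> * \<xi> k \<omega>))"
      by (intro Bochner_Integration.integral_sum Bochner_Integration.integrable_sum int_prod subsetD[OF that])
    also have "\<dots> = (\<Sum>j\<in>K. \<Sum>k\<in>K. c j k)"
      unfolding c_def by (intro sum.cong refl Bochner_Integration.integral_sum int_prod subsetD[OF that])
    finally show ?thesis .
  qed
  have row: "(\<Sum>k\<in>K. \<bar>c j k\<bar>) \<le> A / n * (?g * \<rho> ^ d)"
    if "j \<in> {1..n}" "K \<subseteq> {1..n}" "\<And>k. k \<in> K \<Longrightarrow> d \<le> gap j k" for j K d
  proof -
    have "finite K" by (rule finite_subset[OF that(2)]) simp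
    have "(\<Sum>k\<in>K. \<bar>c j k\<bar>) \<le> (\<Sum>k\<in>K. A / n * \<rho> ^ gap j k)"
      unfolding c_def using that by (intro sum_mono cov) auto
    also have "\<dots> = A / n * (\<Sum>k\<in>K. \<rho> ^ gap j k)" by (simp add: sum_distrib_left)
    also have "\<dots> \<le> A / n * (2 * \<rho> ^ d / (1 - \<rho>))"
      using A by (intro mult_left_mono sum_geometric_gap_le[OF \<rho> \<open>finite K\<close>] that) auto
    finally show ?thesis by simp
  qed
  have small_row: "(\<Sum>j\<in>small. \<Sum>k\<in>K. \<bar>c j k\<bar>) \<le> A * ?g * s" if "K \<subseteq> {1..n}" for K
  proof -
    have "(\<Sum>j\<in>small. \<Sum>k\<in>K. \<bar>c j k\<bar>) \<le> (\<Sum>j\<in>small. A / n * (?g * \<rho> ^ 0))"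
      using that sub by (intro sum_mono row) auto
    also have "\<dots> = card small * (A / n * ?g)" by simp
    also have "\<dots> \<le> real ((m + 1) * N) * (A / n * ?g)"
      using card_small A \<rho> by (intro mult_right_mono) (auto simp del: of_nat_mult of_nat_add)
    also have "\<dots> = A * ?g * (real ((m + 1) * N) / n)" by (simp only: times_divide_eq_left times_divide_eq_right mult.commute mult.left_commute divide_divide_eq_left)
    also have "real ((m + 1) * N) / n = s" by (simp only: s_def N_def)
    finally show ?thesis .
  qed

  \<comment> \<open>The covariances are summable along each row, so the discarded sum has a second moment of the
      order of the number of discarded indices.\<close>
  have R_int: "integrable M R" "integrable M (\<lambda>\<omega>. (R \<omega>)\<^sup>2)"
  proof -
    have "L4_le M R (\<Sum>k\<in>small. A / sqrt n)"
      unfolding R_def[abs_def] by (intro L4_le_sum L4 in_n(1))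
    then show "integrable M R" "integrable M (\<lambda>\<omega>. (R \<omega>)\<^sup>2)"
      by (auto intro: L4_le_integrable L4_le_square)
  qed
  have E1: "cmod (expectation (\<lambda>\<omega>. iexp (S \<omega>)) - expectation (\<lambda>\<omega>. iexp (T \<omega>))) \<le> sqrt (A * ?g * s)"
  proof -
    have "cmod (expectation (\<lambda>\<omega>. iexp (S \<omega>)) - expectation (\<lambda>\<omega>. iexp (T \<omega>)))
      = cmod (expectation (\<lambda>\<omega>. iexp (S \<omega>) - iexp (T \<omega>)))"
      by (subst Bochner_Integration.integral_diff) (auto intro!: integrable_iexp_rv)
    also have "\<dots> \<le> expectation (\<lambda>\<omega>. cmod (iexp (S \<omega>) - iexp (T \<omega>)))" by (rule integral_norm_bound)
    also have "\<dots> \<le> expectation (\<lambda>\<omega>. \<bar>R \<omega>\<bar>)"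
    proof (intro integral_mono integrable_abs R_int integrable_norm Bochner_Integration.integrable_diff integrable_iexp_rv measS measT)
      show "cmod (iexp (S \<omega>) - iexp (T \<omega>)) \<le> \<bar>R \<omega>\<bar>" for \<omega>
        using iexp_diff_le[of "S \<omega>" "T \<omega>"] by (simp add: S_eq)
    qed
    also have "\<dots> \<le> sqrt (expectation (\<lambda>\<omega>. (R \<omega>)\<^sup>2))" by (rule expectation_abs_le_sqrt[OF R_int])
    also have "\<dots> \<le> sqrt (A * ?g * s)"
    proof (rule real_sqrt_le_mono)
      have "expectation (\<lambda>\<omega>. (R \<omega>)\<^sup>2) = (\<Sum>j\<in>small. \<Sum>k\<in>small. c j k)"
        unfolding R_def by (rule sq_sum[OF sub(1)])
      also have "\<dots> \<le> (\<Sum>j\<in>small. \<Sum>k\<in>small. \<bar>c j k\<bar>)" by (intro sum_mono) auto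
      also have "\<dots> \<le> A * ?g * s" by (rule small_row[OF sub(1)])
      finally show "expectation (\<lambda>\<omega>. (R \<omega>)\<^sup>2) \<le> A * ?g * s" .
    qed
    finally show ?thesis .
  qed

  \<comment> \<open>Splitting off one block at a time costs the decoupling error of that block; the block sizes
      add up to at most \<open>n\<close>.\<close>
  let ?\<phi> = "\<lambda>b. expectation (\<lambda>\<omega>. iexp (B b \<omega>))"
  have phi_le: "cmod (expectation (\<lambda>\<omega>. iexp (Y \<omega>))) \<le> 1" for Y :: "'a \<Rightarrow> real"
  proof -
    have "cmod (expectation (\<lambda>\<omega>. iexp (Y \<omega>))) \<le> expectation (\<lambda>\<omega>. cmod (iexp (Y \<omega>)))" by (rule integral_norm_bound)
    then show ?thesis by (simp add: prob_space)
  qed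
  have E2': "cmod (expectation (\<lambda>\<omega>. iexp (\<Sum>b<k. B b \<omega>)) - (\<Prod>b<k. ?\<phi> b)) \<le> (\<Sum>b<k. card (blk b) * (A / sqrt n * \<rho> ^ m))" for k
  proof (induction k)
    case 0
    then show ?case by (simp add: prob_space)
  next
    case (Suc k)
    let ?J = "\<Union>b<k. blk b"
    have J: "?J \<subseteq> {1..k * l}"
    proof
      fix j assume "j \<in> ?J"
      then have j: "j div l < k" "1 \<le> j" by (auto simp: blk_def)
      then have "j < k * l" using l by (simp add: div_less_iff_less_mult)
      then show "j \<in> {1..k * l}" using j by simp
    qed
    have K: "blk k \<subseteq> {k * l + m<..n}"
    proof
      fix j assume j: "j \<in> blk k"
      have "j div l = k" "m < j mod l" using j by (simp_all add: blk_def)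
      then have "k * l + j mod l = j" using div_mult_mod_eq[of j l] by simp
      then have "k * l + m < j" using \<open>m < j mod l\<close> by linarith
      then show "j \<in> {k * l + m<..n}" using j by (simp add: blk_def)
    qed
    have J': "?J \<subseteq> {1..n}" using sub by blast
    have d: "cmod (expectation (\<lambda>\<omega>. iexp (\<Sum>b<Suc k. B b \<omega>)) - expectation (\<lambda>\<omega>. iexp (\<Sum>b<k. B b \<omega>)) * ?\<phi> k)
        \<le> card (blk k) * (A / sqrt n * \<rho> ^ m)"
    proof -
      have "(\<Sum>j\<in>?J. \<xi> j \<omega>) = (\<Sum>b<k. B b \<omega>)" "(\<Sum>j\<in>blk k. \<xi> j \<omega>) = B k \<omega>"
        "(\<Sum>b<Suc k. B b \<omega>) = (\<Sum>b<k. B b \<omega>) + B k \<omega>" for \<omega>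
        by (rule T_sum[symmetric], simp_all add: B_def)
      with dec[OF J J' K] show ?thesis by (simp only:)
    qed
    have "cmod (expectation (\<lambda>\<omega>. iexp (\<Sum>b<k. B b \<omega>)) * ?\<phi> k - (\<Prod>b<k. ?\<phi> b) * ?\<phi> k)
       = cmod (expectation (\<lambda>\<omega>. iexp (\<Sum>b<k. B b \<omega>)) - (\<Prod>b<k. ?\<phi> b)) * cmod (?\<phi> k)"
      by (simp add: left_diff_distrib[symmetric] norm_mult)
    also have "\<dots> \<le> cmod (expectation (\<lambda>\<omega>. iexp (\<Sum>b<k. B b \<omega>)) - (\<Prod>b<k. ?\<phi> b))"
      using mult_left_mono[OF phi_le[of "B k"] norm_ge_zero] by simp
    also note Suc
    finally have "cmod (expectation (\<lambda>\<omega>. iexp (\<Sum>b<k. B b \<omega>)) * ?\<phi> k - (\<Prod>b<k. ?\<phi> b) * ?\<phi> k) \<le> (\<Sum>b<k. card (blk b) * (A / sqrt n * \<rho> ^ m))" .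
    from add_mono[OF d this] norm_triangle_ineq[of
        "expectation (\<lambda>\<omega>. iexp (\<Sum>b<Suc k. B b \<omega>)) - expectation (\<lambda>\<omega>. iexp (\<Sum>b<k. B b \<omega>)) * ?\<phi> k"
        "expectation (\<lambda>\<omega>. iexp (\<Sum>b<k. B b \<omega>)) * ?\<phi> k - (\<Prod>b<k. ?\<phi> b) * ?\<phi> k"]
    show ?case unfolding diff_add_cancel add_diff_eq sum.lessThan_Suc prod.lessThan_Suc by linarith
  qed
  have E2: "cmod (expectation (\<lambda>\<omega>. iexp (T \<omega>)) - (\<Prod>b<N. ?\<phi> b)) \<le> A * (sqrt n * \<rho> ^ m)"
  proof -
    have "(\<Sum>b<N. card (blk b)) = card (\<Union>b<N. blk b)"
      by (subst card_UN_disjoint) (auto simp: disj_blk)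
    also have "\<dots> \<le> card {1..n}" using sub by (intro card_mono) auto
    finally have "(\<Sum>b<N. card (blk b)) \<le> n" by simp
    then have cN: "real (\<Sum>b<N. card (blk b)) \<le> n" by (simp only: of_nat_le_iff)
    have "(\<Sum>b<N. card (blk b) * (A / sqrt n * \<rho> ^ m)) = real (\<Sum>b<N. card (blk b)) * (A / sqrt n * \<rho> ^ m)"
      by (simp only: of_nat_sum sum_distrib_right)
    also have "\<dots> \<le> n * (A / sqrt n * \<rho> ^ m)"
      using cN A \<rho> by (intro mult_right_mono) auto
    also have "\<dots> = A * (sqrt n * \<rho> ^ m)"
    proof -
      have "real n * (A / sqrt n * \<rho> ^ m) = A * (real n / sqrt n * \<rho> ^ m)" by simp
      then show ?thesis by (simp only: real_div_sqrt of_nat_0_le_iff)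
    qed
    finally show ?thesis using E2'[of N] unfolding T_def by linarith
  qed

  \<comment> \<open>Factors in the unit disc: the errors of the single blocks add up.\<close>
  let ?\<eta> = "l * (A / sqrt n)"
  have B_L4: "L4_le M (B b) ?\<eta>" for b
  proof (rule L4_le_mono)
    show "L4_le M (B b) (\<Sum>k\<in>blk b. A / sqrt n)"
      unfolding B_def[abs_def] by (intro L4_le_sum L4 in_n(2))
    show "(\<Sum>k\<in>blk b. A / sqrt n) \<le> ?\<eta>"
      using card_blk[of b] A by (simp add: mult_right_mono divide_right_mono)
  qed
  have B_mean: "expectation (B b) = 0" for b
  proof -
    have "expectation (B b) = (\<Sum>k\<in>blk b. expectation (\<xi> k))"
      unfolding B_def[abs_def] by (intro Bochner_Integration.integral_sum L4_le_integrable[OF L4] in_n(2))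
    then show ?thesis using mean in_n(2) by (simp only: sum.neutral_const cong: sum.cong)
  qed
  define v where "v b = expectation (\<lambda>\<omega>. (B b \<omega>)\<^sup>2)" for b
  have v_nonneg: "0 \<le> v b" for b by (simp add: v_def)
  have E3: "cmod ((\<Prod>b<N. ?\<phi> b) - (\<Prod>b<N. complex_of_real (exp (- v b / 2)))) \<le> real N * (?\<eta> ^ 3 + ?\<eta> ^ 4)"
  proof -
    have "cmod ((\<Prod>b<N. ?\<phi> b) - (\<Prod>b<N. complex_of_real (exp (- v b / 2)))) \<le> (\<Sum>b<N. cmod (?\<phi> b - complex_of_real (exp (- v b / 2))))"
      using phi_le v_nonneg by (intro norm_prod_diff) auto
    also have "\<dots> \<le> (\<Sum>b<N. ?\<eta> ^ 3 + ?\<eta> ^ 4)"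
      unfolding v_def by (intro sum_mono iexp_gaussian_approx[OF B_L4 B_mean])
    finally show ?thesis by simp
  qed

  \<comment> \<open>Two indices lie in the same block unless one of them is discarded or they are more than \<open>m\<close>
      apart, and the pairs of both exceptional kinds have small total covariance.\<close>
  let ?V = "expectation (\<lambda>\<omega>. (S \<omega>)\<^sup>2)"
  have E4': "\<bar>(\<Sum>b<N. v b) - ?V\<bar> \<le> 2 * (A * ?g * s) + A * ?g * \<rho> ^ m"
  proof -
    define P where "P j k \<longleftrightarrow> m < j mod l \<and> m < k mod l \<and> j div l = k div l" for j k
    have "(\<Sum>b<N. v b) = (\<Sum>b<N. \<Sum>j\<in>{1..n}. \<Sum>k\<in>{1..n}. if j div l = b then (if P j k then c j k else 0) else 0)"
    proof (rule sum.cong[OF refl])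
      fix b
      have "v b = (\<Sum>j\<in>blk b. \<Sum>k\<in>blk b. c j k)"
        unfolding v_def B_def by (rule sq_sum[OF sub(2)])
      also have "\<dots> = (\<Sum>j\<in>{1..n}. if j div l = b \<and> m < j mod l then (\<Sum>k\<in>{1..n}. if k div l = b \<and> m < k mod l then c j k else 0) else 0)"
        unfolding blk_def by (simp only: sum.inter_filter finite_atLeastAtMost)
      also have "\<dots> = (\<Sum>j\<in>{1..n}. \<Sum>k\<in>{1..n}. if j div l = b then (if P j k then c j k else 0) else 0)"
      proof (rule sum.cong[OF refl])
        fix j
        show "(if j div l = b \<and> m < j mod l then (\<Sum>k\<in>{1..n}. if k div l = b \<and> m < k mod l then c j k else 0) else 0)
          = (\<Sum>k\<in>{1..n}. if j div l = b then (if P j k then c j k else 0) else 0)"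
        proof (cases "j div l = b \<and> m < j mod l")
          case True
          then show ?thesis by (auto simp: P_def intro!: sum.cong)
        next
          case False
          then have "(\<Sum>k\<in>{1..n}. if j div l = b then (if P j k then c j k else 0) else 0) = 0"
            by (intro sum.neutral) (auto simp: P_def)
          then show ?thesis unfolding if_not_P[OF False] by (rule sym)
        qed
      qed
      finally show "v b = (\<Sum>j\<in>{1..n}. \<Sum>k\<in>{1..n}. if j div l = b then (if P j k then c j k else 0) else 0)" .
    qed
    also have "\<dots> = (\<Sum>j\<in>{1..n}. \<Sum>b<N. \<Sum>k\<in>{1..n}. if j div l = b then (if P j k then c j k else 0) else 0)"
      by (rule sum.swap)
    also have "\<dots> = (\<Sum>j\<in>{1..n}. \<Sum>k\<in>{1..n}. \<Sum>b<N. if j div l = b then (if P j k then c j k else 0) else 0)"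
      by (intro sum.cong refl sum.swap)
    also have "\<dots> = (\<Sum>j\<in>{1..n}. \<Sum>k\<in>{1..n}. if P j k then c j k else 0)"
      using in_blk by (intro sum.cong refl) (simp add: sum.delta')
    finally have vsum: "(\<Sum>b<N. v b) = (\<Sum>j\<in>{1..n}. \<Sum>k\<in>{1..n}. if P j k then c j k else 0)" .
    have "?V = (\<Sum>j\<in>{1..n}. \<Sum>k\<in>{1..n}. c j k)" unfolding S_def by (rule sq_sum) simp
    with vsum have "\<bar>(\<Sum>b<N. v b) - ?V\<bar> = \<bar>\<Sum>j\<in>{1..n}. \<Sum>k\<in>{1..n}. (if P j k then c j k else 0) - c j k\<bar>"
      by (simp add: sum_subtractf)
    also have "\<dots> \<le> (\<Sum>j\<in>{1..n}. \<Sum>k\<in>{1..n}. \<bar>(if P j k then c j k else 0) - c j k\<bar>)"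
      by (rule order_trans[OF sum_abs]) (intro sum_mono sum_abs)
    also have "\<dots> \<le> (\<Sum>j\<in>{1..n}. \<Sum>k\<in>{1..n}. (if j \<in> small then \<bar>c j k\<bar> else 0) + (if k \<in> small then \<bar>c j k\<bar> else 0) + (if m \<le> gap j k then \<bar>c j k\<bar> else 0))"
    proof (intro sum_mono)
      fix j k assume jk: "j \<in> {1..n}" "k \<in> {1..n}"
      have far: "m \<le> gap j k" if "m < j mod l" "m < k mod l" "j div l \<noteq> k div l"
      proof -
        have *: "m \<le> gap x y" if "x div l < y div l" "m < y mod l" for x y
        proof -
          have "x < y div l * l" using that l by (metis div_less_iff_less_mult)
          moreover have "y div l * l + y mod l = y" by simp
          ultimately have "x + m < y" using that(2) by linarith
          then show ?thesis by simp
        qed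
        show ?thesis using *[of j k] *[of k j] that by (cases "j div l < k div l") auto
      qed
      show "\<bar>(if P j k then c j k else 0) - c j k\<bar> \<le> (if j \<in> small then \<bar>c j k\<bar> else 0) + (if k \<in> small then \<bar>c j k\<bar> else 0) + (if m \<le> gap j k then \<bar>c j k\<bar> else 0)"
        using jk far by (auto simp: P_def small_def)
    qed
    also have "\<dots> = (\<Sum>j\<in>{1..n}. \<Sum>k\<in>{1..n}. if j \<in> small then \<bar>c j k\<bar> else 0) + (\<Sum>j\<in>{1..n}. \<Sum>k\<in>{1..n}. if k \<in> small then \<bar>c j k\<bar> else 0)
        + (\<Sum>j\<in>{1..n}. \<Sum>k\<in>{1..n}. if m \<le> gap j k then \<bar>c j k\<bar> else 0)"
      by (simp add: sum.distrib)
    also have "\<dots> \<le> A * ?g * s + A * ?g * s + A * ?g * \<rho> ^ m"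
    proof (intro add_mono)
      have sm: "(\<Sum>j\<in>{1..n}. if j \<in> small then h j else 0) = (\<Sum>j\<in>small. h j)" for h :: "nat \<Rightarrow> real"
        using sub(1) by (subst sum.mono_neutral_right[of "{1..n}" small]) (auto intro!: sum.cong)
      have "(\<Sum>j\<in>{1..n}. \<Sum>k\<in>{1..n}. if j \<in> small then \<bar>c j k\<bar> else 0) = (\<Sum>j\<in>{1..n}. if j \<in> small then (\<Sum>k\<in>{1..n}. \<bar>c j k\<bar>) else 0)"
        by (intro sum.cong) auto
      then show 1: "(\<Sum>j\<in>{1..n}. \<Sum>k\<in>{1..n}. if j \<in> small then \<bar>c j k\<bar> else 0) \<le> A * ?g * s"
        using small_row[of "{1..n}"] unfolding sm by (simp only: order_refl)
      have "(\<Sum>j\<in>{1..n}. \<Sum>k\<in>{1..n}. if k \<in> small then \<bar>c j k\<bar> else 0) = (\<Sum>k\<in>{1..n}. \<Sum>j\<in>{1..n}. if k \<in> small then \<bar>c k j\<bar> else 0)"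
      proof (subst sum.swap, intro sum.cong refl if_cong arg_cong[where f = abs])
        show "c i j = c j i" for i j by (simp add: c_def mult.commute)
      qed
      then show "(\<Sum>j\<in>{1..n}. \<Sum>k\<in>{1..n}. if k \<in> small then \<bar>c j k\<bar> else 0) \<le> A * ?g * s"
        using 1 by simp
      have "(\<Sum>j\<in>{1..n}. \<Sum>k\<in>{1..n}. if m \<le> gap j k then \<bar>c j k\<bar> else 0) = (\<Sum>j\<in>{1..n}. \<Sum>k\<in>{k\<in>{1..n}. m \<le> gap j k}. \<bar>c j k\<bar>)"
        by (subst sum.inter_filter) auto
      also have "\<dots> \<le> (\<Sum>j\<in>{1..n}. A / n * (?g * \<rho> ^ m))" by (intro sum_mono row) auto
      also have "\<dots> = A * ?g * \<rho> ^ m" using n by simp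
      finally show "(\<Sum>j\<in>{1..n}. \<Sum>k\<in>{1..n}. if m \<le> gap j k then \<bar>c j k\<bar> else 0) \<le> A * ?g * \<rho> ^ m" .
    qed
    finally show ?thesis by simp
  qed
  have E4: "cmod ((\<Prod>b<N. complex_of_real (exp (- v b / 2))) - complex_of_real (exp (- ?V / 2))) \<le> A * ?g * s + A / (1 - \<rho>) * \<rho> ^ m"
  proof -
    have "(\<Prod>b<N. complex_of_real (exp (- v b / 2))) = complex_of_real (exp (- ((\<Sum>b<N. v b) / 2)))"
    proof -
      have "(\<Prod>b<N. complex_of_real (exp (- v b / 2))) = complex_of_real (\<Prod>b<N. exp (- v b / 2))" by simp
      also have "(\<Prod>b<N. exp (- v b / 2)) = exp (\<Sum>b<N. - v b / 2)" by (simp add: exp_sum)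
      also have "(\<Sum>b<N. - v b / 2) = - ((\<Sum>b<N. v b) / 2)" by (simp add: sum_negf sum_divide_distrib)
      finally show ?thesis .
    qed
    then have "cmod ((\<Prod>b<N. complex_of_real (exp (- v b / 2))) - complex_of_real (exp (- ?V / 2)))
       = \<bar>exp (- ((\<Sum>b<N. v b) / 2)) - exp (- (?V / 2))\<bar>"
      by (metis minus_divide_left norm_of_real of_real_diff)
    also have "\<dots> \<le> \<bar>(\<Sum>b<N. v b) / 2 - ?V / 2\<bar>"
      by (rule abs_exp_minus_diff_le) (auto intro!: sum_nonneg v_nonneg)
    also have "\<dots> = \<bar>(\<Sum>b<N. v b) - ?V\<bar> / 2" by (simp add: diff_divide_distrib[symmetric])
    also have "\<dots> \<le> (2 * (A * ?g * s) + A * ?g * \<rho> ^ m) / 2" using E4' by simp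
    also have "\<dots> = A * ?g * s + A / (1 - \<rho>) * \<rho> ^ m"
    proof -
      have "(2 * (A * (2 * u) * s) + A * (2 * u) * \<rho> ^ m) / 2 = A * (2 * u) * s + A * u * \<rho> ^ m" for u
        by (simp add: add_divide_distrib)
      from this[of "1 / (1 - \<rho>)"] show ?thesis by simp
    qed
    finally show ?thesis .
  qed
  have tri: "cmod (a - e) \<le> x1 + x2 + x3 + x4"
    if "cmod (a - b) \<le> x1" "cmod (b - c) \<le> x2" "cmod (c - d) \<le> x3" "cmod (d - e) \<le> x4" for a b c d e x1 x2 x3 x4
    using that norm_triangle_ineq[of "a - b" "b - e"] norm_triangle_ineq[of "b - c" "c - e"] norm_triangle_ineq[of "c - d" "d - e"]
    unfolding diff_add_cancel add_diff_eq by linarith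
  show ?thesis using tri[OF E1 E2 E3 E4] by (simp add: S_def N_def mult.commute)
qed

lemma polynomial_times_geometric_limit_0:
  fixes \<rho> :: real assumes "0 \<le> \<rho>" "\<rho> < 1"
  shows "(\<lambda>q. (real q + 1) ^ 5 * \<rho> ^ q) \<longlonglongrightarrow> 0"
proof -
  define \<theta> where "\<theta> = root 5 \<rho>"
  have \<theta>: "0 \<le> \<theta>" "\<theta> < 1" "\<theta> ^ 5 = \<rho>" using assms by (simp_all add: \<theta>_def)
  have "(\<lambda>q. of_nat q * \<theta> ^ q) \<longlonglongrightarrow> 0" "(\<lambda>q. \<theta> ^ q) \<longlonglongrightarrow> 0"
    using \<theta> powser_times_n_limit_0[of \<theta>] by (auto intro: LIMSEQ_power_zero)
  from tendsto_power[OF tendsto_add[OF this], of 5]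
  have "(\<lambda>q. ((real q + 1) * \<theta> ^ q) ^ 5) \<longlonglongrightarrow> 0" by (simp add: distrib_right)
  also have "(\<lambda>q. ((real q + 1) * \<theta> ^ q) ^ 5) = (\<lambda>q. (real q + 1) ^ 5 * \<rho> ^ q)"
    by (simp add: power_mult_distrib power_mult[symmetric] mult.commute \<theta>(3)[symmetric])
  finally show ?thesis .
qed

text \<open>
  With \<open>q\<close> of the order of \<open>n\<^bsup>1/10\<^esup>\<close>, stretches of length \<open>q\<^sup>2\<close> and gaps of length \<open>q\<close> make all four terms of
  the blocking bound vanish: the gap is negligible against the stretch, a geometric rate beats
  \<open>\<surd>n \<le> (q + 1)\<^sup>5\<close> over the gap, and the \<open>n / q\<^sup>2\<close> blocks have third moments of order \<open>(q\<^sup>2 / \<surd>n)\<^sup>3\<close>.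
\<close>

theorem blocking_clt:
  fixes \<xi> :: "nat \<Rightarrow> nat \<Rightarrow> 'a \<Rightarrow> real"
  assumes A: "0 \<le> A" and \<rho>: "0 \<le> \<rho>" "\<rho> < 1"
    and L4: "\<And>n k. k \<in> {1..n} \<Longrightarrow> L4_le M (\<xi> n k) (A / sqrt n)"
    and mean: "\<And>n k. k \<in> {1..n} \<Longrightarrow> expectation (\<xi> n k) = 0"
    and cov: "\<And>n j k. j \<in> {1..n} \<Longrightarrow> k \<in> {1..n} \<Longrightarrow> \<bar>expectation (\<lambda>\<omega>. \<xi> n j \<omega> * \<xi> n k \<omega>)\<bar> \<le> A / n * \<rho> ^ gap j k"
    and dec: "\<And>n m a J K. J \<subseteq> {1..a} \<Longrightarrow> J \<subseteq> {1..n} \<Longrightarrow> K \<subseteq> {a + m<..n} \<Longrightarrow>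
       cmod (expectation (\<lambda>\<omega>. iexp ((\<Sum>j\<in>J. \<xi> n j \<omega>) + (\<Sum>k\<in>K. \<xi> n k \<omega>)))
          - expectation (\<lambda>\<omega>. iexp (\<Sum>j\<in>J. \<xi> n j \<omega>)) * expectation (\<lambda>\<omega>. iexp (\<Sum>k\<in>K. \<xi> n k \<omega>)))
        \<le> card K * (A / sqrt n * \<rho> ^ m)"
    and var: "(\<lambda>n. expectation (\<lambda>\<omega>. (\<Sum>k=1..n. \<xi> n k \<omega>)\<^sup>2)) \<longlonglongrightarrow> v"
  shows "(\<lambda>n. expectation (\<lambda>\<omega>. iexp (\<Sum>k=1..n. \<xi> n k \<omega>))) \<longlonglongrightarrow> complex_of_real (exp (- v / 2))"
proof -
  define q where "q n = nat \<lfloor>root 10 (real n)\<rfloor>" for n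
  define c where "c = 2 * A / (1 - \<rho>)"
  have c: "0 \<le> c" using A \<rho> by (simp add: c_def)
  define h where "h q = sqrt (c * (2 * (1 / real q + 1 / real q * (1 / real q)))) + A * ((real q + 1) ^ 5 * \<rho> ^ q)
     + (2 * A ^ 3 * (1 / real q) + 2 * A ^ 4 * (1 / real q) ^ 4)
     + (c * (2 * (1 / real q + 1 / real q * (1 / real q))) + A / (1 - \<rho>) * \<rho> ^ q)" for q
  have q_lim: "filterlim q at_top sequentially"
  proof (subst filterlim_at_top, intro allI)
    fix Z
    show "\<forall>\<^sub>F n in sequentially. Z \<le> q n"
      using eventually_ge_at_top[of "Z ^ 10"]
    proof eventually_elim
      case (elim n)
      have "real Z = root 10 (real Z ^ 10)" by (simp add: real_root_power_cancel)
      also have "\<dots> \<le> root 10 (real n)" using elim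
        by (intro real_root_le_mono) (auto simp: of_nat_power[symmetric] simp del: of_nat_power)
      finally show ?case by (simp add: q_def le_nat_iff le_floor_iff)
    qed
  qed
  have q_bounds: "1 \<le> q n" "real (q n) ^ 10 \<le> n" "n \<le> (real (q n) + 1) ^ 10" if "1 \<le> n" for n
  proof -
    have r: "1 \<le> root 10 (real n)" using that by simp
    then have *: "real (q n) \<le> root 10 n" "root 10 n \<le> real (q n) + 1" by (simp_all add: q_def)
    show "1 \<le> q n" using r by (simp add: q_def le_nat_iff le_floor_iff)
    have "real (q n) ^ 10 \<le> root 10 n ^ 10" using * by (intro power_mono) auto
    then show "real (q n) ^ 10 \<le> n" by simp
    have "root 10 n ^ 10 \<le> (real (q n) + 1) ^ 10" using * r by (intro power_mono) auto
    then show "n \<le> (real (q n) + 1) ^ 10" by simp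
  qed
  have bound: "cmod (expectation (\<lambda>\<omega>. iexp (\<Sum>k=1..n. \<xi> n k \<omega>))
      - complex_of_real (exp (- expectation (\<lambda>\<omega>. (\<Sum>k=1..n. \<xi> n k \<omega>)\<^sup>2) / 2))) \<le> h (q n)" if n: "1 \<le> n" for n
  proof -
    define Q where "Q = real (q n)"
    define x where "x = real n"
    let ?l = "(q n)\<^sup>2"
    have Q: "1 \<le> Q" "Q ^ 10 \<le> x" "x \<le> (Q + 1) ^ 10" and x: "1 \<le> x"
      using q_bounds[OF n] n by (auto simp: Q_def x_def)
    have Q2: "Q\<^sup>2 \<le> x" using power_increasing[of 2 10 Q] Q by linarith
    have "real (n div ?l) \<le> x / Q\<^sup>2"
      using of_nat_div_le_of_nat[of n ?l, where 'a = real] by (simp add: x_def Q_def)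
    moreover have "1 \<le> x / Q\<^sup>2" using Q2 Q(1) by simp
    ultimately have N: "real (n div ?l + 1) \<le> 2 * x / Q\<^sup>2" by simp
    have s: "real ((q n + 1) * (n div ?l + 1)) / n \<le> 2 * (1 / Q + 1 / Q * (1 / Q))"
    proof -
      have "real ((q n + 1) * (n div ?l + 1)) / n = (Q + 1) * real (n div ?l + 1) / x"
        by (simp only: of_nat_mult of_nat_add of_nat_1 Q_def x_def)
      also have "\<dots> \<le> (Q + 1) * (2 * x / Q\<^sup>2) / x"
        using N Q x by (intro divide_right_mono mult_left_mono) auto
      also have "\<dots> = 2 * (1 / Q + 1 / Q * (1 / Q))"
        using Q x by (simp add: field_simps power2_eq_square)
      finally show ?thesis .
    qed
    have "Q ^ 5 = sqrt (Q ^ 10)" using Q by (intro real_sqrt_unique[symmetric]) (auto simp: power_mult[symmetric])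
    then have sq_lo: "Q ^ 5 \<le> sqrt x" using Q by simp
    have "(Q + 1) ^ 5 = sqrt ((Q + 1) ^ 10)" using Q by (intro real_sqrt_unique[symmetric]) (auto simp: power_mult[symmetric])
    then have sq_hi: "sqrt x \<le> (Q + 1) ^ 5" using Q by simp
    have sx: "0 < sqrt x" "sqrt x * sqrt x = x" using x by auto
    let ?\<eta> = "real ?l * (A / sqrt n)"
    have \<eta>: "?\<eta> = Q\<^sup>2 * A / sqrt x" "0 \<le> ?\<eta>" using A by (simp_all add: Q_def x_def)
    have cube: "real (n div ?l + 1) * ?\<eta> ^ 3 \<le> 2 * A ^ 3 * (1 / Q)"
    proof -
      have "real (n div ?l + 1) * ?\<eta> ^ 3 \<le> (2 * x / Q\<^sup>2) * ?\<eta> ^ 3"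
        by (rule mult_right_mono[OF N]) (use \<eta>(2) in simp)
      also have "\<dots> = 2 * A ^ 3 * (Q ^ 4 / sqrt x)"
      proof -
        have "(2 * (y * y) / Q\<^sup>2) * (Q\<^sup>2 * A / y) ^ 3 = 2 * A ^ 3 * (Q ^ 4 / y)" if "0 < y" for y
          using Q(1) that by (simp add: field_simps power2_eq_square power3_eq_cube power4_eq_xxxx)
        from this[OF sx(1)] show ?thesis unfolding \<eta>(1) sx(2) .
      qed
      also have "\<dots> \<le> 2 * A ^ 3 * (Q ^ 4 / Q ^ 5)"
        using A Q(1) sq_lo sx(1) by (intro mult_left_mono divide_left_mono mult_pos_pos) auto
      also have "Q ^ 4 / Q ^ 5 = 1 / Q" using Q by (simp add: power_eq_if[of Q 5])
      finally show ?thesis .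
    qed
    have fourth: "real (n div ?l + 1) * ?\<eta> ^ 4 \<le> 2 * A ^ 4 * (1 / Q) ^ 4"
    proof -
      have "real (n div ?l + 1) * ?\<eta> ^ 4 \<le> (2 * x / Q\<^sup>2) * ?\<eta> ^ 4"
        by (rule mult_right_mono[OF N]) (use \<eta>(2) in simp)
      also have "\<dots> = 2 * A ^ 4 * (Q ^ 6 / x)"
      proof -
        have "(2 * (y * y) / Q\<^sup>2) * (Q\<^sup>2 * A / y) ^ 4 = 2 * A ^ 4 * (Q ^ 6 / (y * y))" if "0 < y" for y
          using Q(1) that by (simp add: field_simps power2_eq_square power4_eq_xxxx eval_nat_numeral)
        from this[OF sx(1)] show ?thesis unfolding \<eta>(1) sx(2) .
      qed
      also have "\<dots> \<le> 2 * A ^ 4 * (Q ^ 6 / Q ^ 10)"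
        using A Q x by (intro mult_left_mono divide_left_mono) auto
      also have "Q ^ 6 / Q ^ 10 = (1 / Q) ^ 4"
      proof -
        have "Q ^ 10 = Q ^ 6 * Q ^ 4" by (simp add: power_add[symmetric])
        then show ?thesis using Q(1) by (simp add: divide_simps)
      qed
      finally show ?thesis .
    qed
    have "cmod (expectation (\<lambda>\<omega>. iexp (\<Sum>k=1..n. \<xi> n k \<omega>))
      - complex_of_real (exp (- expectation (\<lambda>\<omega>. (\<Sum>k=1..n. \<xi> n k \<omega>)\<^sup>2) / 2)))
      \<le> sqrt (2 * A / (1 - \<rho>) * (real ((q n + 1) * (n div ?l + 1)) / n)) + A * (sqrt n * \<rho> ^ q n)
       + real (n div ?l + 1) * (?\<eta> ^ 3 + ?\<eta> ^ 4)
       + (2 * A / (1 - \<rho>) * (real ((q n + 1) * (n div ?l + 1)) / n) + A / (1 - \<rho>) * \<rho> ^ q n)"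
      by (rule blocking_bound[OF A \<rho> _ _ L4 mean cov dec]) (use n q_bounds(1)[OF n] in \<open>simp_all\<close>)
    also have "\<dots> \<le> h (q n)"
      unfolding h_def c_def[symmetric] Q_def[symmetric] distrib_left[of "real (n div ?l + 1)"]
    proof (intro add_mono real_sqrt_le_mono mult_left_mono s c A cube fourth order_refl)
      show "sqrt (real n) * \<rho> ^ q n \<le> (Q + 1) ^ 5 * \<rho> ^ q n"
        using sq_hi \<rho> by (intro mult_right_mono) (auto simp: x_def)
    qed (use A \<rho> in simp)
    finally show ?thesis .
  qed
  have inv: "(\<lambda>q. 1 / real q) \<longlonglongrightarrow> 0" by (rule lim_1_over_n)
  have "h \<longlonglongrightarrow> sqrt (c * (2 * (0 + 0 * 0))) + A * 0 + (2 * A ^ 3 * 0 + 2 * A ^ 4 * 0 ^ 4) + (c * (2 * (0 + 0 * 0)) + A / (1 - \<rho>) * 0)"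
    unfolding h_def[abs_def] using \<rho>
    by (intro tendsto_intros inv polynomial_times_geometric_limit_0 LIMSEQ_power_zero) auto
  then have "h \<longlonglongrightarrow> 0" by simp
  from filterlim_compose[OF this q_lim] have h0: "(\<lambda>n. h (q n)) \<longlonglongrightarrow> 0" .
  have "(\<lambda>n. expectation (\<lambda>\<omega>. iexp (\<Sum>k=1..n. \<xi> n k \<omega>))
      - complex_of_real (exp (- expectation (\<lambda>\<omega>. (\<Sum>k=1..n. \<xi> n k \<omega>)\<^sup>2) / 2))) \<longlonglongrightarrow> 0"
    by (rule Lim_null_comparison[OF _ h0]) (use bound in \<open>auto intro!: eventually_sequentiallyI[of 1]\<close>)
  moreover have "(\<lambda>n. complex_of_real (exp (- expectation (\<lambda>\<omega>. (\<Sum>k=1..n. \<xi> n k \<omega>)\<^sup>2) / 2))) \<longlonglongrightarrow> complex_of_real (exp (- v / 2))"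
    by (intro tendsto_intros var) auto
  ultimately have "(\<lambda>n. (expectation (\<lambda>\<omega>. iexp (\<Sum>k=1..n. \<xi> n k \<omega>))
      - complex_of_real (exp (- expectation (\<lambda>\<omega>. (\<Sum>k=1..n. \<xi> n k \<omega>)\<^sup>2) / 2)))
      + complex_of_real (exp (- expectation (\<lambda>\<omega>. (\<Sum>k=1..n. \<xi> n k \<omega>)\<^sup>2) / 2))) \<longlonglongrightarrow> 0 + complex_of_real (exp (- v / 2))"
    by (rule tendsto_add)
  then show ?thesis unfolding diff_add_cancel add_0 .
qed

end

section \<open>Arrays of geometrically dependent filters\<close>

context iid_pair
begin

text \<open>
  The filters to which the limit theory applies: centred, bounded in \<open>L\<^sup>4\<close>, and forgetting the
  innovations older than \<open>L\<close> steps at a geometric rate.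
\<close>

definition geometric_filter :: "real \<Rightarrow> real \<Rightarrow> ((nat \<Rightarrow> real) \<Rightarrow> real) \<Rightarrow> bool" where
  "geometric_filter A \<rho> g \<longleftrightarrow>
     g \<in> borel_measurable (Pi\<^sub>M UNIV (\<lambda>_. borel)) \<and>
     L4_le M (\<lambda>\<omega>. g (history \<epsilon> 0 \<omega>)) A \<and>
     expectation (\<lambda>\<omega>. g (history \<epsilon> 0 \<omega>)) = 0 \<and>
     (\<forall>k L. L4_le M (\<lambda>\<omega>. g (history \<epsilon> k \<omega>) - g (draw (\<lambda>i. mixed (k - int L) (k - int i)) \<omega>)) (A * \<rho> ^ L))"

lemma geometric_filterD:
  assumes "geometric_filter A \<rho> g"
  shows "g \<in> borel_measurable (Pi\<^sub>M UNIV (\<lambda>_. borel))"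
    and "L4_le M (\<lambda>\<omega>. g (history \<epsilon> k \<omega>)) A"
    and "expectation (\<lambda>\<omega>. g (history \<epsilon> k \<omega>)) = 0"
    and "L4_le M (\<lambda>\<omega>. g (history \<epsilon> k \<omega>) - g (draw (\<lambda>i. mixed (k - int L) (k - int i)) \<omega>)) (A * \<rho> ^ L)"
proof -
  have inj: "inj (\<lambda>i. Inl (k - int i))" for k by (rule inj_past) simp
  show m: "g \<in> borel_measurable (Pi\<^sub>M UNIV (\<lambda>_. borel))" using assms by (simp add: geometric_filter_def)
  show "L4_le M (\<lambda>\<omega>. g (history \<epsilon> k \<omega>)) A"
    using assms L4_le_draw[OF inj inj m, of 0 A k] by (simp add: geometric_filter_def history_eq_draw)
  show "expectation (\<lambda>\<omega>. g (history \<epsilon> k \<omega>)) = 0"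
    using assms expectation_draw_eq[OF inj inj m, of 0 k] by (simp add: geometric_filter_def history_eq_draw)
  show "L4_le M (\<lambda>\<omega>. g (history \<epsilon> k \<omega>) - g (draw (\<lambda>i. mixed (k - int L) (k - int i)) \<omega>)) (A * \<rho> ^ L)"
    using assms by (simp add: geometric_filter_def)
qed

lemma geometric_filter_zero: "0 \<le> A \<Longrightarrow> 0 \<le> \<rho> \<Longrightarrow> geometric_filter A \<rho> (\<lambda>_. 0)"
  by (auto simp: geometric_filter_def intro!: L4_le_mono[OF L4_le_zero])

lemma geometric_filter_covariance:
  assumes g: "geometric_filter A \<rho> g" and h: "geometric_filter A \<rho> h" and \<rho>: "0 \<le> \<rho>" 
  shows "\<bar>expectation (\<lambda>\<omega>. g (history \<epsilon> j \<omega>) * h (history \<epsilon> k \<omega>))\<bar> \<le> A * A * \<rho> ^ nat \<bar>j - k\<bar>"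
proof -
  have *: "\<bar>expectation (\<lambda>\<omega>. g (history \<epsilon> j \<omega>) * h (history \<epsilon> k \<omega>))\<bar> \<le> A * A * \<rho> ^ nat (k - j)"
    if g: "geometric_filter A \<rho> g" and h: "geometric_filter A \<rho> h" and jk: "j \<le> k" for g h j k
  proof -
    let ?\<Psi> = "\<lambda>z. h (\<lambda>i. z (k - int i))"
    have m: "?\<Psi> \<in> borel_measurable (Pi\<^sub>M UNIV (\<lambda>_. borel))"
      by (rule measurable_compose[OF measurable_shift geometric_filterD(1)[OF h]])
    have e: "?\<Psi> (draw Inl \<omega>) = h (history \<epsilon> k \<omega>)" for \<omega>
      by (simp add: history_eq_draw draw_def)
    have e': "?\<Psi> (draw (mixed j) \<omega>) = h (draw (\<lambda>i. mixed (k - int (nat (k - j))) (k - int i)) \<omega>)" for \<omega>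
      using jk by (simp add: draw_def)
    have "\<bar>expectation (\<lambda>\<omega>. g (history \<epsilon> j \<omega>) * ?\<Psi> (draw Inl \<omega>))\<bar> \<le> A * (A * \<rho> ^ nat (k - j))"
    proof (rule covariance_decouple[OF geometric_filterD(1)[OF g] m])
      show "L4_le M (\<lambda>\<omega>. ?\<Psi> (draw Inl \<omega>)) A" "expectation (\<lambda>\<omega>. ?\<Psi> (draw Inl \<omega>)) = 0"
        unfolding e by (rule geometric_filterD[OF h])+
      show "L4_le M (\<lambda>\<omega>. ?\<Psi> (draw Inl \<omega>) - ?\<Psi> (draw (mixed j) \<omega>)) (A * \<rho> ^ nat (k - j))"
        unfolding e e' by (rule geometric_filterD[OF h])
    qed (rule geometric_filterD[OF g])
    then show ?thesis unfolding e by (simp add: mult.assoc)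
  qed
  show ?thesis
  proof (cases "j \<le> k")
    case True
    then show ?thesis using *[OF g h, of j k] by simp
  next
    case False
    then show ?thesis using *[OF h g, of k j] by (simp add: mult.commute)
  qed
qed

text \<open>
  The first sum is a function of the history at time \<open>a\<close>. Every filter in the second sum looks back
  more than \<open>m\<close> steps before it meets that history, so replacing the history by its copy changes each
  summand by at most \<open>W A \<rho>\<^sup>m\<close>.
\<close>

lemma geometric_filter_decouple:
  fixes F :: "nat \<Rightarrow> (nat \<Rightarrow> real) \<Rightarrow> real" and w :: "nat \<Rightarrow> real" and a m :: nat
    and A \<rho> W :: real
  assumes F: "\<And>k. geometric_filter A \<rho> (F k)" and \<rho>: "0 \<le> \<rho>" "\<rho> \<le> 1"
    and w: "\<And>k. k \<in> K \<Longrightarrow> \<bar>w k\<bar> \<le> W" and W: "0 \<le> W"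
    and J: "J \<subseteq> {1..a}" and K: "finite K" "\<And>k. k \<in> K \<Longrightarrow> a + m < k"
  defines "\<xi> \<equiv> \<lambda>k \<omega>. w k * F k (history \<epsilon> (int k) \<omega>)"
  shows "cmod (expectation (\<lambda>\<omega>. iexp ((\<Sum>j\<in>J. \<xi> j \<omega>) + (\<Sum>k\<in>K. \<xi> k \<omega>)))
          - expectation (\<lambda>\<omega>. iexp (\<Sum>j\<in>J. \<xi> j \<omega>)) * expectation (\<lambda>\<omega>. iexp (\<Sum>k\<in>K. \<xi> k \<omega>)))
        \<le> card K * (W * A * \<rho> ^ m)"
proof -
  let ?\<Phi> = "\<lambda>x. \<Sum>j\<in>J. w j * F j (\<lambda>i. x (i + (a - j)))"
  let ?\<Psi> = "\<lambda>z. \<Sum>k\<in>K. w k * F k (\<lambda>i. z (int k - int i))"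
  note Fm = geometric_filterD(1)[OF F]
  have sh: "(\<lambda>x i. x (i + c)) \<in> Pi\<^sub>M UNIV (\<lambda>_. borel) \<rightarrow>\<^sub>M Pi\<^sub>M UNIV (\<lambda>_. borel :: real measure)" for c :: nat
    by (rule measurable_PiM_single') auto
  have m1: "?\<Phi> \<in> borel_measurable (Pi\<^sub>M UNIV (\<lambda>_. borel))"
    by (intro borel_measurable_sum borel_measurable_times borel_measurable_const measurable_compose[OF sh Fm])
  have m2: "?\<Psi> \<in> borel_measurable (Pi\<^sub>M UNIV (\<lambda>_. borel))"
    by (intro borel_measurable_sum borel_measurable_times borel_measurable_const measurable_compose[OF measurable_shift Fm])
  have e1: "?\<Phi> (history \<epsilon> (int a) \<omega>) = (\<Sum>j\<in>J. \<xi> j \<omega>)" for \<omega>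
  proof (unfold \<xi>_def, rule sum.cong[OF refl])
    fix j assume "j \<in> J"
    then have "j \<le> a" using J by auto
    then have "(\<lambda>i. history \<epsilon> (int a) \<omega> (i + (a - j))) = history \<epsilon> (int j) \<omega>"
      by (simp add: history_def fun_eq_iff of_nat_diff)
    then show "w j * F j (\<lambda>i. history \<epsilon> (int a) \<omega> (i + (a - j))) = w j * F j (history \<epsilon> (int j) \<omega>)" by simp
  qed
  have e2: "?\<Psi> (draw Inl \<omega>) = (\<Sum>k\<in>K. \<xi> k \<omega>)" for \<omega>
    by (simp add: \<xi>_def history_eq_draw draw_def)
  have D: "L4_le M (\<lambda>\<omega>. ?\<Psi> (draw Inl \<omega>) - ?\<Psi> (draw (mixed (int a)) \<omega>)) (\<Sum>k\<in>K. W * (A * \<rho> ^ m))"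
  proof -
    have "L4_le M (\<lambda>\<omega>. \<Sum>k\<in>K. w k * (F k (history \<epsilon> (int k) \<omega>) - F k (draw (\<lambda>i. mixed (int a) (int k - int i)) \<omega>)))
       (\<Sum>k\<in>K. W * (A * \<rho> ^ m))"
    proof (rule L4_le_sum)
      fix k assume k: "k \<in> K"
      then have ak: "a \<le> k" "m \<le> k - a" using K(2)[OF k] by auto
      have A: "0 \<le> A" using L4_le_nonneg[OF geometric_filterD(2)[OF F[of k]]] .
      have "L4_le M (\<lambda>\<omega>. F k (history \<epsilon> (int k) \<omega>) - F k (draw (\<lambda>i. mixed (int a) (int k - int i)) \<omega>)) (A * \<rho> ^ (k - a))"
        using geometric_filterD(4)[OF F[of k], of "int k" "k - a"] ak by (simp add: of_nat_diff)
      from L4_le_scale[OF this, of "w k"]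
      show "L4_le M (\<lambda>\<omega>. w k * (F k (history \<epsilon> (int k) \<omega>) - F k (draw (\<lambda>i. mixed (int a) (int k - int i)) \<omega>))) (W * (A * \<rho> ^ m))"
        by (rule L4_le_mono) (use w[OF k] W A \<rho> ak in \<open>intro mult_mono mult_left_mono power_decreasing; simp\<close>)
    qed
    also have "(\<lambda>\<omega>. \<Sum>k\<in>K. w k * (F k (history \<epsilon> (int k) \<omega>) - F k (draw (\<lambda>i. mixed (int a) (int k - int i)) \<omega>)))
       = (\<lambda>\<omega>. ?\<Psi> (draw Inl \<omega>) - ?\<Psi> (draw (mixed (int a)) \<omega>))"
      by (simp add: history_eq_draw draw_def right_diff_distrib sum_subtractf)
    finally show ?thesis .
  qed
  from iexp_decouple[OF m1 m2 L4_le_integrable[OF D]] L4_le_expectation_abs[OF D]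
  show ?thesis unfolding e1 e2 by (simp add: mult.assoc)
qed

theorem geometric_filter_clt:
  fixes F :: "nat \<Rightarrow> nat \<Rightarrow> (nat \<Rightarrow> real) \<Rightarrow> real" and w :: "nat \<Rightarrow> nat \<Rightarrow> real"
    and A \<rho> W v :: real
  assumes F: "\<And>n k. geometric_filter A \<rho> (F n k)" and \<rho>: "0 \<le> \<rho>" "\<rho> < 1"
    and w: "\<And>n k. k \<in> {1..n} \<Longrightarrow> \<bar>w n k\<bar> \<le> W / sqrt n" and W: "0 \<le> W"
    and var: "(\<lambda>n. expectation (\<lambda>\<omega>. (\<Sum>k=1..n. w n k * F n k (history \<epsilon> (int k) \<omega>))\<^sup>2)) \<longlonglongrightarrow> v"
  shows "(\<lambda>n. expectation (\<lambda>\<omega>. iexp (\<Sum>k=1..n. w n k * F n k (history \<epsilon> (int k) \<omega>)))) \<longlonglongrightarrow> complex_of_real (exp (- v / 2))"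
proof -
  have A: "0 \<le> A" using L4_le_nonneg[OF geometric_filterD(2)[OF F]] .
  define B where "B = W * A + W * W * (A * A)"
  have B: "0 \<le> B" "W * A \<le> B" "W * W * (A * A) \<le> B" using A W by (auto simp: B_def)
  show ?thesis
  proof (rule blocking_clt[OF B(1) \<rho>, where \<xi> = "\<lambda>n k \<omega>. w n k * F n k (history \<epsilon> (int k) \<omega>)", OF _ _ _ _ var])
    fix n k :: nat assume k: "k \<in> {1..n}"
    show "L4_le M (\<lambda>\<omega>. w n k * F n k (history \<epsilon> (int k) \<omega>)) (B / sqrt n)"
    proof (rule L4_le_mono[OF L4_le_scale[OF geometric_filterD(2)[OF F]]])
      have "\<bar>w n k\<bar> * A \<le> W / sqrt n * A" by (rule mult_right_mono[OF w[OF k] A])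
      also have "\<dots> = (W * A) / sqrt n" by simp
      also have "\<dots> \<le> B / sqrt n" by (intro divide_right_mono B) simp
      finally show "\<bar>w n k\<bar> * A \<le> B / sqrt n" .
    qed
    show "expectation (\<lambda>\<omega>. w n k * F n k (history \<epsilon> (int k) \<omega>)) = 0"
      using geometric_filterD(3)[OF F] by simp
  next
    fix n j k :: nat assume jk: "j \<in> {1..n}" "k \<in> {1..n}"
    have "\<bar>expectation (\<lambda>\<omega>. w n j * F n j (history \<epsilon> (int j) \<omega>) * (w n k * F n k (history \<epsilon> (int k) \<omega>)))\<bar>
       = (\<bar>w n j\<bar> * \<bar>w n k\<bar>) * \<bar>expectation (\<lambda>\<omega>. F n j (history \<epsilon> (int j) \<omega>) * F n k (history \<epsilon> (int k) \<omega>))\<bar>"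
    proof -
      have "(\<lambda>\<omega>. w n j * F n j (history \<epsilon> (int j) \<omega>) * (w n k * F n k (history \<epsilon> (int k) \<omega>)))
         = (\<lambda>\<omega>. (w n j * w n k) * (F n j (history \<epsilon> (int j) \<omega>) * F n k (history \<epsilon> (int k) \<omega>)))"
        by (simp add: ac_simps)
      then show ?thesis by (simp only: integral_mult_right_zero abs_mult)
    qed
    also have "\<dots> \<le> (W / sqrt n * (W / sqrt n)) * (A * A * \<rho> ^ nat \<bar>int j - int k\<bar>)"
      using w[OF jk(1)] w[OF jk(2)] W A \<rho> by (intro mult_mono geometric_filter_covariance F) auto
    also have "\<dots> = (W * W * (A * A)) / n * \<rho> ^ gap j k" by simp
    also have "\<dots> \<le> B / n * \<rho> ^ gap j k" using \<rho> by (intro mult_right_mono divide_right_mono B) auto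
    finally show "\<bar>expectation (\<lambda>\<omega>. w n j * F n j (history \<epsilon> (int j) \<omega>) * (w n k * F n k (history \<epsilon> (int k) \<omega>)))\<bar> \<le> B / n * \<rho> ^ gap j k" .
  next
    fix n m a :: nat and J K assume J: "J \<subseteq> {1..a}" and "J \<subseteq> {1..n}" and K: "K \<subseteq> {a + m<..n}"
    then have fin: "finite K" using finite_subset by blast
    have "cmod (expectation (\<lambda>\<omega>. iexp ((\<Sum>j\<in>J. w n j * F n j (history \<epsilon> (int j) \<omega>)) + (\<Sum>k\<in>K. w n k * F n k (history \<epsilon> (int k) \<omega>))))
          - expectation (\<lambda>\<omega>. iexp (\<Sum>j\<in>J. w n j * F n j (history \<epsilon> (int j) \<omega>))) * expectation (\<lambda>\<omega>. iexp (\<Sum>k\<in>K. w n k * F n k (history \<epsilon> (int k) \<omega>))))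
        \<le> card K * (W / sqrt n * A * \<rho> ^ m)"
      by (rule geometric_filter_decouple[OF F _ _ _ _ J fin]) (use \<rho> W w K in auto)
    also have "\<dots> \<le> card K * (B / sqrt n * \<rho> ^ m)"
      using \<rho> B(2) by (intro mult_left_mono mult_right_mono) (auto intro: divide_right_mono)
    finally show "cmod (expectation (\<lambda>\<omega>. iexp ((\<Sum>j\<in>J. w n j * F n j (history \<epsilon> (int j) \<omega>)) + (\<Sum>k\<in>K. w n k * F n k (history \<epsilon> (int k) \<omega>))))
          - expectation (\<lambda>\<omega>. iexp (\<Sum>j\<in>J. w n j * F n j (history \<epsilon> (int j) \<omega>))) * expectation (\<lambda>\<omega>. iexp (\<Sum>k\<in>K. w n k * F n k (history \<epsilon> (int k) \<omega>))))
        \<le> card K * (B / sqrt n * \<rho> ^ m)" .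
  qed
qed

end

section \<open>Piecewise locally stationary processes\<close>

locale pls = iid_pair M \<epsilon> \<epsilon>' for M :: "'a measure" and \<epsilon> \<epsilon>' +
  fixes r :: nat and d :: "nat \<Rightarrow> real" and G :: "nat \<Rightarrow> real \<Rightarrow> (nat \<Rightarrow> real) \<Rightarrow> real" and \<rho> :: real
  assumes breaks: "break_points r d"
    and filters: "measurable_filters r d G"
    and second_moments: "\<And>n j. 1 \<le> j \<Longrightarrow> j \<le> n \<Longrightarrow> lp_norm M 2 (pls_process r d G \<epsilon> n j) < \<top>"
    and centred: "\<And>n j. 1 \<le> j \<Longrightarrow> j \<le> n \<Longrightarrow> expectation (pls_process r d G \<epsilon> n j) = 0"
    and rho: "0 \<le> \<rho>" "\<rho> < 1"
    and dependence: "\<exists>K::real. \<forall>k. dependence_measure M r d G \<epsilon> \<epsilon>' k 4 \<le> ennreal (K * \<rho> ^ k)"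
    and lipschitz: "\<exists>C::real. \<forall>k\<le>r. \<forall>t\<in>{d k..d (Suc k)}. \<forall>s\<in>{d k..d (Suc k)}.
           lp_norm M 4 (\<lambda>\<omega>. G k t (history \<epsilon> 0 \<omega>) - G k s (history \<epsilon> 0 \<omega>)) \<le> ennreal (C * \<bar>t - s\<bar>)"
begin

subsection \<open>Regimes\<close>

lemma d_less: "j \<le> r \<Longrightarrow> d j < d (Suc j)"
  using breaks by (simp add: break_points_def)

lemma d_mono: "i \<le> j \<Longrightarrow> j \<le> Suc r \<Longrightarrow> d i \<le> d j"
proof (induction j rule: dec_induct)
  case (step j)
  then show ?case using d_less[of j] by simp
qed simp

lemma d_ge_0: "j \<le> Suc r \<Longrightarrow> 0 \<le> d j" and d_le_1: "j \<le> Suc r \<Longrightarrow> d j \<le> 1"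
  using d_mono[of 0 j] d_mono[of j "Suc r"] breaks by (simp_all add: break_points_def)

lemma regime_unique:
  assumes "i \<le> r" "j \<le> r" "t \<in> {d i<..d (Suc i)}" "t \<in> {d j<..d (Suc j)}"
  shows "i = j"
proof (rule ccontr)
  assume "i \<noteq> j"
  then consider "Suc i \<le> j" | "Suc j \<le> i" by linarith
  then show False
  proof cases
    case 1
    then show False using d_mono[of "Suc i" j] assms by auto
  next
    case 2
    then show False using d_mono[of "Suc j" i] assms by auto
  qed
qed

lemma regime_exists:
  assumes "t \<in> {0<..1}" obtains j where "j \<le> r" "t \<in> {d j<..d (Suc j)}"
proof -
  let ?P = "\<lambda>i. t \<le> d (Suc i)"
  have P: "?P r" using assms breaks by (simp add: break_points_def)
  define j where "j = (LEAST i. ?P i)"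
  have j: "?P j" "j \<le> r" unfolding j_def by (rule LeastI[of ?P, OF P], rule Least_le[of ?P, OF P])
  have "d j < t"
  proof (cases j)
    case 0
    then show ?thesis using assms breaks by (simp add: break_points_def)
  next
    case (Suc i)
    then have "\<not> ?P i" using not_less_Least[of i ?P] by (simp add: j_def)
    then show ?thesis using Suc by simp
  qed
  then show thesis using that j by auto
qed

lemma regime_eq:
  assumes "j \<le> r" "t \<in> {d j<..d (Suc j)}" shows "regime r d t = j"
proof -
  have "t \<noteq> 0" using assms d_ge_0[of j] by auto
  moreover have "(THE k. k \<le> r \<and> d k < t \<and> t \<le> d (Suc k)) = j"
  proof (rule the_equality)
    show "j \<le> r \<and> d j < t \<and> t \<le> d (Suc j)" using assms by simp
    show "k = j" if "k \<le> r \<and> d k < t \<and> t \<le> d (Suc k)" for k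
      by (rule regime_unique[of k j t]) (use assms that in auto)
  qed
  ultimately show ?thesis by (simp add: regime_def)
qed

text \<open>The filter producing the \<open>k\<close>-th observation; it vanishes for indices outside \<open>1, \<dots>, n\<close>.\<close>

definition obs_filter :: "nat \<Rightarrow> int \<Rightarrow> (nat \<Rightarrow> real) \<Rightarrow> real" where
  "obs_filter n k x = (\<Sum>j\<le>r. G j (real_of_int k / real n) x * indicator {d j<..d (Suc j)} (real_of_int k / real n))"

lemma pls_process_eq: "pls_process r d G \<epsilon> n k \<omega> = obs_filter n (int k) (history \<epsilon> (int k) \<omega>)"
  by (simp add: pls_process_def obs_filter_def)

lemma obs_filter_in_regime:
  assumes j: "j \<le> r" "real_of_int k / real n \<in> {d j<..d (Suc j)}"
  shows "obs_filter n k = G j (real_of_int k / real n)"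
proof
  fix x
  let ?t = "real_of_int k / real n"
  have "obs_filter n k x = (\<Sum>i\<le>r. if i = j then G j ?t x else 0)"
    unfolding obs_filter_def
  proof (rule sum.cong[OF refl])
    fix i assume "i \<in> {..r}"
    then have "?t \<in> {d i<..d (Suc i)} \<longleftrightarrow> i = j" using j regime_unique[of i j ?t] by blast
    then show "G i ?t x * indicator {d i<..d (Suc i)} ?t = (if i = j then G j ?t x else 0)"
      by (simp add: indicator_def)
  qed
  then show "obs_filter n k x = G j ?t x" using j by simp
qed

lemma obs_filter_outside:
  assumes "real_of_int k / real n \<notin> {0<..1}" shows "obs_filter n k = (\<lambda>_. 0)"
proof
  fix x
  have "real_of_int k / real n \<notin> {d i<..d (Suc i)}" if "i \<le> r" for i
    using assms d_ge_0[of i] d_le_1[of "Suc i"] that by auto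
  then show "obs_filter n k x = 0" unfolding obs_filter_def by (intro sum.neutral) auto
qed

lemma measurable_G:
  assumes "j \<le> r" "t \<in> {d j..d (Suc j)}"
  shows "G j t \<in> borel_measurable (Pi\<^sub>M UNIV (\<lambda>_. borel))"
proof -
  have "(\<lambda>x. (t, x)) \<in> Pi\<^sub>M UNIV (\<lambda>_. borel) \<rightarrow>\<^sub>M restrict_space borel {d j..d (Suc j)} \<Otimes>\<^sub>M Pi\<^sub>M UNIV (\<lambda>_. borel :: real measure)"
    using assms by (intro measurable_Pair1') (simp add: space_restrict_space)
  moreover have "(\<lambda>(t, x). G j t x) \<in> borel_measurable (restrict_space borel {d j..d (Suc j)} \<Otimes>\<^sub>M Pi\<^sub>M UNIV (\<lambda>_. borel))"
    using filters assms(1) by (simp add: measurable_filters_def)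
  ultimately have "(\<lambda>x. (\<lambda>(t, x). G j t x) (t, x)) \<in> borel_measurable (Pi\<^sub>M UNIV (\<lambda>_. borel))"
    by (rule measurable_compose)
  then show ?thesis by simp
qed

subsection \<open>The filters are geometrically dependent\<close>

lemma coupled_history_eq_draw:
  "coupled_history \<epsilon> \<epsilon>' N = draw (\<lambda>i. if i = N then Inr (- int N) else Inl (0 - int i))"
  by (auto simp: coupled_history_def history_def draw_def noise_def fun_eq_iff)

lemma coupling_bound:
  "\<exists>K\<ge>0. \<forall>j\<le>r. \<forall>t\<in>{d j<..d (Suc j)}. \<forall>N.
     L4_le M (\<lambda>\<omega>. G j t (history \<epsilon> 0 \<omega>) - G j t (coupled_history \<epsilon> \<epsilon>' N \<omega>)) (K * \<rho> ^ N)"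
proof -
  obtain K :: real where K: "\<And>k. dependence_measure M r d G \<epsilon> \<epsilon>' k 4 \<le> ennreal (K * \<rho> ^ k)"
    using dependence by blast
  have "L4_le M (\<lambda>\<omega>. G j t (history \<epsilon> 0 \<omega>) - G j t (coupled_history \<epsilon> \<epsilon>' N \<omega>)) (max K 0 * \<rho> ^ N)"
    if j: "j \<le> r" and t: "t \<in> {d j<..d (Suc j)}" for j t N
  proof (rule lp_norm_4_le_imp_L4_le)
    have [measurable]: "G j t \<in> borel_measurable (Pi\<^sub>M UNIV (\<lambda>_. borel))" using j t by (intro measurable_G) auto
    show "(\<lambda>\<omega>. G j t (history \<epsilon> 0 \<omega>) - G j t (coupled_history \<epsilon> \<epsilon>' N \<omega>)) \<in> borel_measurable M"
      unfolding coupled_history_eq_draw by measurable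
    have "lp_norm M 4 (\<lambda>\<omega>. G j t (history \<epsilon> 0 \<omega>) - G j t (coupled_history \<epsilon> \<epsilon>' N \<omega>))
       \<le> (SUP t\<in>{d j<..d (Suc j)}. lp_norm M 4 (\<lambda>\<omega>. G j t (history \<epsilon> 0 \<omega>) - G j t (coupled_history \<epsilon> \<epsilon>' N \<omega>)))"
      by (rule SUP_upper[OF t])
    also have "\<dots> \<le> dependence_measure M r d G \<epsilon> \<epsilon>' N 4"
      unfolding dependence_measure_def using j by (intro Max_ge) auto
    also note K
    finally show "lp_norm M 4 (\<lambda>\<omega>. G j t (history \<epsilon> 0 \<omega>) - G j t (coupled_history \<epsilon> \<epsilon>' N \<omega>)) \<le> ennreal (K * \<rho> ^ N)" .
  qed (use rho in \<open>auto intro!: mult_right_mono\<close>)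
  then show ?thesis by (intro exI[of _ "max K 0"]) auto
qed

lemma lipschitz_bound:
  "\<exists>C\<ge>0. \<forall>j\<le>r. \<forall>t\<in>{d j..d (Suc j)}. \<forall>s\<in>{d j..d (Suc j)}.
     L4_le M (\<lambda>\<omega>. G j t (history \<epsilon> 0 \<omega>) - G j s (history \<epsilon> 0 \<omega>)) (C * \<bar>t - s\<bar>)"
proof -
  obtain C :: real where C: "\<And>k t s. k \<le> r \<Longrightarrow> t \<in> {d k..d (Suc k)} \<Longrightarrow> s \<in> {d k..d (Suc k)} \<Longrightarrow>
    lp_norm M 4 (\<lambda>\<omega>. G k t (history \<epsilon> 0 \<omega>) - G k s (history \<epsilon> 0 \<omega>)) \<le> ennreal (C * \<bar>t - s\<bar>)"
    using lipschitz by blast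
  have "L4_le M (\<lambda>\<omega>. G j t (history \<epsilon> 0 \<omega>) - G j s (history \<epsilon> 0 \<omega>)) (max C 0 * \<bar>t - s\<bar>)"
    if j: "j \<le> r" and t: "t \<in> {d j..d (Suc j)}" and s: "s \<in> {d j..d (Suc j)}" for j t s
  proof (rule lp_norm_4_le_imp_L4_le[OF _ C[OF j t s]])
    note [measurable] = measurable_G[OF j t] measurable_G[OF j s]
    show "(\<lambda>\<omega>. G j t (history \<epsilon> 0 \<omega>) - G j s (history \<epsilon> 0 \<omega>)) \<in> borel_measurable M"
      by measurable
  qed (auto intro!: mult_right_mono)
  then show ?thesis by (intro exI[of _ "max C 0"]) auto
qed

text \<open>Sampling times of a fine grid approximate every point of a regime from within that regime.\<close>

lemma grid_point:
  assumes j: "j \<le> r" and t: "t \<in> {d j<..d (Suc j)}" and n: "1 / real n < t - d j" "0 < n"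
  obtains k where "1 \<le> k" "k \<le> n" "real k / real n \<in> {d j<..d (Suc j)}" "\<bar>t - real k / real n\<bar> \<le> 1 / real n"
proof -
  define k where "k = nat \<lfloor>t * real n\<rfloor>"
  have t01: "0 < t" "t \<le> 1" using t j d_ge_0[of j] d_le_1[of "Suc j"] by auto
  have k: "real k \<le> t * real n" "t * real n < real k + 1"
    using t01 by (auto simp: k_def)
  have le: "real k / real n \<le> t" using k n by (simp add: field_simps)
  have "(t * real n - 1) / real n < real k / real n" using k n by (intro divide_strict_right_mono) auto
  then have gt: "t - 1 / real n < real k / real n" using n by (simp add: diff_divide_distrib)
  show thesis
  proof (rule that)
    show in_regime: "real k / real n \<in> {d j<..d (Suc j)}" using le gt n t by auto
    then have "0 < real k / real n" using d_ge_0[of j] j by auto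
    then show "1 \<le> k" by (cases k) auto
    have "real k / real n \<le> 1" using le t01 by simp
    then show "k \<le> n" using n by (simp add: field_simps)
    show "\<bar>t - real k / real n\<bar> \<le> 1 / real n" using le gt by simp
  qed
qed

lemma observation_integrable:
  assumes "j \<le> r" "1 \<le> k" "k \<le> n" "real k / real n \<in> {d j<..d (Suc j)}"
  shows "integrable M (\<lambda>\<omega>. G j (real k / real n) (history \<epsilon> 0 \<omega>))"
    and "expectation (\<lambda>\<omega>. G j (real k / real n) (history \<epsilon> 0 \<omega>)) = 0"
proof -
  let ?g = "G j (real k / real n)"
  have g[measurable]: "?g \<in> borel_measurable (Pi\<^sub>M UNIV (\<lambda>_. borel))" using assms by (intro measurable_G) auto
  have inj: "inj (\<lambda>i. Inl (l - int i))" for l by (rule inj_past) simp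
  have X: "pls_process r d G \<epsilon> n k = (\<lambda>\<omega>. ?g (history \<epsilon> (int k) \<omega>))"
    using obs_filter_in_regime[of j "int k" n] assms by (simp add: pls_process_eq fun_eq_iff)
  have "(\<integral>\<^sup>+ \<omega>. ennreal (\<bar>?g (history \<epsilon> (int k) \<omega>)\<bar> powr 2) \<partial>M) \<noteq> \<top>"
    using second_moments[OF assms(2,3)] unfolding X lp_norm_def by (auto simp: Let_def split: if_splits)
  then have "integrable M (\<lambda>\<omega>. (?g (history \<epsilon> (int k) \<omega>))\<^sup>2)"
  proof -
    have "(\<integral>\<^sup>+ \<omega>. ennreal (\<bar>?g (history \<epsilon> (int k) \<omega>)\<bar> powr 2) \<partial>M) = (\<integral>\<^sup>+ \<omega>. ennreal ((?g (history \<epsilon> (int k) \<omega>))\<^sup>2) \<partial>M)"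
      by (intro nn_integral_cong) (simp add: powr_numeral)
    with \<open>(\<integral>\<^sup>+ \<omega>. ennreal (\<bar>?g (history \<epsilon> (int k) \<omega>)\<bar> powr 2) \<partial>M) \<noteq> \<top>\<close>
    show ?thesis by (intro integrableI_nonneg) (simp_all add: less_top)
  qed
  then have int: "integrable M (\<lambda>\<omega>. ?g (history \<epsilon> (int k) \<omega>))"
    by (rule square_integrable_imp_integrable[rotated]) measurable
  then show "integrable M (\<lambda>\<omega>. ?g (history \<epsilon> 0 \<omega>))"
    unfolding history_eq_draw integrable_draw_iff[OF inj g] .
  show "expectation (\<lambda>\<omega>. ?g (history \<epsilon> 0 \<omega>)) = 0"
    using centred[OF assms(2,3)] expectation_draw_eq[OF inj inj g, of 0 "int k"] unfolding X history_eq_draw by simp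
qed

text \<open>
  One sampling time in each regime has a finite fourth moment by the dependence bound; the
  Lipschitz condition carries this, and the zero means of the sampled times, to all times.
\<close>

lemma geometric_filters:
  "\<exists>A C. 0 \<le> A \<and> 0 \<le> C \<and> (\<forall>j\<le>r. \<forall>t\<in>{d j<..d (Suc j)}. geometric_filter A \<rho> (G j t)) \<and>
     (\<forall>j\<le>r. \<forall>t\<in>{d j<..d (Suc j)}. \<forall>s\<in>{d j<..d (Suc j)}.
        L4_le M (\<lambda>\<omega>. G j t (history \<epsilon> 0 \<omega>) - G j s (history \<epsilon> 0 \<omega>)) (C * \<bar>t - s\<bar>))"
proof -
  obtain K where K: "0 \<le> K" "\<And>j t N. j \<le> r \<Longrightarrow> t \<in> {d j<..d (Suc j)} \<Longrightarrow>
     L4_le M (\<lambda>\<omega>. G j t (history \<epsilon> 0 \<omega>) - G j t (coupled_history \<epsilon> \<epsilon>' N \<omega>)) (K * \<rho> ^ N)"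
    using coupling_bound by blast
  obtain C where C: "0 \<le> C" "\<And>j t s. j \<le> r \<Longrightarrow> t \<in> {d j..d (Suc j)} \<Longrightarrow> s \<in> {d j..d (Suc j)} \<Longrightarrow>
     L4_le M (\<lambda>\<omega>. G j t (history \<epsilon> 0 \<omega>) - G j s (history \<epsilon> 0 \<omega>)) (C * \<bar>t - s\<bar>)"
    using lipschitz_bound by blast
  have near: "\<exists>s\<in>{d j<..d (Suc j)}. \<bar>t - s\<bar> \<le> e \<and> integrable M (\<lambda>\<omega>. G j s (history \<epsilon> 0 \<omega>))
      \<and> expectation (\<lambda>\<omega>. G j s (history \<epsilon> 0 \<omega>)) = 0"
    if j: "j \<le> r" and t: "t \<in> {d j<..d (Suc j)}" and e: "0 < e" for j t e
  proof -
    obtain m where "inverse (real (Suc m)) < min e (t - d j)"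
      using reals_Archimedean[of "min e (t - d j)"] t e by auto
    moreover define n where "n = Suc m"
    ultimately have n: "0 < n" "1 / real n < min e (t - d j)" by (simp_all only: inverse_eq_divide zero_less_Suc)
    then obtain k where "1 \<le> k" "k \<le> n" "real k / real n \<in> {d j<..d (Suc j)}" "\<bar>t - real k / real n\<bar> \<le> 1 / real n"
      using grid_point[OF j t, of n] by auto
    note kn = this
    have "\<bar>t - real k / real n\<bar> \<le> e" using kn(4) n(2) by linarith
    with observation_integrable[OF j kn(1-3)] kn(3) show ?thesis by blast
  qed
  have "\<exists>B. \<forall>t\<in>{d j<..d (Suc j)}. L4_le M (\<lambda>\<omega>. G j t (history \<epsilon> 0 \<omega>)) B" if j: "j \<le> r" for j
  proof -
    have top: "d (Suc j) \<in> {d j<..d (Suc j)}" using d_less[OF j] by simp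
    from near[OF j top, of 1] obtain s where s: "s \<in> {d j<..d (Suc j)}" "integrable M (\<lambda>\<omega>. G j s (history \<epsilon> 0 \<omega>))" by auto
    have "G j s \<in> borel_measurable (Pi\<^sub>M UNIV (\<lambda>_. borel))" using j s by (intro measurable_G) auto
    from filter_L4[OF this s(2) K(2)[OF j s(1)] rho]
    obtain B where B: "L4_le M (\<lambda>\<omega>. G j s (history \<epsilon> 0 \<omega>)) B" by blast
    have "L4_le M (\<lambda>\<omega>. G j t (history \<epsilon> 0 \<omega>)) (C * 1 + B)" if t: "t \<in> {d j<..d (Suc j)}" for t
    proof -
      have "L4_le M (\<lambda>\<omega>. G j t (history \<epsilon> 0 \<omega>) - G j s (history \<epsilon> 0 \<omega>) + G j s (history \<epsilon> 0 \<omega>)) (C * \<bar>t - s\<bar> + B)"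
        by (intro L4_le_add B C(2)[OF j]) (use s t in auto)
      then have *: "L4_le M (\<lambda>\<omega>. G j t (history \<epsilon> 0 \<omega>)) (C * \<bar>t - s\<bar> + B)" by simp
      have "\<bar>t - s\<bar> \<le> 1" using s t d_ge_0[of j] d_le_1[of "Suc j"] j by auto
      then show ?thesis by (intro L4_le_mono[OF *] add_mono mult_left_mono C(1)) auto
    qed
    then show ?thesis by blast
  qed
  then obtain B where B: "\<And>j t. j \<le> r \<Longrightarrow> t \<in> {d j<..d (Suc j)} \<Longrightarrow> L4_le M (\<lambda>\<omega>. G j t (history \<epsilon> 0 \<omega>)) (B j)"
  proof -
    from \<open>\<And>j. j \<le> r \<Longrightarrow> \<exists>B. \<forall>t\<in>{d j<..d (Suc j)}. L4_le M (\<lambda>\<omega>. G j t (history \<epsilon> 0 \<omega>)) B\<close>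
    have "\<forall>j. \<exists>B. j \<le> r \<longrightarrow> (\<forall>t\<in>{d j<..d (Suc j)}. L4_le M (\<lambda>\<omega>. G j t (history \<epsilon> 0 \<omega>)) B)" by blast
    from choice[OF this] show ?thesis using that by blast
  qed
  have B0: "0 \<le> B j" if "j \<le> r" for j
    using L4_le_nonneg[OF B[OF that, of "d (Suc j)"]] d_less[OF that] by simp
  define A where "A = (\<Sum>j\<le>r. B j) + K / (1 - \<rho>)"
  have A: "B j \<le> A" "K / (1 - \<rho>) \<le> A" "0 \<le> A" if "j \<le> r" for j
  proof -
    have "B j \<le> (\<Sum>j\<le>r. B j)" using that B0 by (intro member_le_sum) auto
    moreover have "0 \<le> K / (1 - \<rho>)" "0 \<le> (\<Sum>j\<le>r. B j)" using K(1) rho B0 by (auto intro!: sum_nonneg)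
    ultimately show "B j \<le> A" "K / (1 - \<rho>) \<le> A" "0 \<le> A" by (auto simp: A_def)
  qed
  have "geometric_filter A \<rho> (G j t)" if j: "j \<le> r" and t: "t \<in> {d j<..d (Suc j)}" for j t
  proof -
    have m: "G j t \<in> borel_measurable (Pi\<^sub>M UNIV (\<lambda>_. borel))" using j t by (intro measurable_G) auto
    have L: "L4_le M (\<lambda>\<omega>. G j t (history \<epsilon> 0 \<omega>)) A" by (rule L4_le_mono[OF B[OF j t] A(1)[OF j]])
    have "\<bar>expectation (\<lambda>\<omega>. G j t (history \<epsilon> 0 \<omega>))\<bar> \<le> 0 + e" if e: "0 < e" for e
    proof -
      have "0 < e / (C + 1)" using e C(1) by simp
      from near[OF j t this] obtain s where s: "s \<in> {d j<..d (Suc j)}" "\<bar>t - s\<bar> \<le> e / (C + 1)"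
        "integrable M (\<lambda>\<omega>. G j s (history \<epsilon> 0 \<omega>))" "expectation (\<lambda>\<omega>. G j s (history \<epsilon> 0 \<omega>)) = 0" by blast
      have D: "L4_le M (\<lambda>\<omega>. G j t (history \<epsilon> 0 \<omega>) - G j s (history \<epsilon> 0 \<omega>)) (C * \<bar>t - s\<bar>)"
        using s t by (intro C(2)[OF j]) auto
      have "expectation (\<lambda>\<omega>. G j t (history \<epsilon> 0 \<omega>)) = expectation (\<lambda>\<omega>. G j t (history \<epsilon> 0 \<omega>) - G j s (history \<epsilon> 0 \<omega>))"
        using s(3,4) L4_le_integrable[OF L] by simp
      also have "\<bar>\<dots>\<bar> \<le> expectation (\<lambda>\<omega>. \<bar>G j t (history \<epsilon> 0 \<omega>) - G j s (history \<epsilon> 0 \<omega>)\<bar>)" by (rule integral_abs_bound)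
      also have "\<dots> \<le> C * \<bar>t - s\<bar>" by (rule L4_le_expectation_abs[OF D])
      also have "\<dots> \<le> (C + 1) * (e / (C + 1))" using s(2) C(1) by (intro mult_mono) auto
      also have "\<dots> = e" using C(1) by simp
      finally show ?thesis by simp
    qed
    then have mean: "expectation (\<lambda>\<omega>. G j t (history \<epsilon> 0 \<omega>)) = 0"
      using field_le_epsilon[of "\<bar>expectation (\<lambda>\<omega>. G j t (history \<epsilon> 0 \<omega>))\<bar>" 0] by simp
    have "L4_le M (\<lambda>\<omega>. G j t (history \<epsilon> k \<omega>) - G j t (draw (\<lambda>i. mixed (k - int L) (k - int i)) \<omega>)) (A * \<rho> ^ L)" for k L
    proof (rule L4_le_mono[OF filter_coupling[OF m L4_le_integrable[OF L] K(2)[OF j t] rho]])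
      have "K * \<rho> ^ L / (1 - \<rho>) = K / (1 - \<rho>) * \<rho> ^ L" by simp
      also have "\<dots> \<le> A * \<rho> ^ L" using A(2)[OF j] rho by (intro mult_right_mono) auto
      finally show "K * \<rho> ^ L / (1 - \<rho>) \<le> A * \<rho> ^ L" .
    qed
    with m L mean show ?thesis by (simp add: geometric_filter_def)
  qed
  moreover have "L4_le M (\<lambda>\<omega>. G j t (history \<epsilon> 0 \<omega>) - G j s (history \<epsilon> 0 \<omega>)) (C * \<bar>t - s\<bar>)"
    if "j \<le> r" "t \<in> {d j<..d (Suc j)}" "s \<in> {d j<..d (Suc j)}" for j t s
    using C(2)[OF that(1), of t s] that(2,3) by simp
  moreover have "0 \<le> A" by (rule A(3)[of 0]) simp
  ultimately show ?thesis using C(1) by (intro exI[of _ A] exI[of _ C] conjI allI ballI impI)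
qed

text \<open>One constant that serves as \<open>L\<^sup>4\<close> bound and as coupling constant for all filters at all times.\<close>

definition amp :: real where
  "amp = (SOME A. \<exists>C. 0 \<le> A \<and> 0 \<le> C \<and> (\<forall>j\<le>r. \<forall>t\<in>{d j<..d (Suc j)}. geometric_filter A \<rho> (G j t)) \<and>
     (\<forall>j\<le>r. \<forall>t\<in>{d j<..d (Suc j)}. \<forall>s\<in>{d j<..d (Suc j)}.
        L4_le M (\<lambda>\<omega>. G j t (history \<epsilon> 0 \<omega>) - G j s (history \<epsilon> 0 \<omega>)) (C * \<bar>t - s\<bar>)))"

lemma amp:
  "0 \<le> amp" "j \<le> r \<Longrightarrow> t \<in> {d j<..d (Suc j)} \<Longrightarrow> geometric_filter amp \<rho> (G j t)"
  "\<exists>C\<ge>0. \<forall>j\<le>r. \<forall>t\<in>{d j<..d (Suc j)}. \<forall>s\<in>{d j<..d (Suc j)}.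
        L4_le M (\<lambda>\<omega>. G j t (history \<epsilon> 0 \<omega>) - G j s (history \<epsilon> 0 \<omega>)) (C * \<bar>t - s\<bar>)"
  using someI_ex[OF geometric_filters, folded amp_def] by blast+

lemma geometric_obs_filter: "geometric_filter amp \<rho> (obs_filter n k)"
proof (cases "real_of_int k / real n \<in> {0<..1}")
  case True
  then obtain j where "j \<le> r" "real_of_int k / real n \<in> {d j<..d (Suc j)}" by (rule regime_exists)
  then show ?thesis using amp(2) obs_filter_in_regime by simp
next
  case False
  then show ?thesis using obs_filter_outside geometric_filter_zero[OF amp(1) rho(1)] by simp
qed

subsection \<open>Covariances\<close>

definition obs_cov :: "nat \<Rightarrow> int \<Rightarrow> int \<Rightarrow> real" where
  "obs_cov n j k = expectation (\<lambda>\<omega>. obs_filter n j (history \<epsilon> j \<omega>) * obs_filter n k (history \<epsilon> k \<omega>))"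

abbreviation acov :: "real \<Rightarrow> int \<Rightarrow> real" where
  "acov \<equiv> local_acov M r d G \<epsilon>"

lemma obs_cov_bound: "\<bar>obs_cov n j k\<bar> \<le> amp * amp * \<rho> ^ nat \<bar>j - k\<bar>"
  unfolding obs_cov_def by (rule geometric_filter_covariance[OF geometric_obs_filter geometric_obs_filter rho(1)])

lemma obs_cov_outside: "k \<notin> {1..int n} \<Longrightarrow> obs_cov n j k = 0"
proof -
  assume "k \<notin> {1..int n}"
  then have "real_of_int k / real n \<notin> {0<..1}"
    by (cases "n = 0") (auto simp: zero_less_divide_iff divide_le_eq_1)
  then show ?thesis by (simp add: obs_cov_def obs_filter_outside)
qed

lemma acov_eq:
  assumes "j \<le> r" "t \<in> {d j<..d (Suc j)}"
  shows "acov t h = expectation (\<lambda>\<omega>. G j t (history \<epsilon> 0 \<omega>) * G j t (history \<epsilon> h \<omega>))"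
  using geometric_filterD(3)[OF amp(2)[OF assms]]
  by (simp add: local_acov_def covariance_def regime_eq[OF assms])

lemma acov_bound: "t \<in> {0<..1} \<Longrightarrow> \<bar>acov t h\<bar> \<le> amp * amp * \<rho> ^ nat \<bar>h\<bar>"
proof (erule regime_exists)
  fix j assume j: "j \<le> r" "t \<in> {d j<..d (Suc j)}"
  show ?thesis
    using geometric_filter_covariance[OF amp(2)[OF j] amp(2)[OF j] rho(1), of 0 h]
    by (simp add: acov_eq[OF j])
qed

lemma stationary_product:
  fixes g1 g2 :: "(nat \<Rightarrow> real) \<Rightarrow> real"
  assumes "g1 \<in> borel_measurable (Pi\<^sub>M UNIV (\<lambda>_. borel))" "g2 \<in> borel_measurable (Pi\<^sub>M UNIV (\<lambda>_. borel))"
  shows "expectation (\<lambda>\<omega>. g1 (history \<epsilon> k \<omega>) * g2 (history \<epsilon> (k + h) \<omega>))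
       = expectation (\<lambda>\<omega>. g1 (history \<epsilon> 0 \<omega>) * g2 (history \<epsilon> h \<omega>))"
proof -
  let ?\<phi> = "\<lambda>z. g1 (\<lambda>i. z (0 - int i)) * g2 (\<lambda>i. z (h - int i))"
  have m: "?\<phi> \<in> borel_measurable (Pi\<^sub>M UNIV (\<lambda>_. borel))"
    by (intro borel_measurable_times measurable_compose[OF measurable_shift assms(1)] measurable_compose[OF measurable_shift assms(2)])
  have "inj (\<lambda>j. Inl (k + j))" by (simp add: inj_def)
  from expectation_draw_eq[OF this inj_Inl m]
  show ?thesis by (simp add: history_eq_draw draw_def add_diff_eq)
qed

text \<open>Moving both time arguments within one regime moves the lagged product moment at most linearly.\<close>

lemma product_lipschitz:
  "\<exists>D\<ge>0. \<forall>l\<le>r. \<forall>t\<in>{d l<..d (Suc l)}. \<forall>s\<in>{d l<..d (Suc l)}. \<forall>s'\<in>{d l<..d (Suc l)}. \<forall>h.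
     \<bar>expectation (\<lambda>\<omega>. G l s (history \<epsilon> 0 \<omega>) * G l s' (history \<epsilon> h \<omega>)) - acov t h\<bar> \<le> D * (\<bar>s - t\<bar> + \<bar>s' - t\<bar>)"
proof -
  obtain C where C: "0 \<le> C" "\<And>j t s. j \<le> r \<Longrightarrow> t \<in> {d j<..d (Suc j)} \<Longrightarrow> s \<in> {d j<..d (Suc j)} \<Longrightarrow>
        L4_le M (\<lambda>\<omega>. G j t (history \<epsilon> 0 \<omega>) - G j s (history \<epsilon> 0 \<omega>)) (C * \<bar>t - s\<bar>)"
    using amp(3) by blast
  have "\<bar>expectation (\<lambda>\<omega>. G l s (history \<epsilon> 0 \<omega>) * G l s' (history \<epsilon> h \<omega>)) - acov t h\<bar> \<le> amp * C * (\<bar>s - t\<bar> + \<bar>s' - t\<bar>)"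
    if l: "l \<le> r" and t: "t \<in> {d l<..d (Suc l)}" and s: "s \<in> {d l<..d (Suc l)}" and s': "s' \<in> {d l<..d (Suc l)}" for l t s s' h
  proof -
    let ?a = "\<lambda>\<omega>. G l s (history \<epsilon> 0 \<omega>)" and ?b = "\<lambda>\<omega>. G l s' (history \<epsilon> h \<omega>)"
    let ?u = "\<lambda>\<omega>. G l t (history \<epsilon> 0 \<omega>)" and ?v = "\<lambda>\<omega>. G l t (history \<epsilon> h \<omega>)"
    have inj: "inj (\<lambda>i. Inl (k - int i))" for k by (rule inj_past) simp
    have D1: "L4_le M (\<lambda>\<omega>. ?a \<omega> - ?u \<omega>) (C * \<bar>s - t\<bar>)" by (rule C(2)[OF l s t])
    have m: "(\<lambda>x. G l s' x - G l t x) \<in> borel_measurable (Pi\<^sub>M UNIV (\<lambda>_. borel))"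
      using l s' t by (intro borel_measurable_diff measurable_G) auto
    have D2: "L4_le M (\<lambda>\<omega>. ?b \<omega> - ?v \<omega>) (C * \<bar>s' - t\<bar>)"
      using L4_le_draw[OF inj inj m, of 0 _ h] C(2)[OF l s' t] by (simp add: history_eq_draw)
    have L: "L4_le M ?a amp" "L4_le M ?b amp" "L4_le M ?u amp" "L4_le M ?v amp"
      by (rule geometric_filterD(2)[OF amp(2)]; fact)+
    have "expectation (\<lambda>\<omega>. ?a \<omega> * ?b \<omega>) - acov t h
        = expectation (\<lambda>\<omega>. (?a \<omega> - ?u \<omega>) * ?b \<omega>) + expectation (\<lambda>\<omega>. ?u \<omega> * (?b \<omega> - ?v \<omega>))"
      using L4_le_mult(1)[OF L(1,2)] L4_le_mult(1)[OF L(3,2)] L4_le_mult(1)[OF L(3,4)]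
      by (simp add: acov_eq[OF l t] left_diff_distrib right_diff_distrib)
    moreover have "\<bar>expectation (\<lambda>\<omega>. (?a \<omega> - ?u \<omega>) * ?b \<omega>)\<bar> \<le> C * \<bar>s - t\<bar> * amp"
      by (rule L4_le_expectation_mult[OF D1 L(2)])
    moreover have "\<bar>expectation (\<lambda>\<omega>. ?u \<omega> * (?b \<omega> - ?v \<omega>))\<bar> \<le> amp * (C * \<bar>s' - t\<bar>)"
      by (rule L4_le_expectation_mult[OF L(3) D2])
    ultimately have "\<bar>expectation (\<lambda>\<omega>. ?a \<omega> * ?b \<omega>) - acov t h\<bar> \<le> C * \<bar>s - t\<bar> * amp + amp * (C * \<bar>s' - t\<bar>)"
      by linarith
    then show ?thesis by (simp add: algebra_simps)
  qed
  then show ?thesis using amp(1) C(1) by (intro exI[of _ "amp * C"]) auto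
qed

text \<open>
  Near an interior point of a regime both observations eventually come from the filter of that
  regime, and their local times merge.
\<close>

lemma obs_cov_tendsto:
  fixes k :: "nat \<Rightarrow> int"
  assumes l: "l \<le> r" and t: "t \<in> {d l<..<d (Suc l)}"
    and k: "(\<lambda>n. real_of_int (k n) / real n) \<longlonglongrightarrow> t"
  shows "(\<lambda>n. obs_cov n (k n) (k n + h)) \<longlonglongrightarrow> acov t h"
proof -
  obtain D where D: "0 \<le> D" "\<And>t s s' h. t \<in> {d l<..d (Suc l)} \<Longrightarrow> s \<in> {d l<..d (Suc l)} \<Longrightarrow> s' \<in> {d l<..d (Suc l)} \<Longrightarrow>
     \<bar>expectation (\<lambda>\<omega>. G l s (history \<epsilon> 0 \<omega>) * G l s' (history \<epsilon> h \<omega>)) - acov t h\<bar> \<le> D * (\<bar>s - t\<bar> + \<bar>s' - t\<bar>)"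
    using product_lipschitz l by blast
  let ?s = "\<lambda>n. real_of_int (k n) / real n" and ?s' = "\<lambda>n. real_of_int (k n + h) / real n"
  have "(\<lambda>n. ?s n + real_of_int h * (1 / real n)) \<longlonglongrightarrow> t + real_of_int h * 0"
    by (intro tendsto_add tendsto_mult tendsto_const k lim_1_over_n)
  then have k': "?s' \<longlonglongrightarrow> t" by (simp add: add_divide_distrib)
  have ev: "\<forall>\<^sub>F n in sequentially. x n \<in> {d l<..d (Suc l)}" if "x \<longlonglongrightarrow> t" for x
    using order_tendstoD(1)[OF that, of "d l"] order_tendstoD(2)[OF that, of "d (Suc l)"] t
    by (auto elim: eventually_elim2)
  have "\<forall>\<^sub>F n in sequentially. norm (obs_cov n (k n) (k n + h) - acov t h) \<le> D * (\<bar>?s n - t\<bar> + \<bar>?s' n - t\<bar>)"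
    using ev[OF k] ev[OF k']
  proof eventually_elim
    case (elim n)
    have "obs_cov n (k n) (k n + h) = expectation (\<lambda>\<omega>. G l (?s n) (history \<epsilon> 0 \<omega>) * G l (?s' n) (history \<epsilon> h \<omega>))"
      unfolding obs_cov_def obs_filter_in_regime[OF l elim(1)] obs_filter_in_regime[OF l elim(2)]
      by (intro stationary_product measurable_G l) (use elim in auto)
    then show ?case using D(2)[OF _ elim, of t h] t by simp
  qed
  moreover have "(\<lambda>n. D * (\<bar>?s n - t\<bar> + \<bar>?s' n - t\<bar>)) \<longlonglongrightarrow> D * (\<bar>t - t\<bar> + \<bar>t - t\<bar>)"
    by (intro tendsto_mult tendsto_add tendsto_rabs tendsto_diff tendsto_const k k')
  then have "(\<lambda>n. D * (\<bar>?s n - t\<bar> + \<bar>?s' n - t\<bar>)) \<longlonglongrightarrow> 0" by simp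
  ultimately have "(\<lambda>n. obs_cov n (k n) (k n + h) - acov t h) \<longlonglongrightarrow> 0"
    by (rule Lim_null_comparison)
  then show ?thesis by (rule LIM_zero_cancel)
qed

lemma measurable_acov: "(\<lambda>t. indicator {0<..1} t * acov t h) \<in> borel_measurable borel"
proof -
  obtain D where D: "0 \<le> D" "\<And>l t s s' h. l \<le> r \<Longrightarrow> t \<in> {d l<..d (Suc l)} \<Longrightarrow> s \<in> {d l<..d (Suc l)} \<Longrightarrow> s' \<in> {d l<..d (Suc l)} \<Longrightarrow>
     \<bar>expectation (\<lambda>\<omega>. G l s (history \<epsilon> 0 \<omega>) * G l s' (history \<epsilon> h \<omega>)) - acov t h\<bar> \<le> D * (\<bar>s - t\<bar> + \<bar>s' - t\<bar>)"
    using product_lipschitz by blast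
  have "continuous_on {d l<..d (Suc l)} (\<lambda>t. acov t h)" if l: "l \<le> r" for l
  proof (rule lipschitz_on_continuous_on)
    show "(2 * D)-lipschitz_on {d l<..d (Suc l)} (\<lambda>t. acov t h)"
    proof (rule lipschitz_onI)
      fix s t assume "s \<in> {d l<..d (Suc l)}" "t \<in> {d l<..d (Suc l)}"
      then show "dist (acov s h) (acov t h) \<le> 2 * D * dist s t"
        using D(2)[OF l, of t s s h] by (simp add: acov_eq[OF l, of s] dist_real_def)
    qed (use D in simp)
  qed
  then have "(\<lambda>t. indicator {d l<..d (Suc l)} t *\<^sub>R acov t h) \<in> borel_measurable borel" if "l \<le> r" for l
    using that by (intro borel_measurable_continuous_on_indicator) auto
  then have "(\<lambda>t. \<Sum>l\<le>r. indicator {d l<..d (Suc l)} t *\<^sub>R acov t h) \<in> borel_measurable borel"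
    by (intro borel_measurable_sum) auto
  also have "(\<lambda>t. \<Sum>l\<le>r. indicator {d l<..d (Suc l)} t *\<^sub>R acov t h) = (\<lambda>t. indicator {0<..1} t * acov t h)"
  proof
    fix t
    have ind: "(\<Sum>l\<le>r. indicator {d l<..d (Suc l)} t) = (indicator {0<..1} t :: real)"
    proof (cases "t \<in> {0<..1}")
      case True
      then obtain j where j: "j \<le> r" "t \<in> {d j<..d (Suc j)}" by (rule regime_exists)
      then have "(\<Sum>l\<le>r. indicator {d l<..d (Suc l)} t) = (\<Sum>l\<le>r. if l = j then 1 else 0 :: real)"
      proof (intro sum.cong refl)
        fix l assume "l \<in> {..r}"
        then have "t \<in> {d l<..d (Suc l)} \<longleftrightarrow> l = j" using j regime_unique[of l j t] by blast
        then show "indicator {d l<..d (Suc l)} t = (if l = j then 1 else 0 :: real)" by (simp add: indicator_def)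
      qed
      then show ?thesis using True j by simp
    next
      case False
      have "t \<notin> {d i<..d (Suc i)}" if "i \<le> r" for i
        using False d_ge_0[of i] d_le_1[of "Suc i"] that by auto
      then show ?thesis using False by (auto intro!: sum.neutral)
    qed
    show "(\<Sum>l\<le>r. indicator {d l<..d (Suc l)} t *\<^sub>R acov t h) = indicator {0<..1} t * acov t h"
      by (simp add: sum_distrib_right[symmetric] ind)
  qed
  finally show ?thesis .
qed

end

section \<open>The variance of weighted sums\<close>

text \<open>
  The average is the integral of the step function equal to \<open>g n k\<close> on the cell \<open>((k - 1) / n, k / n]\<close>,
  that is, of \<open>t \<mapsto> g n \<lceil>t n\<rceil>\<close>; the limit is dominated convergence.
\<close>

lemma step_average_tendsto:
  fixes g :: "nat \<Rightarrow> int \<Rightarrow> real" and \<phi> :: "real \<Rightarrow> real"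
  assumes bnd: "\<And>n k. \<bar>g n k\<bar> \<le> B"
    and meas: "(\<lambda>t. indicator {0<..1} t * \<phi> t) \<in> borel_measurable borel"
    and conv: "AE t in lborel. t \<in> {0<..1} \<longrightarrow> (\<lambda>n. g n \<lceil>t * real n\<rceil>) \<longlonglongrightarrow> \<phi> t"
  shows "(\<lambda>n. (\<Sum>k=1..n. g n (int k)) / real n) \<longlonglongrightarrow> (\<integral>t. indicator {0<..1} t * \<phi> t \<partial>lborel)"
proof -
  define s where "s n t = (\<Sum>k=1..n. g n (int k) * indicator {(real k - 1) / real n<..real k / real n} t)" for n t
  have s_eq: "s n t = indicator {0<..1} t * g n \<lceil>t * real n\<rceil>" if n: "1 \<le> n" for n t
  proof -
    have cell: "t \<in> {(real k - 1) / real n<..real k / real n} \<longleftrightarrow> int k = \<lceil>t * real n\<rceil>" for k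
    proof -
      have "t \<in> {(real k - 1) / real n<..real k / real n} \<longleftrightarrow> real k - 1 < t * real n \<and> t * real n \<le> real k"
        using n by (simp add: pos_divide_less_eq pos_le_divide_eq)
      also have "\<dots> \<longleftrightarrow> int k = \<lceil>t * real n\<rceil>" by (simp add: ceiling_eq_iff eq_commute[of "int k"])
      finally show ?thesis .
    qed
    have "s n t = (\<Sum>k=1..n. if int k = \<lceil>t * real n\<rceil> then g n \<lceil>t * real n\<rceil> else 0)"
      unfolding s_def by (intro sum.cong refl) (simp add: indicator_def cell[simplified])
    also have "\<dots> = indicator {0<..1} t * g n \<lceil>t * real n\<rceil>"
    proof (cases "t \<in> {0<..1}")
      case True
      then have "0 < t * real n" "t * real n \<le> real n" using n by auto
      then have "0 < \<lceil>t * real n\<rceil>" "\<lceil>t * real n\<rceil> \<le> int n" by (auto simp: ceiling_le_iff)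
      then obtain k0 where k0: "\<lceil>t * real n\<rceil> = int k0" "k0 \<in> {1..n}"
        by (cases "\<lceil>t * real n\<rceil>") auto
      then show ?thesis using True by simp
    next
      case False
      have "\<not> (int k = \<lceil>t * real n\<rceil>)" if "k \<in> {1..n}" for k
      proof
        assume "int k = \<lceil>t * real n\<rceil>"
        then have "t \<in> {(real k - 1) / real n<..real k / real n}" using cell by blast
        moreover have "0 \<le> (real k - 1) / real n" "real k / real n \<le> 1" using that n by auto
        ultimately show False using False by (auto simp del: divide_nonneg_nonneg)
      qed
      then show ?thesis using False by (intro trans[OF sum.neutral]) auto
    qed
    finally show ?thesis .
  qed
  have B: "0 \<le> B" using bnd[of 0 0] by linarith
  have int_s: "integral\<^sup>L lborel (s n) = (\<Sum>k=1..n. g n (int k)) / real n" if n: "1 \<le> n" for n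
  proof -
    have "integral\<^sup>L lborel (s n) = (\<Sum>k=1..n. g n (int k) * (\<integral>t. indicator {(real k - 1) / real n<..real k / real n} t \<partial>lborel))"
    proof -
      have "integrable lborel (indicator {(real k - 1) / real n<..real k / real n} :: real \<Rightarrow> real)" for k
        by (rule integrable_real_indicator) (simp_all add: divide_right_mono)
      then show ?thesis unfolding s_def[abs_def] by (subst Bochner_Integration.integral_sum) simp_all
    qed
    also have "\<dots> = (\<Sum>k=1..n. g n (int k) * (1 / real n))"
      by (intro sum.cong refl) (simp add: diff_divide_distrib[symmetric] divide_right_mono)
    finally show ?thesis by (simp add: sum_divide_distrib)
  qed
  have "(\<lambda>n. integral\<^sup>L lborel (s (Suc n))) \<longlonglongrightarrow> (\<integral>t. indicator {0<..1} t * \<phi> t \<partial>lborel)"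
  proof (rule integral_dominated_convergence[where w = "\<lambda>t. B * indicator {0<..1} t"])
    show "AE t in lborel. (\<lambda>n. s (Suc n) t) \<longlonglongrightarrow> indicator {0<..1} t * \<phi> t"
      using conv
    proof eventually_elim
      case (elim t)
      show ?case
      proof (cases "t \<in> {0<..1}")
        case True
        with elim have "(\<lambda>n. g n \<lceil>t * real n\<rceil>) \<longlonglongrightarrow> \<phi> t" by simp
        from LIMSEQ_Suc[OF this] show ?thesis using True by (simp add: s_eq)
      next
        case False
        then show ?thesis by (simp add: s_eq)
      qed
    qed
    show "AE t in lborel. norm (s (Suc n) t) \<le> B * indicator {0<..1} t" for n
      using bnd by (intro AE_I2) (auto simp: s_eq indicator_def)
    show "s (Suc n) \<in> borel_measurable lborel" for n unfolding s_def[abs_def] by measurable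
    show "(\<lambda>t. indicator {0<..1} t * \<phi> t) \<in> borel_measurable lborel" using meas by simp
  qed auto
  then have "(\<lambda>n. (\<Sum>k=1..Suc n. g (Suc n) (int k)) / real (Suc n)) \<longlonglongrightarrow> (\<integral>t. indicator {0<..1} t * \<phi> t \<partial>lborel)"
    by (simp only: int_s Suc_le_mono One_nat_def le0)
  then show ?thesis by (rule LIMSEQ_imp_Suc)
qed

lemma summation_by_parts_bound:
  fixes a o' :: "nat \<Rightarrow> real"
  assumes "\<And>m. \<bar>\<Sum>k=1..m. o' k\<bar> \<le> Q"
  shows "\<bar>\<Sum>k=1..n. a k * o' k\<bar> \<le> Q * (\<bar>a (Suc n)\<bar> + (\<Sum>k=1..n. \<bar>a (Suc k) - a k\<bar>))"
proof -
  have eq: "(\<Sum>k=1..n. a k * o' k) = a (Suc n) * (\<Sum>k=1..n. o' k) - (\<Sum>k=1..n. (a (Suc k) - a k) * (\<Sum>i=1..k. o' i))"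
    by (induction n) (simp_all add: algebra_simps)
  have "\<bar>\<Sum>k=1..n. a k * o' k\<bar> \<le> \<bar>a (Suc n) * (\<Sum>k=1..n. o' k)\<bar> + \<bar>\<Sum>k=1..n. (a (Suc k) - a k) * (\<Sum>i=1..k. o' i)\<bar>"
    unfolding eq by (rule abs_triangle_ineq4)
  also have "\<dots> \<le> \<bar>a (Suc n)\<bar> * Q + (\<Sum>k=1..n. \<bar>a (Suc k) - a k\<bar> * Q)"
    by (intro add_mono order_trans[OF sum_abs] sum_mono; unfold abs_mult; intro mult_left_mono assms abs_ge_zero)
  finally show ?thesis by (simp add: sum_distrib_left distrib_left mult.commute)
qed

lemma abs_summable_geometric_int:
  fixes \<rho> :: real assumes "0 \<le> \<rho>" "\<rho> < 1"
  shows "Infinite_Set_Sum.abs_summable_on (\<lambda>h :: int. \<rho> ^ nat \<bar>h\<bar>) UNIV"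
proof -
  have half: "Infinite_Set_Sum.abs_summable_on (\<lambda>h :: int. \<rho> ^ nat \<bar>h\<bar>) (range (\<lambda>n. s * int n))" if s: "s = 1 \<or> s = -1" for s
  proof -
    have "bij_betw (\<lambda>n. s * int n) UNIV (range (\<lambda>n. s * int n))"
      using s by (auto simp: bij_betw_def inj_def)
    from abs_summable_on_reindex_bij_betw[OF this, of "\<lambda>h. \<rho> ^ nat \<bar>h\<bar>"]
    show ?thesis using s assms by (auto simp: abs_summable_on_nat_iff' abs_mult)
  qed
  have "(UNIV :: int set) = range (\<lambda>n. 1 * int n) \<union> range (\<lambda>n. -1 * int n)"
    by (auto simp: image_iff) (metis int_cases2)
  then show ?thesis using abs_summable_on_union[OF half[of 1] half[of "-1"]] by (metis)
qed

text \<open>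
  Sorting a double sum by the lag \<open>h = k - j\<close>. The sum over the lags is written as an integral over the
  counting measure, so that dominated convergence and Fubini's theorem apply to it.
\<close>

lemma sum_square_eq_lagged:
  fixes u :: "int \<Rightarrow> int \<Rightarrow> real"
  assumes "\<And>j k. k \<notin> {1..int n} \<Longrightarrow> u j k = 0"
  shows "(\<Sum>j=1..n. \<Sum>k=1..n. u (int j) (int k)) = (\<integral>h. (\<Sum>j=1..n. u (int j) (int j + h)) \<partial>count_space UNIV)"
    and "integrable (count_space UNIV) (\<lambda>h. \<Sum>j=1..n. u (int j) (int j + h))"
proof -
  let ?H = "{- int n..int n}"
  have zero: "(\<Sum>j=1..n. u (int j) (int j + h)) = 0" if "h \<notin> ?H" for h
    using that by (intro sum.neutral ballI assms) auto
  have zero': "h \<in> ?H" if "(\<Sum>j=1..n. u (int j) (int j + h)) \<noteq> 0" for h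
    using zero[of h] that by blast
  have supp: "finite {h. (\<Sum>j=1..n. u (int j) (int j + h)) \<noteq> 0}"
    by (rule finite_subset[of _ ?H]) (use zero' in blast, simp)
  have row: "(\<Sum>k=1..n. u (int j) (int k)) = (\<Sum>h\<in>?H. u (int j) (int j + h))" if "j \<in> {1..n}" for j
  proof -
    have "(\<Sum>k=1..n. u (int j) (int k)) = (\<Sum>h\<in>{1 - int j..int n - int j}. u (int j) (int j + h))"
      by (rule sum.reindex_bij_witness[of _ "\<lambda>h. nat (int j + h)" "\<lambda>k. int k - int j"]) auto
    also have "\<dots> = (\<Sum>h\<in>?H. u (int j) (int j + h))"
      using that by (intro sum.mono_neutral_left) (auto intro!: assms)
    finally show ?thesis .
  qed
  have "(\<Sum>j=1..n. \<Sum>k=1..n. u (int j) (int k)) = (\<Sum>j=1..n. \<Sum>h\<in>?H. u (int j) (int j + h))"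
    by (intro sum.cong refl row)
  also have "\<dots> = (\<Sum>h\<in>?H. \<Sum>j=1..n. u (int j) (int j + h))" by (rule sum.swap)
  also have "\<dots> = (\<Sum>h | h \<in> UNIV \<and> (\<Sum>j=1..n. u (int j) (int j + h)) \<noteq> 0. \<Sum>j=1..n. u (int j) (int j + h))"
    by (intro sum.mono_neutral_right) (simp, use zero' in blast, use zero in blast)
  also have "\<dots> = (\<integral>h. (\<Sum>j=1..n. u (int j) (int j + h)) \<partial>count_space UNIV)"
    by (rule lebesgue_integral_count_space_finite_support[symmetric]) (use supp in simp)
  finally show "(\<Sum>j=1..n. \<Sum>k=1..n. u (int j) (int k)) = (\<integral>h. (\<Sum>j=1..n. u (int j) (int j + h)) \<partial>count_space UNIV)" .
  have "Infinite_Set_Sum.abs_summable_on (\<lambda>h. \<Sum>j=1..n. u (int j) (int j + h)) UNIV"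
    using abs_summable_on_cong_neutral[of ?H UNIV "\<lambda>h. \<Sum>j=1..n. u (int j) (int j + h)" "\<lambda>h. \<Sum>j=1..n. u (int j) (int j + h)"]
      abs_summable_on_finite[of ?H "\<lambda>h. \<Sum>j=1..n. u (int j) (int j + h)"] zero by blast
  then show "integrable (count_space UNIV) (\<lambda>h. \<Sum>j=1..n. u (int j) (int j + h))"
    by (simp add: abs_summable_on_def)
qed

context pls
begin

definition mean_acov :: "int \<Rightarrow> real" where
  "mean_acov h = (\<integral>t. indicator {0<..1} t * acov t h \<partial>lborel)"

lemma acov_integrable: "integrable lborel (\<lambda>t. indicator {0<..1} t * acov t h)"
  and mean_acov_abs: "(\<integral>t. \<bar>indicator {0<..1} t * acov t h\<bar> \<partial>lborel) \<le> amp * amp * \<rho> ^ nat \<bar>h\<bar>"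
proof -
  let ?C = "amp * amp * \<rho> ^ nat \<bar>h\<bar>"
  have pw: "\<bar>indicator {0<..1} t * acov t h\<bar> \<le> indicator {0<..1} t * ?C" for t
    using acov_bound[of t h] by (auto simp: indicator_def)
  have I: "integrable lborel (\<lambda>t. indicator {0<..1::real} t * ?C)" by simp
  show J: "integrable lborel (\<lambda>t. indicator {0<..1} t * acov t h)"
    by (rule Bochner_Integration.integrable_bound[OF I])
      (use measurable_acov pw in \<open>auto intro!: AE_I2 order_trans[OF _ abs_ge_self]\<close>)
  have "(\<integral>t. \<bar>indicator {0<..1} t * acov t h\<bar> \<partial>lborel) \<le> (\<integral>t. indicator {0<..1::real} t * ?C \<partial>lborel)"
    by (intro integral_mono integrable_abs J I pw)
  then show "(\<integral>t. \<bar>indicator {0<..1} t * acov t h\<bar> \<partial>lborel) \<le> ?C" by simp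
qed

lemma mean_acov_bound: "\<bar>mean_acov h\<bar> \<le> amp * amp * \<rho> ^ nat \<bar>h\<bar>"
  unfolding mean_acov_def by (rule order_trans[OF integral_abs_bound mean_acov_abs])

lemma geometric_count_integrable:
  "integrable (count_space UNIV) (\<lambda>h :: int. C * \<rho> ^ nat \<bar>h\<bar>)"
  using abs_summable_geometric_int[OF rho] by (simp add: abs_summable_on_def)

lemma count_integrable_bound:
  assumes "\<And>h :: int. \<bar>f h\<bar> \<le> C * \<rho> ^ nat \<bar>h\<bar>"
  shows "integrable (count_space UNIV) (f :: int \<Rightarrow> real)"
  by (rule Bochner_Integration.integrable_bound[OF geometric_count_integrable[of C]])
    (use assms in \<open>auto intro!: AE_I2 order_trans[OF _ abs_ge_self]\<close>)

lemma AE_obs_cov_tendsto: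
  "AE t in lborel. t \<in> {0<..1} \<longrightarrow>
     (\<lambda>n. obs_cov n (\<lceil>t * real n\<rceil> + i) (\<lceil>t * real n\<rceil> + i + h)) \<longlonglongrightarrow> acov t h"
proof -
  have "AE t in lborel. t \<notin> d ` {..Suc r}"
    by (intro AE_not_in finite_imp_null_set_lborel) auto
  then show ?thesis
  proof (eventually_elim, intro impI)
    fix t assume t: "t \<notin> d ` {..Suc r}" "t \<in> {0<..1}"
    from t(2) obtain l where l: "l \<le> r" "t \<in> {d l<..d (Suc l)}" by (rule regime_exists)
    have tl: "t \<in> {d l<..<d (Suc l)}" using l t(1) by (auto simp: order_le_less)
    have lim: "(\<lambda>n. real_of_int (\<lceil>t * real n\<rceil> + i) / real n) \<longlonglongrightarrow> t"
    proof -
      have "(\<lambda>n. real_of_int \<lceil>t * real n\<rceil> / real n - t) \<longlonglongrightarrow> 0"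
      proof (rule Lim_null_comparison[OF _ lim_1_over_n])
        show "\<forall>\<^sub>F n in sequentially. norm (real_of_int \<lceil>t * real n\<rceil> / real n - t) \<le> 1 / of_nat n"
          using eventually_gt_at_top[of 0]
        proof eventually_elim
          case (elim n)
          have "real_of_int \<lceil>t * real n\<rceil> / real n - t = (real_of_int \<lceil>t * real n\<rceil> - t * real n) / real n"
            using elim by (simp add: diff_divide_distrib)
          moreover have "0 \<le> real_of_int \<lceil>t * real n\<rceil> - t * real n" "real_of_int \<lceil>t * real n\<rceil> - t * real n \<le> 1"
            by linarith+
          ultimately show ?case using elim by (simp add: divide_right_mono)
        qed
      qed
      from tendsto_add[OF tendsto_add[OF this tendsto_const[of t]] tendsto_mult[OF tendsto_const[of "real_of_int i"] lim_1_over_n]]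
      show ?thesis by (simp add: add_divide_distrib)
    qed
    show "(\<lambda>n. obs_cov n (\<lceil>t * real n\<rceil> + i) (\<lceil>t * real n\<rceil> + i + h)) \<longlonglongrightarrow> acov t h"
      by (rule obs_cov_tendsto[OF l(1) tl lim])
  qed
qed

lemma obs_cov_bounded: "\<bar>obs_cov n j k\<bar> \<le> amp * amp"
proof -
  have "amp * amp * \<rho> ^ nat \<bar>j - k\<bar> \<le> amp * amp * 1"
    using amp(1) rho by (intro mult_left_mono power_le_one) auto
  with obs_cov_bound[of n j k] show ?thesis by simp
qed

text \<open>
  The lag-\<open>h\<close> part of the variance. The oscillating part of the weights has bounded partial sums,
  so summation by parts reduces it to the increments of the covariances along the sample, which
  average out because the covariances are almost constant within a regime.
\<close>

lemma lagged_average_tendsto: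
  fixes c :: "nat \<Rightarrow> int \<Rightarrow> real" and \<theta> :: "nat \<Rightarrow> real"
  assumes Q: "\<And>n m. 1 \<le> n \<Longrightarrow> \<bar>\<Sum>k=1..m. c n (int k) * c n (int k + h) - \<theta> n\<bar> \<le> Q"
    and \<theta>: "\<And>n. \<bar>\<theta> n\<bar> \<le> T"
  shows "(\<lambda>n. (\<Sum>k=1..n. c n (int k) * c n (int k + h) * obs_cov n (int k) (int k + h)) / real n - \<theta> n * mean_acov h) \<longlonglongrightarrow> 0"
proof -
  define a where "a n k = obs_cov n k (k + h)" for n k
  have avg: "(\<lambda>n. (\<Sum>k=1..n. a n (int k)) / real n) \<longlonglongrightarrow> mean_acov h"
    unfolding mean_acov_def
    by (rule step_average_tendsto[where B = "amp * amp"])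
      (use AE_obs_cov_tendsto[of 0 h] in \<open>simp_all add: a_def obs_cov_bounded measurable_acov\<close>)
  have inc: "(\<lambda>n. (\<Sum>k=1..n. \<bar>a n (int k + 1) - a n (int k)\<bar>) / real n) \<longlonglongrightarrow> 0"
  proof -
    have "(\<lambda>n. (\<Sum>k=1..n. \<bar>a n (int k + 1) - a n (int k)\<bar>) / real n) \<longlonglongrightarrow> (\<integral>t. indicator {0<..1::real} t * 0 \<partial>lborel)"
    proof (rule step_average_tendsto[where g = "\<lambda>n k. \<bar>a n (k + 1) - a n k\<bar>" and B = "2 * (amp * amp)"])
      show "\<bar>\<bar>a n (k + 1) - a n k\<bar>\<bar> \<le> 2 * (amp * amp)" for n k
        using obs_cov_bounded[of n "k + 1" "k + 1 + h"] obs_cov_bounded[of n k "k + h"] unfolding a_def by linarith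
      show "AE t in lborel. t \<in> {0<..1} \<longrightarrow> (\<lambda>n. \<bar>a n (\<lceil>t * real n\<rceil> + 1) - a n \<lceil>t * real n\<rceil>\<bar>) \<longlonglongrightarrow> 0"
        using AE_obs_cov_tendsto[of 0 h] AE_obs_cov_tendsto[of 1 h]
      proof eventually_elim
        case (elim t)
        show ?case
        proof
          assume t: "t \<in> {0<..1}"
          have "(\<lambda>n. \<bar>a n (\<lceil>t * real n\<rceil> + 1) - a n (\<lceil>t * real n\<rceil> + 0)\<bar>) \<longlonglongrightarrow> \<bar>acov t h - acov t h\<bar>"
            unfolding a_def using elim t by (intro tendsto_rabs tendsto_diff) blast+
          then show "(\<lambda>n. \<bar>a n (\<lceil>t * real n\<rceil> + 1) - a n \<lceil>t * real n\<rceil>\<bar>) \<longlonglongrightarrow> 0" by simp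
        qed
      qed
    qed simp
    then show ?thesis by simp
  qed
  define o' where "o' n k = c n (int k) * c n (int k + h) - \<theta> n" for n k
  have Q0: "0 \<le> Q" using Q[of 1 0] by linarith
  have osc: "(\<lambda>n. (\<Sum>k=1..n. a n (int k) * o' n k) / real n) \<longlonglongrightarrow> 0"
  proof (rule Lim_null_comparison)
    show "\<forall>\<^sub>F n in sequentially. norm ((\<Sum>k=1..n. a n (int k) * o' n k) / real n)
       \<le> Q * (amp * amp * (1 / real n) + (\<Sum>k=1..n. \<bar>a n (int k + 1) - a n (int k)\<bar>) / real n)"
      using eventually_ge_at_top[of 1]
    proof eventually_elim
      case (elim n)
      have "\<bar>\<Sum>k=1..n. a n (int k) * o' n k\<bar> \<le> Q * (\<bar>a n (int (Suc n))\<bar> + (\<Sum>k=1..n. \<bar>a n (int (Suc k)) - a n (int k)\<bar>))"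
        by (rule summation_by_parts_bound) (use Q[OF elim] in \<open>simp add: o'_def\<close>)
      also have "\<dots> \<le> Q * (amp * amp + (\<Sum>k=1..n. \<bar>a n (int k + 1) - a n (int k)\<bar>))"
      proof (intro mult_left_mono add_mono Q0)
        show "\<bar>a n (int (Suc n))\<bar> \<le> amp * amp" unfolding a_def by (rule obs_cov_bounded)
      qed (simp add: add.commute)
      finally have "\<bar>\<Sum>k=1..n. a n (int k) * o' n k\<bar> / real n \<le> Q * (amp * amp + (\<Sum>k=1..n. \<bar>a n (int k + 1) - a n (int k)\<bar>)) / real n"
        by (intro divide_right_mono) auto
      then show ?case by (simp add: add_divide_distrib distrib_left)
    qed
    have "(\<lambda>n. Q * (amp * amp * (1 / real n) + (\<Sum>k=1..n. \<bar>a n (int k + 1) - a n (int k)\<bar>) / real n)) \<longlonglongrightarrow> Q * (amp * amp * 0 + 0)"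
      by (intro tendsto_intros inc lim_1_over_n)
    then show "(\<lambda>n. Q * (amp * amp * (1 / real n) + (\<Sum>k=1..n. \<bar>a n (int k + 1) - a n (int k)\<bar>) / real n)) \<longlonglongrightarrow> 0" by simp
  qed
  have main: "(\<lambda>n. \<theta> n * ((\<Sum>k=1..n. a n (int k)) / real n - mean_acov h)) \<longlonglongrightarrow> 0"
  proof (rule Lim_null_comparison)
    show "\<forall>\<^sub>F n in sequentially. norm (\<theta> n * ((\<Sum>k=1..n. a n (int k)) / real n - mean_acov h)) \<le> T * \<bar>(\<Sum>k=1..n. a n (int k)) / real n - mean_acov h\<bar>"
      using \<theta> by (intro always_eventually allI) (auto simp: abs_mult intro!: mult_right_mono)
    have "(\<lambda>n. T * \<bar>(\<Sum>k=1..n. a n (int k)) / real n - mean_acov h\<bar>) \<longlonglongrightarrow> T * \<bar>mean_acov h - mean_acov h\<bar>"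
      by (intro tendsto_intros avg)
    then show "(\<lambda>n. T * \<bar>(\<Sum>k=1..n. a n (int k)) / real n - mean_acov h\<bar>) \<longlonglongrightarrow> 0" by simp
  qed
  have "(\<Sum>k=1..n. c n (int k) * c n (int k + h) * obs_cov n (int k) (int k + h)) / real n - \<theta> n * mean_acov h
     = (\<Sum>k=1..n. a n (int k) * o' n k) / real n + \<theta> n * ((\<Sum>k=1..n. a n (int k)) / real n - mean_acov h)" for n
  proof -
    have "(\<Sum>k=1..n. c n (int k) * c n (int k + h) * obs_cov n (int k) (int k + h))
       = (\<Sum>k=1..n. a n (int k) * o' n k) + \<theta> n * (\<Sum>k=1..n. a n (int k))"
      by (simp add: a_def o'_def sum_distrib_left sum.distrib[symmetric] algebra_simps)
    then show ?thesis by (simp add: add_divide_distrib right_diff_distrib)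
  qed
  then show ?thesis using tendsto_add[OF osc main] by simp
qed

text \<open>The geometric decay of the covariances dominates the sum over the lags.\<close>

lemma variance_tendsto:
  fixes c :: "nat \<Rightarrow> int \<Rightarrow> real" and freq :: "nat \<Rightarrow> real"
  assumes W: "\<And>n k. \<bar>c n k\<bar> \<le> W"
    and osc: "\<And>h. \<exists>Q. \<forall>n\<ge>1. \<forall>m. \<bar>\<Sum>k=1..m. c n (int k) * c n (int k + h) - \<kappa> * cos (of_int h * freq n)\<bar> \<le> Q"
  shows "(\<lambda>n. expectation (\<lambda>\<omega>. (\<Sum>k=1..n. c n (int k) * obs_filter n (int k) (history \<epsilon> (int k) \<omega>))\<^sup>2) / real n
            - \<kappa> * (\<integral>h. mean_acov h * cos (of_int h * freq n) \<partial>count_space UNIV)) \<longlonglongrightarrow> 0"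
proof -
  define u where "u n j k = c n j * c n k * obs_cov n j k" for n j k
  define L where "L n h = (\<Sum>j=1..n. u n (int j) (int j + h)) / real n" for n h
  define R where "R n h = (\<kappa> * cos (of_int h * freq n)) * mean_acov h" for n and h :: int
  let ?C = "amp * amp"
  have W0: "0 \<le> W" using W[of 0 0] by linarith
  have uzero: "u n j k = 0" if "k \<notin> {1..int n}" for n j k using obs_cov_outside[OF that] by (simp add: u_def)
  have L_int: "integrable (count_space UNIV) (L n)" for n
    unfolding L_def[abs_def] using sum_square_eq_lagged(2)[of n "u n"] uzero by simp
  have sq: "expectation (\<lambda>\<omega>. (\<Sum>k=1..n. c n (int k) * obs_filter n (int k) (history \<epsilon> (int k) \<omega>))\<^sup>2) / real n
     = (\<integral>h. L n h \<partial>count_space UNIV)" for n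
  proof -
    let ?Y = "\<lambda>k \<omega>. obs_filter n (int k) (history \<epsilon> (int k) \<omega>)"
    have I: "integrable M (\<lambda>\<omega>. ?Y j \<omega> * ?Y k \<omega>)" for j k
      by (rule L4_le_mult(1)[OF geometric_filterD(2)[OF geometric_obs_filter] geometric_filterD(2)[OF geometric_obs_filter]])
    have "expectation (\<lambda>\<omega>. (\<Sum>k=1..n. c n (int k) * ?Y k \<omega>)\<^sup>2)
        = expectation (\<lambda>\<omega>. \<Sum>j=1..n. \<Sum>k=1..n. (c n (int j) * c n (int k)) * (?Y j \<omega> * ?Y k \<omega>))"
      by (simp add: power2_eq_square sum_product ac_simps)
    also have "\<dots> = (\<Sum>j=1..n. \<Sum>k=1..n. u n (int j) (int k))"
      by (subst Bochner_Integration.integral_sum, intro Bochner_Integration.integrable_sum integrable_mult_right I,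
          intro sum.cong refl, subst Bochner_Integration.integral_sum, intro integrable_mult_right I)
        (simp add: u_def obs_cov_def)
    also have "\<dots> = (\<integral>h. (\<Sum>j=1..n. u n (int j) (int j + h)) \<partial>count_space UNIV)"
      by (rule sum_square_eq_lagged(1)) (rule uzero)
    finally show ?thesis by (simp add: L_def)
  qed
  have L_bound: "\<bar>L n h\<bar> \<le> W * W * ?C * \<rho> ^ nat \<bar>h\<bar>" for n h
  proof -
    have "\<bar>\<Sum>j=1..n. u n (int j) (int j + h)\<bar> \<le> (\<Sum>j=1..n. \<bar>u n (int j) (int j + h)\<bar>)" by (rule sum_abs)
    also have "\<dots> \<le> (\<Sum>j=1..n. W * W * (?C * \<rho> ^ nat \<bar>h\<bar>))"
    proof (rule sum_mono)
      fix j
      show "\<bar>u n (int j) (int j + h)\<bar> \<le> W * W * (?C * \<rho> ^ nat \<bar>h\<bar>)"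
        unfolding u_def abs_mult using W W0 obs_cov_bound[of n "int j" "int j + h"]
        by (intro mult_mono) auto
    qed
    finally have "\<bar>\<Sum>j=1..n. u n (int j) (int j + h)\<bar> \<le> real n * (W * W * (?C * \<rho> ^ nat \<bar>h\<bar>))" by simp
    then have "\<bar>\<Sum>j=1..n. u n (int j) (int j + h)\<bar> / real n \<le> real n * (W * W * (?C * \<rho> ^ nat \<bar>h\<bar>)) / real n"
      by (intro divide_right_mono) auto
    also have "\<dots> \<le> W * W * (?C * \<rho> ^ nat \<bar>h\<bar>)" using W0 amp(1) rho by (cases "n = 0") auto
    finally show ?thesis by (simp add: L_def)
  qed
  have R_bound: "\<bar>R n h\<bar> \<le> \<bar>\<kappa>\<bar> * ?C * \<rho> ^ nat \<bar>h\<bar>" for n h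
  proof -
    have "\<bar>\<kappa> * cos (of_int h * freq n)\<bar> \<le> \<bar>\<kappa>\<bar> * 1" unfolding abs_mult by (intro mult_left_mono) auto
    then show ?thesis unfolding R_def abs_mult[of _ "mean_acov h"] using mean_acov_bound[of h]
      by (simp only: mult.assoc mult_1_right) (intro mult_mono, auto simp: mult.assoc)
  qed
  have R_int: "integrable (count_space UNIV) (R n)" for n by (rule count_integrable_bound[OF R_bound])
  have "(\<lambda>n. \<integral>h. L n h - R n h \<partial>count_space UNIV) \<longlonglongrightarrow> (\<integral>h. 0 \<partial>count_space (UNIV :: int set))"
  proof (rule integral_dominated_convergence[where w = "\<lambda>h. (W * W * ?C + \<bar>\<kappa>\<bar> * ?C) * \<rho> ^ nat \<bar>h\<bar>"])
    show "AE h in count_space UNIV. norm (L n h - R n h) \<le> (W * W * ?C + \<bar>\<kappa>\<bar> * ?C) * \<rho> ^ nat \<bar>h\<bar>" for n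
    proof (rule AE_I2)
      fix h :: int
      show "norm (L n h - R n h) \<le> (W * W * ?C + \<bar>\<kappa>\<bar> * ?C) * \<rho> ^ nat \<bar>h\<bar>"
        using L_bound[of n h] R_bound[of n h] abs_triangle_ineq4[of "L n h" "R n h"]
        unfolding distrib_right real_norm_def by linarith
    qed
    show "AE h in count_space UNIV. (\<lambda>n. L n h - R n h) \<longlonglongrightarrow> 0"
    proof (rule AE_I2)
      fix h :: int
      obtain Q where Q: "\<And>n m. 1 \<le> n \<Longrightarrow> \<bar>\<Sum>k=1..m. c n (int k) * c n (int k + h) - \<kappa> * cos (of_int h * freq n)\<bar> \<le> Q"
        using osc[of h] by blast
      have "\<bar>\<kappa> * cos (of_int h * freq n)\<bar> \<le> \<bar>\<kappa>\<bar>" for n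
        using mult_left_mono[OF abs_cos_le_one[of "of_int h * freq n"], of "\<bar>\<kappa>\<bar>"] by (simp add: abs_mult)
      from lagged_average_tendsto[OF Q this]
      show "(\<lambda>n. L n h - R n h) \<longlonglongrightarrow> 0" by (simp add: L_def R_def u_def)
    qed
  qed (use geometric_count_integrable in auto)
  moreover have "(\<integral>h. L n h - R n h \<partial>count_space UNIV) = (\<integral>h. L n h \<partial>count_space UNIV) - \<kappa> * (\<integral>h. mean_acov h * cos (of_int h * freq n) \<partial>count_space UNIV)" for n
  proof -
    have "(\<integral>h. R n h \<partial>count_space UNIV) = \<kappa> * (\<integral>h. mean_acov h * cos (of_int h * freq n) \<partial>count_space UNIV)"
      unfolding R_def by (simp add: mult.assoc mult.commute[of "cos _"])
    then show ?thesis using L_int R_int by (simp add: Bochner_Integration.integral_diff)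
  qed
  ultimately have "(\<lambda>n. (\<integral>h. L n h \<partial>count_space UNIV) - \<kappa> * (\<integral>h. mean_acov h * cos (of_int h * freq n) \<partial>count_space UNIV)) \<longlonglongrightarrow> 0"
    by simp
  then show ?thesis unfolding sq .
qed

text \<open>
  Fubini's theorem for the sum over the lags and the integral over time. The time \<open>0\<close>, which belongs
  to no regime interval, is a null set.
\<close>

lemma integral_local_spec:
  "integral {0..1} (\<lambda>t. local_spec M r d G \<epsilon> t l) = 1 / (2 * pi) * (\<integral>h. mean_acov h * cos (of_int h * l) \<partial>count_space UNIV)"
  "(\<lambda>t. local_spec M r d G \<epsilon> t l) integrable_on {0..1}"
proof -
  let ?f = "\<lambda>t. local_spec M r d G \<epsilon> t l"
  define u where "u h t = indicator {0<..1} t * acov t h * cos (of_int h * l)" for h :: int and t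
  interpret P: pair_sigma_finite "count_space (UNIV :: int set)" "lborel :: real measure"
    by (intro pair_sigma_finite.intro sigma_finite_measure_count_space sigma_finite_lborel)
  have u_int: "integrable lborel (u h)" for h
    unfolding u_def[abs_def] by (intro integrable_mult_left acov_integrable)
  have u_abs: "(\<integral>t. norm (u h t) \<partial>lborel) \<le> amp * amp * \<rho> ^ nat \<bar>h\<bar>" for h
  proof -
    have "(\<integral>t. norm (u h t) \<partial>lborel) \<le> (\<integral>t. \<bar>indicator {0<..1} t * acov t h\<bar> \<partial>lborel)"
    proof (intro integral_mono integrable_norm u_int integrable_abs acov_integrable)
      fix t
      have "norm (u h t) = \<bar>indicator {0<..1} t * acov t h\<bar> * \<bar>cos (of_int h * l)\<bar>" by (simp add: u_def abs_mult)
      also have "\<dots> \<le> \<bar>indicator {0<..1} t * acov t h\<bar> * 1" by (intro mult_left_mono) auto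
      finally show "norm (u h t) \<le> \<bar>indicator {0<..1} t * acov t h\<bar>" by simp
    qed
    with mean_acov_abs[of h] show ?thesis by linarith
  qed
  have joint: "integrable (count_space UNIV \<Otimes>\<^sub>M lborel) (case_prod u)"
  proof (rule P.Fubini_integrable)
    show "case_prod u \<in> borel_measurable (count_space UNIV \<Otimes>\<^sub>M lborel)"
      using u_int by (intro measurable_pair_measure_countable1) auto
    show "integrable (count_space UNIV) (\<lambda>h. \<integral>t. norm (case_prod u (h, t)) \<partial>lborel)"
      using u_abs by (intro count_integrable_bound[of _ "amp * amp"]) (simp add: abs_of_nonneg[OF Bochner_Integration.integral_nonneg])
    show "AE h in count_space UNIV. integrable lborel (\<lambda>t. case_prod u (h, t))" using u_int by simp
  qed
  have spec: "indicator {0<..1} t * ?f t = 1 / (2 * pi) * (\<integral>h. u h t \<partial>count_space UNIV)" for t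
  proof (cases "t \<in> {0<..1}")
    case True
    have "Infinite_Set_Sum.abs_summable_on (\<lambda>h. acov t h * cos (of_int h * l)) UNIV"
      unfolding abs_summable_on_def
    proof (rule count_integrable_bound[of _ "amp * amp"])
      fix h
      have "\<bar>acov t h * cos (of_int h * l)\<bar> \<le> \<bar>acov t h\<bar> * 1" unfolding abs_mult by (intro mult_left_mono) auto
      with acov_bound[OF True, of h] show "\<bar>acov t h * cos (of_int h * l)\<bar> \<le> amp * amp * \<rho> ^ nat \<bar>h\<bar>" by linarith
    qed
    from infsetsum_infsum[OF this]
    show ?thesis using True by (simp add: local_spec_def infsetsum_def u_def)
  next
    case False
    then show ?thesis by (simp add: u_def)
  qed
  have "integrable lborel (\<lambda>t. \<integral>h. u h t \<partial>count_space UNIV)" by (rule P.integrable_snd[OF joint])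
  then have "integrable lborel (\<lambda>t. indicator {0<..1} t * ?f t)" unfolding spec by (rule integrable_mult_right)
  then have si: "set_integrable lborel {0<..1} ?f" by (simp add: set_integrable_def)
  have neg: "negligible ({0..1} - {0<..1::real})" by (rule negligible_subset[of "{0}"]) auto
  have "?f integrable_on {0<..1}" by (rule set_borel_integral_eq_integral(1)[OF si])
  then show "?f integrable_on {0..1}"
    by (rule integrable_spike_set) (rule negligible_subset[OF neg], auto)+
  have "integral {0..1} ?f = integral {0<..1} ?f"
    by (rule integral_subset_negligible[symmetric]) (use neg in auto)
  also have "\<dots> = (\<integral>t. indicator {0<..1} t * ?f t \<partial>lborel)"
    using set_borel_integral_eq_integral(2)[OF si] by (simp add: set_lebesgue_integral_def)
  also have "\<dots> = 1 / (2 * pi) * (\<integral>t. (\<integral>h. u h t \<partial>count_space UNIV) \<partial>lborel)" unfolding spec by simp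
  also have "(\<integral>t. (\<integral>h. u h t \<partial>count_space UNIV) \<partial>lborel) = (\<integral>h. (\<integral>t. u h t \<partial>lborel) \<partial>count_space UNIV)"
    by (rule P.Fubini_integral[OF joint])
  also have "\<dots> = (\<integral>h. mean_acov h * cos (of_int h * l) \<partial>count_space UNIV)"
    by (simp add: u_def mean_acov_def)
  finally show "integral {0..1} ?f = 1 / (2 * pi) * (\<integral>h. mean_acov h * cos (of_int h * l) \<partial>count_space UNIV)" .
qed

end

section \<open>From characteristic functions to the limit laws\<close>

text \<open>The continuous mapping theorem for a map that is continuous off a null set of the limit.\<close>

lemma weak_conv_m_continuous_map:
  fixes \<mu> :: "nat \<Rightarrow> real measure" and g :: "real \<Rightarrow> real"
  assumes \<mu>: "\<And>n. real_distribution (\<mu> n)" "real_distribution \<nu>" "weak_conv_m \<mu> \<nu>"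
    and g[measurable]: "g \<in> borel_measurable borel"
    and A: "A \<in> sets borel" "emeasure \<nu> A = 0" "\<And>x. x \<notin> A \<Longrightarrow> isCont g x"
  shows "weak_conv_m (\<lambda>n. distr (\<mu> n) borel g) (distr \<nu> borel g)"
proof -
  interpret \<nu>: real_distribution \<nu> by fact
  interpret \<mu>: real_distribution "\<mu> n" for n by fact
  have gm: "g \<in> borel_measurable \<nu>" "g \<in> borel_measurable (\<mu> n)" for n by simp_all
  show ?thesis
  proof (rule integral_bdd_continuous_conv_imp_weak_conv)
    show "real_distribution (distr (\<mu> n) borel g)" for n using gm by (intro \<mu>.real_distribution_distr)
    show "real_distribution (distr \<nu> borel g)" using gm by (intro \<nu>.real_distribution_distr)
    fix f :: "real \<Rightarrow> real" assume f: "\<And>x. isCont f x" "\<And>x. \<bar>f x\<bar> \<le> 1"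
    have fm[measurable]: "f \<in> borel_measurable borel"
      using f(1) by (intro borel_measurable_continuous_onI continuous_at_imp_continuous_on) auto
    have "emeasure \<nu> {x. \<not> isCont (\<lambda>x. f (g x)) x} \<le> emeasure \<nu> A"
      by (rule emeasure_mono) (use A(1,3) f(1) in \<open>auto intro: isCont_o2\<close>)
    then have null: "emeasure \<nu> {x. \<not> isCont (\<lambda>x. f (g x)) x} = 0" using A(2) by simp
    have "(\<lambda>n. integral\<^sup>L (\<mu> n) (\<lambda>x. f (g x))) \<longlonglongrightarrow> integral\<^sup>L \<nu> (\<lambda>x. f (g x))"
      by (rule weak_conv_imp_bdd_ae_continuous_conv[OF \<mu> null, where B = 1]) (use f in auto)
    then show "(\<lambda>n. integral\<^sup>L (distr (\<mu> n) borel g) f) \<longlonglongrightarrow> integral\<^sup>L (distr \<nu> borel g) f"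
      by (simp add: integral_distr gm)
  qed
qed

text \<open>
  On the unit interval the moments determine weak convergence: they control the characteristic
  functions through the exponential series, uniformly in \<open>n\<close>.
\<close>

lemma (in prob_space) weak_conv_m_from_moments:
  fixes U :: "nat \<Rightarrow> 'a \<Rightarrow> real" and V :: "'b \<Rightarrow> real"
  assumes N: "prob_space N"
    and U[measurable]: "\<And>n. U n \<in> borel_measurable M" and U01: "\<And>n \<omega>. U n \<omega> \<in> {0..1}"
    and V[measurable]: "V \<in> borel_measurable N" and V01: "\<And>x. V x \<in> {0..1}"
    and mom: "\<And>k. (\<lambda>n. expectation (\<lambda>\<omega>. U n \<omega> ^ k)) \<longlonglongrightarrow> (\<integral>x. V x ^ k \<partial>N)"
  shows "weak_conv_m (\<lambda>n. distr M borel (U n)) (distr N borel V)"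
proof (rule levy_continuity)
  interpret N: prob_space N by fact
  show "real_distribution (distr M borel (U n))" for n by (rule real_distribution_distr) measurable
  show "real_distribution (distr N borel V)" by (rule N.real_distribution_distr) measurable
  fix t :: real
  have intU: "integrable M (\<lambda>\<omega>. U n \<omega> ^ k)" for n k
    by (rule integrable_const_bound[of _ 1]) (use U01 in \<open>auto intro!: power_le_one\<close>)
  have intV: "integrable N (\<lambda>x. V x ^ k)" for k
    by (rule N.integrable_const_bound[of _ 1]) (use V01 in \<open>auto intro!: power_le_one\<close>)
  have absU: "expectation (\<lambda>\<omega>. \<bar>U n \<omega>\<bar> ^ k) \<le> 1" for n k
  proof -
    have "expectation (\<lambda>\<omega>. \<bar>U n \<omega>\<bar> ^ k) \<le> expectation (\<lambda>_. 1)"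
      using U01 intU by (intro integral_mono) (auto intro!: power_le_one)
    then show ?thesis by (simp add: prob_space)
  qed
  have absV: "N.expectation (\<lambda>\<omega>. \<bar>V \<omega>\<bar> ^ k) \<le> 1" for k
  proof -
    have "N.expectation (\<lambda>\<omega>. \<bar>V \<omega>\<bar> ^ k) \<le> N.expectation (\<lambda>_. 1)"
      using V01 intV by (intro integral_mono) (auto intro!: power_le_one)
    then show ?thesis by (simp add: N.prob_space)
  qed
  let ?T = "\<lambda>m. 2 * \<bar>t\<bar> ^ m / fact m"
  define P where "P n m = (\<Sum>k\<le>m. ((\<i> * t) ^ k / fact k) * complex_of_real (expectation (\<lambda>\<omega>. U n \<omega> ^ k)))" for n m
  define L where "L m = (\<Sum>k\<le>m. ((\<i> * t) ^ k / fact k) * complex_of_real (N.expectation (\<lambda>x. V x ^ k)))" for m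
  have cU: "cmod (char (distr M borel (U n)) t - P n m) \<le> ?T m" for n m
  proof -
    have "cmod (char (distr M borel (U n)) t - P n m) \<le> ?T m * expectation (\<lambda>\<omega>. \<bar>U n \<omega>\<bar> ^ m)"
      unfolding P_def by (rule char_approx1'[OF intU]) auto
    also have "\<dots> \<le> ?T m * 1" by (intro mult_left_mono absU) auto
    finally show ?thesis by simp
  qed
  have cV: "cmod (char (distr N borel V) t - L m) \<le> ?T m" for m
  proof -
    have "cmod (char (distr N borel V) t - L m) \<le> ?T m * N.expectation (\<lambda>\<omega>. \<bar>V \<omega>\<bar> ^ m)"
      unfolding L_def by (rule N.char_approx1'[OF intV]) auto
    also have "\<dots> \<le> ?T m * 1" by (intro mult_left_mono absV) auto
    finally show ?thesis by simp
  qed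
  have T0: "(\<lambda>m. ?T m) \<longlonglongrightarrow> 0"
  proof -
    have "(\<lambda>m. \<bar>t\<bar> ^ m / fact m) \<longlonglongrightarrow> 0"
      using summable_LIMSEQ_zero[OF summable_exp[of "\<bar>t\<bar>"]] by (simp add: field_simps)
    from tendsto_mult[OF tendsto_const[of 2] this] show ?thesis by simp
  qed
  show "(\<lambda>n. char (distr M borel (U n)) t) \<longlonglongrightarrow> char (distr N borel V) t"
  proof (rule LIMSEQ_I)
    fix e :: real assume "0 < e"
    from order_tendstoD(2)[OF T0, of "e / 4"] \<open>0 < e\<close>
    obtain m where m: "?T m < e / 4" by (auto simp: eventually_sequentially)
    have "(\<lambda>n. P n m) \<longlonglongrightarrow> L m"
      unfolding P_def L_def by (intro tendsto_sum tendsto_mult tendsto_const tendsto_of_real mom)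
    from LIMSEQ_D[OF this, of "e / 2"] \<open>0 < e\<close>
    obtain no where no: "\<And>n. no \<le> n \<Longrightarrow> cmod (P n m - L m) < e / 2" by auto
    have "cmod (char (distr M borel (U n)) t - char (distr N borel V) t) < e" if "no \<le> n" for n
    proof -
      let ?a = "char (distr M borel (U n)) t" and ?b = "char (distr N borel V) t"
      have tri: "cmod (a - b) \<le> cmod (a - p) + cmod (p - l) + cmod (b - l)" for a b p l
        using norm_triangle_ineq4[of "(a - p) + (p - l)" "b - l"] norm_triangle_ineq[of "a - p" "p - l"] by simp
      have "cmod (?a - ?b) \<le> cmod (?a - P n m) + cmod (P n m - L m) + cmod (?b - L m)" by (rule tri)
      then show ?thesis using cU[of n m] cV[of m] no[OF that] m by linarith
    qed
    then show "\<exists>no. \<forall>n\<ge>no. cmod (char (distr M borel (U n)) t - char (distr N borel V) t) < e" by blast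
  qed
qed

lemma prob_space_std_normal: "prob_space std_normal_distribution"
  using prob_space_normal_density[of 1 0] by simp

text \<open>
  Gaussian randomisation: \<open>exp (- s\<^sup>2 x\<^sup>2 / 2)\<close> is the characteristic function of a standard normal
  variable at \<open>s x\<close>, so expectations of it are mixtures of characteristic functions.
\<close>

lemma (in prob_space) gaussian_randomization:
  fixes Z :: "'a \<Rightarrow> complex" and X :: "'a \<Rightarrow> real"
  assumes Z[measurable]: "Z \<in> borel_measurable M" and Z1: "\<And>\<omega>. cmod (Z \<omega>) \<le> 1"
    and X[measurable]: "X \<in> borel_measurable M"
  shows "expectation (\<lambda>\<omega>. Z \<omega> * complex_of_real (exp (- (s * X \<omega>)\<^sup>2 / 2)))
       = (\<integral>u. expectation (\<lambda>\<omega>. Z \<omega> * iexp (s * u * X \<omega>)) \<partial>std_normal_distribution)"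
proof -
  interpret N: prob_space std_normal_distribution by (rule prob_space_std_normal)
  interpret P: pair_prob_space M std_normal_distribution ..
  have ch: "(\<integral>u. iexp (t * u) \<partial>std_normal_distribution) = complex_of_real (exp (- t\<^sup>2 / 2))" for t
    using fun_cong[OF char_std_normal_distribution, of t] by (simp add: char_def)
  have "integrable (M \<Otimes>\<^sub>M std_normal_distribution) (\<lambda>(\<omega>, u). Z \<omega> * iexp (s * u * X \<omega>))"
  proof (rule P.integrable_const_bound[of _ 1])
    show "AE x in M \<Otimes>\<^sub>M std_normal_distribution. norm (case x of (\<omega>, u) \<Rightarrow> Z \<omega> * iexp (s * u * X \<omega>)) \<le> 1"
      using Z1 by (intro AE_I2) (auto simp: norm_mult)
  qed measurable
  from P.Fubini_integral[OF this]
  have "(\<integral>u. expectation (\<lambda>\<omega>. Z \<omega> * iexp (s * u * X \<omega>)) \<partial>std_normal_distribution)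
     = expectation (\<lambda>\<omega>. \<integral>u. Z \<omega> * iexp (s * u * X \<omega>) \<partial>std_normal_distribution)" .
  also have "(\<lambda>\<omega>. \<integral>u. Z \<omega> * iexp (s * u * X \<omega>) \<partial>std_normal_distribution) = (\<lambda>\<omega>. Z \<omega> * complex_of_real (exp (- (s * X \<omega>)\<^sup>2 / 2)))"
  proof
    fix \<omega>
    have "(\<integral>u. Z \<omega> * iexp (s * u * X \<omega>) \<partial>std_normal_distribution) = Z \<omega> * (\<integral>u. iexp ((s * X \<omega>) * u) \<partial>std_normal_distribution)"
      by (subst integral_mult_right_zero[symmetric]) (simp add: ac_simps)
    then show "(\<integral>u. Z \<omega> * iexp (s * u * X \<omega>) \<partial>std_normal_distribution) = Z \<omega> * complex_of_real (exp (- (s * X \<omega>)\<^sup>2 / 2))"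
      unfolding ch .
  qed
  finally show ?thesis by simp
qed

lemma (in prob_space) gaussian_randomization_tendsto:
  fixes Z :: "nat \<Rightarrow> 'a \<Rightarrow> complex" and X :: "nat \<Rightarrow> 'a \<Rightarrow> real" and L :: "real \<Rightarrow> complex"
  assumes Z[measurable]: "\<And>n. Z n \<in> borel_measurable M" and Z1: "\<And>n \<omega>. cmod (Z n \<omega>) \<le> 1"
    and X[measurable]: "\<And>n. X n \<in> borel_measurable M" and L[measurable]: "L \<in> borel_measurable borel"
    and lim: "\<And>u. (\<lambda>n. expectation (\<lambda>\<omega>. Z n \<omega> * iexp (s * u * X n \<omega>))) \<longlonglongrightarrow> L u"
  shows "(\<lambda>n. expectation (\<lambda>\<omega>. Z n \<omega> * complex_of_real (exp (- (s * X n \<omega>)\<^sup>2 / 2)))) \<longlonglongrightarrow> (\<integral>u. L u \<partial>std_normal_distribution)"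
proof -
  interpret N: prob_space std_normal_distribution by (rule prob_space_std_normal)
  have m: "(\<lambda>u. expectation (\<lambda>\<omega>. Z n \<omega> * iexp (s * u * X n \<omega>))) \<in> borel_measurable std_normal_distribution" for n
    by measurable
  have le: "cmod (expectation (\<lambda>\<omega>. Z n \<omega> * iexp (s * u * X n \<omega>))) \<le> 1" for n u
  proof -
    have I: "integrable M (\<lambda>\<omega>. Z n \<omega> * iexp (s * u * X n \<omega>))"
      using Z1 by (intro integrable_const_bound[of _ 1]) (auto simp: norm_mult)
    have "cmod (expectation (\<lambda>\<omega>. Z n \<omega> * iexp (s * u * X n \<omega>))) \<le> expectation (\<lambda>\<omega>. cmod (Z n \<omega> * iexp (s * u * X n \<omega>)))"
      by (rule integral_norm_bound)
    also have "\<dots> \<le> expectation (\<lambda>_. 1)"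
      using Z1 I by (intro integral_mono integrable_norm) (auto simp: norm_mult)
    finally show ?thesis by (simp add: prob_space)
  qed
  have "(\<lambda>n. \<integral>u. expectation (\<lambda>\<omega>. Z n \<omega> * iexp (s * u * X n \<omega>)) \<partial>std_normal_distribution) \<longlonglongrightarrow> (\<integral>u. L u \<partial>std_normal_distribution)"
    by (rule integral_dominated_convergence[where w = "\<lambda>_. 1"]) (use m le lim in auto)
  then show ?thesis unfolding gaussian_randomization[OF Z Z1 X] .
qed

lemma integral_gaussian_std_normal:
  assumes "0 \<le> a"
  shows "(\<integral>u. complex_of_real (exp (- a * u\<^sup>2 / 2)) \<partial>std_normal_distribution) = complex_of_real (1 / sqrt (1 + a))"
proof -
  let ?\<sigma> = "1 / sqrt (1 + a)"
  have pw: "std_normal_density u * exp (- a * u\<^sup>2 / 2) = ?\<sigma> * normal_density 0 ?\<sigma> u" for u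
  proof -
    have "- u\<^sup>2 / 2 + - a * u\<^sup>2 / 2 = - u\<^sup>2 / (2 * ?\<sigma>\<^sup>2)"
      using assms by (simp add: power_divide field_simps)
    then have "exp (- u\<^sup>2 / 2) * exp (- a * u\<^sup>2 / 2) = exp (- u\<^sup>2 / (2 * ?\<sigma>\<^sup>2))"
      by (simp only: exp_add[symmetric])
    moreover have "1 / sqrt (2 * pi) = ?\<sigma> * (1 / sqrt (2 * pi * ?\<sigma>\<^sup>2))"
      using assms by (simp add: real_sqrt_mult real_sqrt_divide power_divide)
    ultimately show ?thesis by (simp only: normal_density_def diff_0_right power_one mult_1_right mult.assoc)
  qed
  have "(\<integral>u. exp (- a * u\<^sup>2 / 2) \<partial>std_normal_distribution) = (\<integral>u. ?\<sigma> * normal_density 0 ?\<sigma> u \<partial>lborel)"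
    by (subst integral_density, simp, simp, simp, simp only: real_scaleR_def pw)
  also have "\<dots> = ?\<sigma>" using assms by simp
  finally show ?thesis by (simp only: integral_complex_of_real)
qed

lemma prob_space_exponential_dist: "prob_space (exponential_dist 1)"
  unfolding exponential_dist_def by (rule prob_space_exponential_density) simp

lemma exponential_dist_laplace:
  "(\<integral>x. exp (- \<bar>x\<bar>) ^ k \<partial>exponential_dist 1) = 1 / (1 + real k)"
proof -
  have pw: "exponential_density 1 x * exp (- \<bar>x\<bar>) ^ k = 1 / (1 + real k) * exponential_density (1 + real k) x" for x
  proof (cases "x < 0")
    case False
    have "1 + real k \<noteq> 0" by linarith
    moreover have "exp (- x) * exp (- x) ^ k = exp (- x * (1 + real k))"
      by (simp add: exp_of_nat_mult[symmetric] exp_add[symmetric] algebra_simps)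
    ultimately show ?thesis using False by (simp add: exponential_density_def)
  qed (simp add: exponential_density_def)
  interpret E: prob_space "density lborel (exponential_density (1 + real k))"
    by (rule prob_space_exponential_density) simp
  have nn: "0 \<le> exponential_density (1 + real k) x" for x :: real by (simp add: exponential_density_def)
  have "(\<integral>x. exponential_density (1 + real k) x \<partial>lborel) = (\<integral>x. 1 \<partial>density lborel (exponential_density (1 + real k)))"
    using nn by (subst integral_density) auto
  also have "\<dots> = 1" using E.prob_space by simp
  finally have one: "(\<integral>x. exponential_density (1 + real k) x \<partial>lborel) = 1" .
  have nn1: "0 \<le> exponential_density 1 x" for x :: real by (simp add: exponential_density_def)
  have "(\<integral>x. exp (- \<bar>x\<bar>) ^ k \<partial>exponential_dist 1) = (\<integral>x. 1 / (1 + real k) * exponential_density (1 + real k) x \<partial>lborel)"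
    unfolding exponential_dist_def using nn1 by (subst integral_density) (auto simp: pw)
  also have "\<dots> = 1 / (1 + real k)" by (simp only: integral_mult_right_zero one mult_1_right)
  finally show ?thesis .
qed

text \<open>
  Randomising twice turns the joint characteristic function of \<open>(X, Y)\<close> into the Laplace transform
  of \<open>X\<^sup>2 + Y\<^sup>2\<close>, whose integer points are the moments of \<open>exp (- (X\<^sup>2 + Y\<^sup>2))\<close>. These converge to the
  moments of the uniform law, and \<open>- ln\<close> maps the uniform law to the exponential law.
\<close>

theorem (in prob_space) weak_conv_m_exponential:
  fixes X Y :: "nat \<Rightarrow> 'a \<Rightarrow> real"
  assumes X[measurable]: "\<And>n. X n \<in> borel_measurable M" and Y[measurable]: "\<And>n. Y n \<in> borel_measurable M"
    and lim: "\<And>a b. (\<lambda>n. expectation (\<lambda>\<omega>. iexp (a * X n \<omega> + b * Y n \<omega>))) \<longlonglongrightarrow> complex_of_real (exp (- (a\<^sup>2 + b\<^sup>2) / 4))"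
  shows "weak_conv_m (\<lambda>n. distr M borel (\<lambda>\<omega>. (X n \<omega>)\<^sup>2 + (Y n \<omega>)\<^sup>2)) (exponential_dist 1)"
proof -
  define W where "W n \<omega> = (X n \<omega>)\<^sup>2 + (Y n \<omega>)\<^sup>2" for n \<omega>
  have W[measurable]: "W n \<in> borel_measurable M" for n unfolding W_def[abs_def] by measurable
  have W0: "0 \<le> W n \<omega>" for n \<omega> by (simp add: W_def)
  let ?N = "exponential_dist 1" and ?V = "\<lambda>x :: real. exp (- \<bar>x\<bar>)"
  interpret N: prob_space ?N by (rule prob_space_exponential_dist)
  have setsN[measurable_cong]: "sets ?N = sets borel" by (simp add: exponential_dist_def)
  have laplace: "(\<lambda>n. expectation (\<lambda>\<omega>. exp (- W n \<omega>) ^ k)) \<longlonglongrightarrow> 1 / (1 + real k)" for k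
  proof -
    define s where "s = sqrt (2 * real k)"
    have s2: "(s * x)\<^sup>2 / 2 = real k * x\<^sup>2" for x :: real by (simp add: s_def power_mult_distrib)
    have E1: "(\<lambda>n. expectation (\<lambda>\<omega>. iexp (b * Y n \<omega>) * complex_of_real (exp (- (s * X n \<omega>)\<^sup>2 / 2))))
        \<longlonglongrightarrow> complex_of_real (exp (- b\<^sup>2 / 4)) * complex_of_real (1 / sqrt (1 + real k))" for b
    proof -
      have "(\<lambda>n. expectation (\<lambda>\<omega>. iexp (b * Y n \<omega>) * complex_of_real (exp (- (s * X n \<omega>)\<^sup>2 / 2))))
        \<longlonglongrightarrow> (\<integral>u. complex_of_real (exp (- b\<^sup>2 / 4)) * complex_of_real (exp (- real k * u\<^sup>2 / 2)) \<partial>std_normal_distribution)"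
      proof (rule gaussian_randomization_tendsto)
        fix u
        have "- ((s * u)\<^sup>2 + b\<^sup>2) / 4 = - b\<^sup>2 / 4 + - real k * u\<^sup>2 / 2"
          using s2[of u] by (auto simp: field_simps)
        then have "complex_of_real (exp (- ((s * u)\<^sup>2 + b\<^sup>2) / 4)) = complex_of_real (exp (- b\<^sup>2 / 4)) * complex_of_real (exp (- real k * u\<^sup>2 / 2))"
          by (simp only: exp_add of_real_mult)
        with lim[of "s * u" b]
        show "(\<lambda>n. expectation (\<lambda>\<omega>. iexp (b * Y n \<omega>) * iexp (s * u * X n \<omega>)))
           \<longlonglongrightarrow> complex_of_real (exp (- b\<^sup>2 / 4)) * complex_of_real (exp (- real k * u\<^sup>2 / 2))"
          by (simp add: exp_add[symmetric] distrib_left[symmetric] add.commute)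
      qed (auto simp del: of_real_exp)
      then show ?thesis
        unfolding integral_mult_right_zero by (simp only: integral_gaussian_std_normal[of "real k", OF of_nat_0_le_iff])
    qed
    have "(\<lambda>n. expectation (\<lambda>\<omega>. complex_of_real (exp (- (s * X n \<omega>)\<^sup>2 / 2)) * complex_of_real (exp (- (s * Y n \<omega>)\<^sup>2 / 2))))
      \<longlonglongrightarrow> (\<integral>v. complex_of_real (1 / sqrt (1 + real k)) * complex_of_real (exp (- real k * v\<^sup>2 / 2)) \<partial>std_normal_distribution)"
    proof (rule gaussian_randomization_tendsto)
      fix v
      have "- (s * v)\<^sup>2 / 4 = - real k * v\<^sup>2 / 2" using s2[of v] by simp
      then show "(\<lambda>n. expectation (\<lambda>\<omega>. complex_of_real (exp (- (s * X n \<omega>)\<^sup>2 / 2)) * iexp (s * v * Y n \<omega>)))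
         \<longlonglongrightarrow> complex_of_real (1 / sqrt (1 + real k)) * complex_of_real (exp (- real k * v\<^sup>2 / 2))"
        using E1[of "s * v"] by (simp only: mult.commute)
    qed (auto simp del: of_real_exp)
    also have "(\<integral>v. complex_of_real (1 / sqrt (1 + real k)) * complex_of_real (exp (- real k * v\<^sup>2 / 2)) \<partial>std_normal_distribution)
       = complex_of_real (1 / (1 + real k))"
      unfolding integral_mult_right_zero integral_gaussian_std_normal[of "real k", OF of_nat_0_le_iff]
      by (simp add: of_real_mult[symmetric] del: of_real_mult of_real_divide)
    also have "(\<lambda>n. expectation (\<lambda>\<omega>. complex_of_real (exp (- (s * X n \<omega>)\<^sup>2 / 2)) * complex_of_real (exp (- (s * Y n \<omega>)\<^sup>2 / 2))))
       = (\<lambda>n. complex_of_real (expectation (\<lambda>\<omega>. exp (- W n \<omega>) ^ k)))"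
    proof
      fix n
      have "complex_of_real (exp (- (s * X n \<omega>)\<^sup>2 / 2)) * complex_of_real (exp (- (s * Y n \<omega>)\<^sup>2 / 2)) = complex_of_real (exp (- W n \<omega>) ^ k)" for \<omega>
      proof -
        have "exp (- (s * X n \<omega>)\<^sup>2 / 2) * exp (- (s * Y n \<omega>)\<^sup>2 / 2) = exp (- W n \<omega>) ^ k"
          unfolding exp_of_nat_mult[symmetric] exp_add[symmetric] minus_divide_left[symmetric] s2 W_def
          by (simp add: algebra_simps)
        then show ?thesis by (simp only: of_real_mult[symmetric])
      qed
      then show "expectation (\<lambda>\<omega>. complex_of_real (exp (- (s * X n \<omega>)\<^sup>2 / 2)) * complex_of_real (exp (- (s * Y n \<omega>)\<^sup>2 / 2)))
         = complex_of_real (expectation (\<lambda>\<omega>. exp (- W n \<omega>) ^ k))"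
        by (simp only: integral_complex_of_real)
    qed
    finally show ?thesis by (simp only: tendsto_of_real_iff)
  qed
  have wc: "weak_conv_m (\<lambda>n. distr M borel (\<lambda>\<omega>. exp (- W n \<omega>))) (distr ?N borel ?V)"
  proof (rule weak_conv_m_from_moments[OF prob_space_exponential_dist])
    show "(\<lambda>n. expectation (\<lambda>\<omega>. exp (- W n \<omega>) ^ k)) \<longlonglongrightarrow> (\<integral>x. ?V x ^ k \<partial>?N)" for k
      using laplace by (simp only: exponential_dist_laplace)
  qed (use W0 in auto)
  have "weak_conv_m (\<lambda>n. distr (distr M borel (\<lambda>\<omega>. exp (- W n \<omega>))) borel (\<lambda>u. - ln u)) (distr (distr ?N borel ?V) borel (\<lambda>u. - ln u))"
  proof (rule weak_conv_m_continuous_map[OF _ _ wc, where A = "{..0}"])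
    have "?V -` {..0} = {}" by (auto simp: not_le)
    then show "emeasure (distr ?N borel ?V) {..0} = 0" by (subst emeasure_distr) auto
    show "isCont (\<lambda>u. - ln u) x" if "x \<notin> {..0}" for x :: real
      using that by (intro continuous_intros) auto
    show "real_distribution (distr M borel (\<lambda>\<omega>. exp (- W n \<omega>)))" for n by (rule real_distribution_distr) measurable
    show "real_distribution (distr ?N borel ?V)" by (rule N.real_distribution_distr) measurable
  qed auto
  moreover have "distr (distr M borel (\<lambda>\<omega>. exp (- W n \<omega>))) borel (\<lambda>u. - ln u) = distr M borel (W n)" for n
    by (subst distr_distr) (auto simp: comp_def)
  moreover have "distr (distr ?N borel ?V) borel (\<lambda>u. - ln u) = ?N"
  proof -
    have "AE x in ?N. \<bar>x\<bar> = x"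
      unfolding exponential_dist_def by (subst AE_density) (auto simp: exponential_density_def)
    then have "distr ?N borel (\<lambda>x. \<bar>x\<bar>) = distr ?N borel (\<lambda>x. x)"
      by (intro distr_cong_AE) auto
    also have "\<dots> = ?N" by (rule distr_id2) (simp add: setsN)
    finally show ?thesis by (subst distr_distr) (auto simp: comp_def)
  qed
  ultimately show ?thesis by (simp add: W_def[abs_def])
qed

theorem (in prob_space) weak_conv_m_chi_square:
  fixes X :: "nat \<Rightarrow> 'a \<Rightarrow> real"
  assumes X[measurable]: "\<And>n. X n \<in> borel_measurable M"
    and lim: "\<And>a. (\<lambda>n. expectation (\<lambda>\<omega>. iexp (a * X n \<omega>))) \<longlonglongrightarrow> complex_of_real (exp (- a\<^sup>2 / 2))"
  shows "weak_conv_m (\<lambda>n. distr M borel (\<lambda>\<omega>. (X n \<omega>)\<^sup>2)) chi_square_1"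
proof -
  have rd: "real_distribution (distr M borel (X n))" for n by (rule real_distribution_distr) measurable
  have wc: "weak_conv_m (\<lambda>n. distr M borel (X n)) std_normal_distribution"
  proof (rule levy_continuity[OF rd real_dist_normal_dist])
    show "(\<lambda>n. char (distr M borel (X n)) t) \<longlonglongrightarrow> char std_normal_distribution t" for t
      using lim[of t] by (simp add: char_std_normal_distribution char_def integral_distr)
  qed
  have "weak_conv_m (\<lambda>n. distr (distr M borel (X n)) borel (\<lambda>z. z\<^sup>2)) (distr std_normal_distribution borel (\<lambda>z. z\<^sup>2))"
    by (rule weak_conv_m_continuous_map[OF rd real_dist_normal_dist wc, where A = "{}"]) auto
  moreover have "distr (distr M borel (X n)) borel (\<lambda>z. z\<^sup>2) = distr M borel (\<lambda>\<omega>. (X n \<omega>)\<^sup>2)" for n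
    by (subst distr_distr) (auto simp: comp_def)
  ultimately show ?thesis by (simp add: chi_square_1_def)
qed

section \<open>The periodogram\<close>

context pls
begin

text \<open>
  By \<open>variance_tendsto\<close> the weighted sum has variance about \<open>n \<kappa>\<close> times \<open>2 \<pi>\<close> times the integrated
  spectral density. The lower bound on the spectral density keeps the normalised weights of the
  order \<open>n\<^bsup>-1/2\<^esup>\<close>.
\<close>

lemma weighted_clt:
  fixes c :: "nat \<Rightarrow> int \<Rightarrow> real" and freq :: "nat \<Rightarrow> real" and W \<kappa> c0 :: real
  assumes W: "\<And>n k. \<bar>c n k\<bar> \<le> W"
    and osc: "\<And>h. \<exists>Q. \<forall>n\<ge>1. \<forall>m. \<bar>\<Sum>k=1..m. c n (int k) * c n (int k + h) - \<kappa> * cos (of_int h * freq n)\<bar> \<le> Q"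
    and c0: "0 < c0" "\<And>n t. 1 \<le> n \<Longrightarrow> t \<in> {0..1} \<Longrightarrow> c0 \<le> local_spec M r d G \<epsilon> t (freq n)"
  defines "v \<equiv> \<lambda>n. integral {0..1} (\<lambda>t. local_spec M r d G \<epsilon> t (freq n))"
  shows "(\<lambda>n. expectation (\<lambda>\<omega>. iexp (\<Sum>k=1..n. c n (int k) / sqrt (2 * pi * n * v n) * pls_process r d G \<epsilon> n k \<omega>)))
     \<longlonglongrightarrow> complex_of_real (exp (- \<kappa> / 2))"
proof -
  define V where "V n = (\<integral>h. mean_acov h * cos (of_int h * freq n) \<partial>count_space UNIV)" for n
  have Vv: "V n = 2 * pi * v n" for n
    unfolding V_def v_def integral_local_spec by simp
  have v_ge: "c0 \<le> v n" if "1 \<le> n" for n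
  proof -
    have "integral {0..1} (\<lambda>t::real. c0) \<le> v n"
      unfolding v_def using c0(2)[OF that] by (intro integral_le integral_local_spec(2)) auto
    then show ?thesis by simp
  qed
  have W0: "0 \<le> W" using W[of 0 0] by linarith
  let ?S = "\<lambda>n. expectation (\<lambda>\<omega>. (\<Sum>k=1..n. c n (int k) * obs_filter n (int k) (history \<epsilon> (int k) \<omega>))\<^sup>2)"
  let ?w = "\<lambda>n k. c n (int k) / sqrt (2 * pi * n * v n)"
  have sq: "expectation (\<lambda>\<omega>. (\<Sum>k=1..n. ?w n k * obs_filter n (int k) (history \<epsilon> (int k) \<omega>))\<^sup>2) = ?S n / real n / V n"
    if n: "1 \<le> n" for n
  proof -
    have pos: "0 < 2 * pi * n * v n" using n v_ge[OF n] c0(1) by simp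
    have "(\<Sum>k=1..n. ?w n k * obs_filter n (int k) (history \<epsilon> (int k) \<omega>))\<^sup>2
       = (\<Sum>k=1..n. c n (int k) * obs_filter n (int k) (history \<epsilon> (int k) \<omega>))\<^sup>2 / (2 * pi * n * v n)" for \<omega>
    proof -
      have "(\<Sum>k=1..n. ?w n k * obs_filter n (int k) (history \<epsilon> (int k) \<omega>))
         = (\<Sum>k=1..n. c n (int k) * obs_filter n (int k) (history \<epsilon> (int k) \<omega>)) / sqrt (2 * pi * n * v n)"
        by (simp add: sum_divide_distrib)
      then show ?thesis using pos by (simp add: power_divide)
    qed
    then show ?thesis by (simp add: Vv ac_simps)
  qed
  have lim: "(\<lambda>n. ?S n / real n / V n) \<longlonglongrightarrow> \<kappa>"
  proof -
    have diff: "(\<lambda>n. ?S n / real n - \<kappa> * V n) \<longlonglongrightarrow> 0"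
      unfolding V_def by (rule variance_tendsto[OF W osc])
    have "(\<lambda>n. ?S n / real n / V n - \<kappa>) \<longlonglongrightarrow> 0"
    proof (rule Lim_null_comparison)
      show "\<forall>\<^sub>F n in sequentially. norm (?S n / real n / V n - \<kappa>) \<le> \<bar>?S n / real n - \<kappa> * V n\<bar> * (1 / (2 * pi * c0))"
        using eventually_ge_at_top[of 1]
      proof eventually_elim
        case (elim n)
        have V: "2 * pi * c0 \<le> V n" "0 < 2 * pi * c0" unfolding Vv using v_ge[OF elim] c0(1) by simp_all
        then have Vpos: "0 < V n" by linarith
        have "?S n / real n / V n - \<kappa> = (?S n / real n - \<kappa> * V n) / V n" using Vpos by (simp add: diff_divide_distrib)
        then have "norm (?S n / real n / V n - \<kappa>) = \<bar>?S n / real n - \<kappa> * V n\<bar> * (1 / V n)" using Vpos by (simp only: real_norm_def abs_divide) simp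
        also have "\<dots> \<le> \<bar>?S n / real n - \<kappa> * V n\<bar> * (1 / (2 * pi * c0))"
          using V Vpos c0(1) by (intro mult_left_mono divide_left_mono mult_pos_pos) auto
        finally show ?case .
      qed
      show "(\<lambda>n. \<bar>?S n / real n - \<kappa> * V n\<bar> * (1 / (2 * pi * c0))) \<longlonglongrightarrow> 0"
        by (rule tendsto_mult_left_zero[OF tendsto_rabs_zero[OF diff]])
    qed
    then show ?thesis by (rule LIM_zero_cancel)
  qed
  have "(\<lambda>n. expectation (\<lambda>\<omega>. iexp (\<Sum>k=1..n. ?w n k * obs_filter n (int k) (history \<epsilon> (int k) \<omega>))))
     \<longlonglongrightarrow> complex_of_real (exp (- \<kappa> / 2))"
  proof (rule geometric_filter_clt[OF geometric_obs_filter rho])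
    show "(\<lambda>n. expectation (\<lambda>\<omega>. (\<Sum>k=1..n. ?w n k * obs_filter n (int k) (history \<epsilon> (int k) \<omega>))\<^sup>2)) \<longlonglongrightarrow> \<kappa>"
      by (rule Lim_transform_eventually[OF lim]) (use sq in \<open>auto intro!: eventually_sequentiallyI[of 1]\<close>)
    show "0 \<le> W / sqrt (2 * pi * c0)" using W0 c0 by simp
    fix n k :: nat assume "k \<in> {1..n}"
    then have n: "1 \<le> n" by simp
    have "sqrt (2 * pi * c0) * sqrt n \<le> sqrt (2 * pi * n * v n)"
    proof -
      have "2 * pi * c0 * n \<le> 2 * pi * v n * n" using v_ge[OF n] by (intro mult_right_mono mult_left_mono) auto
      then have "sqrt (2 * pi * c0 * n) \<le> sqrt (2 * pi * n * v n)" by (simp add: ac_simps)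
      then show ?thesis by (simp only: real_sqrt_mult)
    qed
    then have "\<bar>c n (int k)\<bar> / sqrt (2 * pi * n * v n) \<le> W / (sqrt (2 * pi * c0) * sqrt n)"
      using W W0 c0(1) n by (intro frac_le) auto
    moreover have "0 \<le> sqrt (2 * pi * n * v n)" using v_ge[OF n] c0(1) by simp
    ultimately show "\<bar>?w n k\<bar> \<le> W / sqrt (2 * pi * c0) / sqrt n" by (simp only: abs_divide abs_of_nonneg divide_divide_eq_left)
  qed
  then show ?thesis by (simp only: pls_process_eq)
qed

end

lemma periodogram_eq_sum_squares:
  "periodogram X n l \<omega> = ((\<Sum>k=1..n. X k \<omega> * cos (k * l))\<^sup>2 + (\<Sum>k=1..n. X k \<omega> * sin (k * l))\<^sup>2) / (2 * pi * n)"
proof -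
  have "complex_of_real (X j \<omega>) * exp (\<i> * of_nat j * complex_of_real l) = Complex (X j \<omega> * cos (j * l)) (X j \<omega> * sin (j * l))" for j
  proof -
    have "exp (\<i> * of_nat j * complex_of_real l) = cis (real j * l)" by (simp add: cis_conv_exp mult.assoc)
    then show ?thesis by (simp add: complex_eq_iff)
  qed
  then have "(\<Sum>j=1..n. complex_of_real (X j \<omega>) * exp (\<i> * of_nat j * complex_of_real l))
      = (\<Sum>j=1..n. Complex (X j \<omega> * cos (j * l)) (X j \<omega> * sin (j * l)))"
    by (simp only:)
  also have "\<dots> = Complex (\<Sum>k=1..n. X k \<omega> * cos (k * l)) (\<Sum>k=1..n. X k \<omega> * sin (k * l))"
    by (simp add: complex_eq_iff)
  finally show ?thesis by (simp add: periodogram_def cmod_power2)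
qed

text \<open>
  The product of two harmonics at distance \<open>h\<close> is a constant plus a harmonic of double frequency;
  multiplied by \<open>2 sin \<lambda>\<close> the latter telescopes.
\<close>

lemma trigonometric_product_sum_bound:
  fixes a b l s0 :: real and h :: int
  assumes s0: "0 < s0" "s0 \<le> sin l"
  defines "c \<equiv> \<lambda>k :: int. a * cos (of_int k * l) + b * sin (of_int k * l)"
  shows "\<bar>\<Sum>k=1..m. c (int k) * c (int k + h) - (a\<^sup>2 + b\<^sup>2) / 2 * cos (of_int h * l)\<bar> \<le> (\<bar>(a\<^sup>2 - b\<^sup>2) / 2\<bar> + \<bar>a * b\<bar>) / s0"
proof -
  define p q where "p = (a\<^sup>2 - b\<^sup>2) / 2" and "q = a * b"
  define x where "x k = (2 * real k + of_int h) * l" for k :: nat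
  define T where "T k = p * sin (x k - l) - q * cos (x k - l)" for k
  have product: "c (int k) * c (int k + h) - (a\<^sup>2 + b\<^sup>2) / 2 * cos (of_int h * l) = p * cos (x k) + q * sin (x k)" for k
  proof -
    let ?u = "real k * l" and ?w = "(real k + of_int h) * l"
    have e: "x k = ?u + ?w" "of_int h * l = ?w - ?u" by (simp_all add: x_def algebra_simps)
    have "c (int k) * c (int k + h) = (a * cos ?u + b * sin ?u) * (a * cos ?w + b * sin ?w)" by (simp add: c_def)
    then show ?thesis
      unfolding e cos_add cos_diff sin_add p_def q_def by (simp add: field_simps power2_eq_square)
  qed
  have tele: "2 * sin l * (p * cos (x k) + q * sin (x k)) = T (Suc k) - T k" for k
  proof -
    have "x (Suc k) - l = x k + l" by (simp add: x_def algebra_simps)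
    then show ?thesis by (simp add: T_def sin_add sin_diff cos_add cos_diff algebra_simps)
  qed
  have "2 * sin l * (\<Sum>k=1..m. p * cos (x k) + q * sin (x k)) = (\<Sum>k=1..m. T (Suc k) - T k)"
    by (simp only: sum_distrib_left tele)
  also have "\<dots> = T (Suc m) - T 1" by (induction m) auto
  finally have eq: "2 * sin l * (\<Sum>k=1..m. p * cos (x k) + q * sin (x k)) = T (Suc m) - T 1" .
  have Tb: "\<bar>T k\<bar> \<le> \<bar>p\<bar> + \<bar>q\<bar>" for k
  proof -
    have "\<bar>T k\<bar> \<le> \<bar>p * sin (x k - l)\<bar> + \<bar>q * cos (x k - l)\<bar>" unfolding T_def by (rule abs_triangle_ineq4)
    also have "\<dots> \<le> \<bar>p\<bar> * 1 + \<bar>q\<bar> * 1" unfolding abs_mult by (intro add_mono mult_left_mono) auto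
    finally show ?thesis by simp
  qed
  let ?\<Sigma> = "\<Sum>k=1..m. p * cos (x k) + q * sin (x k)"
  have "2 * s0 * \<bar>?\<Sigma>\<bar> \<le> 2 * sin l * \<bar>?\<Sigma>\<bar>" using s0 by (intro mult_right_mono) auto
  also have "\<dots> = \<bar>2 * sin l * ?\<Sigma>\<bar>" using s0 by (simp add: abs_mult)
  also have "\<dots> \<le> (\<bar>p\<bar> + \<bar>q\<bar>) + (\<bar>p\<bar> + \<bar>q\<bar>)"
    unfolding eq by (rule order_trans[OF abs_triangle_ineq4 add_mono[OF Tb Tb]])
  finally have "\<bar>?\<Sigma>\<bar> \<le> (\<bar>p\<bar> + \<bar>q\<bar>) / s0" using s0(1) by (simp add: field_simps)
  then show ?thesis unfolding product p_def q_def .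
qed

context pls
begin

lemma measurable_pls_process[measurable]: "pls_process r d G \<epsilon> n k \<in> borel_measurable M"
  using L4_le_measurable[OF geometric_filterD(2)[OF geometric_obs_filter]] by (simp add: pls_process_eq[abs_def])

text \<open>The periodogram divided by the integrated spectral density is the squared length of this pair.\<close>

definition dft_cos :: "(nat \<Rightarrow> real) \<Rightarrow> nat \<Rightarrow> 'a \<Rightarrow> real" where
  "dft_cos freq n \<omega> = (\<Sum>k=1..n. pls_process r d G \<epsilon> n k \<omega> * cos (k * freq n))
     / sqrt (2 * pi * n * integral {0..1} (\<lambda>t. local_spec M r d G \<epsilon> t (freq n)))"

definition dft_sin :: "(nat \<Rightarrow> real) \<Rightarrow> nat \<Rightarrow> 'a \<Rightarrow> real" where
  "dft_sin freq n \<omega> = (\<Sum>k=1..n. pls_process r d G \<epsilon> n k \<omega> * sin (k * freq n))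
     / sqrt (2 * pi * n * integral {0..1} (\<lambda>t. local_spec M r d G \<epsilon> t (freq n)))"

lemma measurable_dft[measurable]:
  "dft_cos freq n \<in> borel_measurable M" "dft_sin freq n \<in> borel_measurable M"
  unfolding dft_cos_def[abs_def] dft_sin_def[abs_def] by measurable

lemma normalized_periodogram_eq:
  assumes c0: "0 < c0" "\<And>n t. 1 \<le> n \<Longrightarrow> t \<in> {0..1} \<Longrightarrow> c0 \<le> local_spec M r d G \<epsilon> t (freq n)"
  shows "periodogram (pls_process r d G \<epsilon> n) n (freq n) \<omega> / integral {0..1} (\<lambda>t. local_spec M r d G \<epsilon> t (freq n))
     = (dft_cos freq n \<omega>)\<^sup>2 + (dft_sin freq n \<omega>)\<^sup>2"
proof (cases "n = 0")
  case True
  then show ?thesis by (simp add: periodogram_def dft_cos_def dft_sin_def)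
next
  case False
  let ?v = "integral {0..1} (\<lambda>t. local_spec M r d G \<epsilon> t (freq n))"
  have "integral {0..1} (\<lambda>t::real. c0) \<le> ?v"
    using c0(2)[of n] False by (intro integral_le integral_local_spec(2)) auto
  then have "0 \<le> 2 * pi * n * ?v" using c0(1) by simp
  then show ?thesis
    by (simp add: periodogram_eq_sum_squares dft_cos_def dft_sin_def power_divide add_divide_distrib)
qed

lemma dft_combination:
  "a * dft_cos freq n \<omega> + b * dft_sin freq n \<omega>
     = (\<Sum>k=1..n. (a * cos (of_int (int k) * freq n) + b * sin (of_int (int k) * freq n))
          / sqrt (2 * pi * n * integral {0..1} (\<lambda>t. local_spec M r d G \<epsilon> t (freq n))) * pls_process r d G \<epsilon> n k \<omega>)"
  unfolding dft_cos_def dft_sin_def sum_divide_distrib sum_distrib_left sum.distrib[symmetric]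
  by (intro sum.cong refl) (simp add: add_divide_distrib algebra_simps)

lemma trig_coefficient_bound: "\<bar>a * cos x + b * sin x\<bar> \<le> \<bar>a\<bar> + \<bar>b\<bar>" for a b x :: real
proof -
  have "\<bar>a * cos x\<bar> \<le> \<bar>a\<bar> * 1" "\<bar>b * sin x\<bar> \<le> \<bar>b\<bar> * 1" unfolding abs_mult by (intro mult_left_mono; simp)+
  then show ?thesis by linarith
qed

text \<open>
  Away from \<open>0\<close> and \<open>\<pi>\<close> the sine is bounded below, so the double frequency averages out uniformly in \<open>n\<close>
  and half of the variance remains in each direction: the cosine and sine sums are asymptotically
  independent normal variables of variance \<open>1 / 2\<close>.
\<close>

theorem periodogram_exponential:
  assumes c0: "0 < c0" "\<And>n t. 1 \<le> n \<Longrightarrow> t \<in> {0..1} \<Longrightarrow> c0 \<le> local_spec M r d G \<epsilon> t (freq n)"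
    and lu: "0 < l" "u < pi" "\<And>n. 1 \<le> n \<Longrightarrow> l \<le> freq n \<and> freq n \<le> u"
  shows "weak_conv_m (\<lambda>n. distr M borel (\<lambda>\<omega>. periodogram (pls_process r d G \<epsilon> n) n (freq n) \<omega>
            / integral {0..1} (\<lambda>t. local_spec M r d G \<epsilon> t (freq n)))) (exponential_dist 1)"
proof -
  have ne: "{l..u} \<noteq> {}" using lu(3)[of 1] by auto
  have "\<exists>y\<in>{l..u}. \<forall>x\<in>{l..u}. sin y \<le> sin x"
    by (intro continuous_attains_inf compact_Icc ne continuous_intros)
  then obtain y where y: "y \<in> {l..u}" "\<And>x. x \<in> {l..u} \<Longrightarrow> sin y \<le> sin x" by blast
  have siny: "0 < sin y" using y(1) lu by (intro sin_gt_zero) auto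
  have "(\<lambda>n. expectation (\<lambda>\<omega>. iexp (a * dft_cos freq n \<omega> + b * dft_sin freq n \<omega>))) \<longlonglongrightarrow> complex_of_real (exp (- (a\<^sup>2 + b\<^sup>2) / 4))" for a b
  proof -
    let ?c = "\<lambda>n (k :: int). a * cos (of_int k * freq n) + b * sin (of_int k * freq n)"
    have "(\<lambda>n. expectation (\<lambda>\<omega>. iexp (\<Sum>k=1..n. ?c n (int k)
        / sqrt (2 * pi * n * integral {0..1} (\<lambda>t. local_spec M r d G \<epsilon> t (freq n))) * pls_process r d G \<epsilon> n k \<omega>)))
       \<longlonglongrightarrow> complex_of_real (exp (- ((a\<^sup>2 + b\<^sup>2) / 2) / 2))"
    proof (rule weighted_clt[where freq = freq, OF trig_coefficient_bound _ c0])
      fix h :: int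
      show "\<exists>Q. \<forall>n\<ge>1. \<forall>m. \<bar>\<Sum>k=1..m. ?c n (int k) * ?c n (int k + h) - (a\<^sup>2 + b\<^sup>2) / 2 * cos (of_int h * freq n)\<bar> \<le> Q"
      proof (intro exI allI impI)
        fix n m :: nat assume "1 \<le> n"
        then have "sin y \<le> sin (freq n)" using y(2) lu(3) by simp
        then show "\<bar>\<Sum>k=1..m. ?c n (int k) * ?c n (int k + h) - (a\<^sup>2 + b\<^sup>2) / 2 * cos (of_int h * freq n)\<bar>
            \<le> (\<bar>(a\<^sup>2 - b\<^sup>2) / 2\<bar> + \<bar>a * b\<bar>) / sin y"
          by (rule trigonometric_product_sum_bound[OF siny])
      qed
    qed
    moreover have "- (x / 2) / 2 = - x / 4" for x :: real by simp
    ultimately show ?thesis by (simp only: dft_combination)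
  qed
  from weak_conv_m_exponential[OF measurable_dft this]
  show ?thesis by (simp only: normalized_periodogram_eq[where freq = freq, OF c0])
qed

text \<open>
  At \<open>0\<close> and \<open>\<pi>\<close> the sine sum vanishes and the cosines are \<open>\<plusminus>1\<close>, so nothing oscillates and the whole
  variance sits in the cosine sum.
\<close>

theorem periodogram_chi_square:
  assumes c0: "0 < c0" "\<And>n t. 1 \<le> n \<Longrightarrow> t \<in> {0..1} \<Longrightarrow> c0 \<le> local_spec M r d G \<epsilon> t (freq n)"
    and freq: "\<And>n. 1 \<le> n \<Longrightarrow> freq n = 0 \<or> freq n = pi"
  shows "weak_conv_m (\<lambda>n. distr M borel (\<lambda>\<omega>. periodogram (pls_process r d G \<epsilon> n) n (freq n) \<omega>
            / integral {0..1} (\<lambda>t. local_spec M r d G \<epsilon> t (freq n)))) chi_square_1"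
proof -
  have sin0: "sin (of_int k * freq n) = 0" if "1 \<le> n" for n and k :: int
    using freq[OF that] sin_npi_int[of k] by (auto simp: mult.commute)
  have dft_sin0: "dft_sin freq n \<omega> = 0" for n \<omega>
  proof (cases "n = 0")
    case False
    then have "sin (real k * freq n) = 0" for k using sin0[of n "int k"] by simp
    then show ?thesis by (simp add: dft_sin_def)
  qed (simp add: dft_sin_def)
  have "(\<lambda>n. expectation (\<lambda>\<omega>. iexp (a * dft_cos freq n \<omega>))) \<longlonglongrightarrow> complex_of_real (exp (- a\<^sup>2 / 2))" for a
  proof -
    let ?c = "\<lambda>n (k :: int). a * cos (of_int k * freq n) + 0 * sin (of_int k * freq n)"
    have "(\<lambda>n. expectation (\<lambda>\<omega>. iexp (\<Sum>k=1..n. ?c n (int k)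
        / sqrt (2 * pi * n * integral {0..1} (\<lambda>t. local_spec M r d G \<epsilon> t (freq n))) * pls_process r d G \<epsilon> n k \<omega>)))
       \<longlonglongrightarrow> complex_of_real (exp (- a\<^sup>2 / 2))"
    proof (rule weighted_clt[where freq = freq, OF trig_coefficient_bound _ c0])
      fix h :: int
      have prod: "?c n k * ?c n (k + h) = a\<^sup>2 * cos (of_int h * freq n)" if n: "1 \<le> n" for n k
      proof -
        have s: "sin (of_int k * freq n) = 0" by (rule sin0[OF n])
        then have "(cos (of_int k * freq n))\<^sup>2 = 1" using sin_cos_squared_add[of "of_int k * freq n"] by simp
        moreover have "cos (of_int (k + h) * freq n) = cos (of_int k * freq n) * cos (of_int h * freq n)"
          using s by (simp add: distrib_right cos_add)
        ultimately show ?thesis by (simp add: power2_eq_square)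
      qed
      show "\<exists>Q. \<forall>n\<ge>1. \<forall>m. \<bar>\<Sum>k=1..m. ?c n (int k) * ?c n (int k + h) - a\<^sup>2 * cos (of_int h * freq n)\<bar> \<le> Q"
      proof (intro exI[of _ 0] allI impI)
        fix n m :: nat assume "1 \<le> n"
        show "\<bar>\<Sum>k=1..m. ?c n (int k) * ?c n (int k + h) - a\<^sup>2 * cos (of_int h * freq n)\<bar> \<le> 0"
          unfolding prod[OF \<open>1 \<le> n\<close>] by simp
      qed
    qed
    then show ?thesis using dft_combination[of a freq _ _ 0] by simp
  qed
  from weak_conv_m_chi_square[OF measurable_dft(1) this]
  show ?thesis
    by (simp only: normalized_periodogram_eq[where freq = freq, OF c0] dft_sin0 zero_power2 add_0_right)
qed

end

theorem corollary5:
  fixes M :: "'a measure"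
    and \<epsilon> \<epsilon>' :: "int \<Rightarrow> 'a \<Rightarrow> real"
    and r :: nat
    and d :: "nat \<Rightarrow> real"
    and G :: "nat \<Rightarrow> real \<Rightarrow> (nat \<Rightarrow> real) \<Rightarrow> real"
    and p :: nat
    and \<rho> :: real
    and freq :: "nat \<Rightarrow> real"
  defines "X \<equiv> pls_process r d G \<epsilon>"
    and "\<gamma> \<equiv> local_acov M r d G \<epsilon>"
    and "f \<equiv> local_spec M r d G \<epsilon>"
  assumes "prob_space M"
    and "iid_with_copy M \<epsilon> \<epsilon>'"
    and "break_points r d"
    and "measurable_filters r d G"
    and "\<And>n j. 1 \<le> j \<Longrightarrow> j \<le> n \<Longrightarrow> lp_norm M 2 (X n j) < \<top>"
    and "\<And>n j. 1 \<le> j \<Longrightarrow> j \<le> n \<Longrightarrow> prob_space.expectation M (X n j) = 0"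
    and "1 \<le> p"
    and "\<And>h k. k \<le> r \<Longrightarrow> Cp_on p {d k<..d (Suc k)} (\<lambda>t. \<gamma> t h)"
    and "0 \<le> \<rho>" and "\<rho> < 1"
    and "\<exists>K::real. \<forall>k. dependence_measure M r d G \<epsilon> \<epsilon>' k 4 \<le> ennreal (K * \<rho> ^ k)"
    and "\<exists>C::real. \<forall>k\<le>r. \<forall>t\<in>{d k..d (Suc k)}. \<forall>s\<in>{d k..d (Suc k)}.
           lp_norm M 4 (\<lambda>\<omega>. G k t (history \<epsilon> 0 \<omega>) - G k s (history \<epsilon> 0 \<omega>))
             \<le> ennreal (C * \<bar>t - s\<bar>)"
    and "\<exists>c>0. \<forall>n\<ge>1. \<forall>t\<in>{0..1}. c \<le> f t (freq n)"
  shows "((\<exists>l u. 0 < l \<and> u < pi \<and> (\<forall>n\<ge>1. l \<le> freq n \<and> freq n \<le> u)) \<longrightarrow>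
            weak_conv_m
              (\<lambda>n. distr M borel
                 (\<lambda>\<omega>. periodogram (X n) n (freq n) \<omega> / integral {0..1} (\<lambda>t. f t (freq n))))
              (exponential_dist 1))
       \<and> ((\<forall>n\<ge>1. freq n = 0 \<or> freq n = pi) \<longrightarrow>
            weak_conv_m
              (\<lambda>n. distr M borel
                 (\<lambda>\<omega>. periodogram (X n) n (freq n) \<omega> / integral {0..1} (\<lambda>t. f t (freq n))))
              chi_square_1)"
proof -
  interpret pls M \<epsilon> \<epsilon>' r d G \<rho>
    by (intro pls.intro iid_pair.intro iid_pair_axioms.intro pls_axioms.intro)
      (use assms(4-) in \<open>simp_all only: X_def\<close>)
  obtain c0 where c0: "0 < c0" "\<And>n t. 1 \<le> n \<Longrightarrow> t \<in> {0..1} \<Longrightarrow> c0 \<le> local_spec M r d G \<epsilon> t (freq n)"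
    using assms(16) unfolding f_def by blast
  show ?thesis
    unfolding X_def f_def
  proof (intro conjI impI)
    assume "\<exists>l u. 0 < l \<and> u < pi \<and> (\<forall>n\<ge>1. l \<le> freq n \<and> freq n \<le> u)"
    then obtain l u where lu: "0 < l" "u < pi" "\<And>n. 1 \<le> n \<Longrightarrow> l \<le> freq n \<and> freq n \<le> u" by blast
    show "weak_conv_m (\<lambda>n. distr M borel (\<lambda>\<omega>. periodogram (pls_process r d G \<epsilon> n) n (freq n) \<omega>
        / integral {0..1} (\<lambda>t. local_spec M r d G \<epsilon> t (freq n)))) (exponential_dist 1)"
      by (rule periodogram_exponential[where freq = freq, OF c0 lu])
  next
    assume "\<forall>n\<ge>1. freq n = 0 \<or> freq n = pi"
    then have freq: "\<And>n. 1 \<le> n \<Longrightarrow> freq n = 0 \<or> freq n = pi" by blast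
    show "weak_conv_m (\<lambda>n. distr M borel (\<lambda>\<omega>. periodogram (pls_process r d G \<epsilon> n) n (freq n) \<omega>
        / integral {0..1} (\<lambda>t. local_spec M r d G \<epsilon> t (freq n)))) chi_square_1"
      by (rule periodogram_chi_square[where freq = freq, OF c0 freq])
  qed
qed

end
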